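(* Let $\mathfrak{g}$ be a solvable Lie algebra of dimension $n$ over $\mathbb{C}$, and let $\mathbb{C}$ denote the trivial $\mathfrak{g}$-module. If $\lambda \in \hat{\mathfrak{g}}$ is in the Taylor spectrum $\sigma_{\mathfrak{g}}(\mathbb{C})$, then $\lambda$ is the sum of at most $n$ Jordan–Hölder values of $\mathfrak{g}$. Moreover, if $\lambda \in \sigma_{\mathfrak{g}}(\mathbb{C})$, then $2\rho - \lambda$ is also in $\sigma_{\mathfrak{g}}(\mathbb{C})$.
   Context: All Lie algebras are over $\mathbb{C}$. For a finite-dimensional Lie algebra $\mathfrak{g}$, $U\mathfrak{g}$ is its universal enveloping algebra and $\hat{\mathfrak{g}}$ is the set of isomorphism classes of simple finite-dimensional left $\mathfrak{g}$-modules. The Taylor spectrum of a left $\mathfrak{g}$-module $V$ is $$\sigma_{\mathfrak{g}}(V)=\{ S\in \hat{\mathfrak{g}} : \operatorname{Tor}^{U\mathfrak{g}}_k(S^*,V)\neq 0 \text{ for some } k\geq 0 \},$$ where $S^*$ is the dual vector space of $S$ with the right $\mathfrak{g}$-action $(f\cdot x)(s)=f(x\cdot s)$. For $\mathfrak{g}$ solvable, every simple finite-dimensional module is one-dimensional (Lie's theorem), and $\hat{\mathfrak{g}}$ is identified with the space of characters $(\mathfrak{g}/[\mathfrak{g},\mathfrak{g}])^*$, where $\lambda$ corresponds to the one-dimensional module $\mathbb{C}_\lambda$ on which $g$ acts by $\lambda(g)$. The set of weights $\omega(V)\subset\hat{\mathfrak{g}}$ of a finite-dimensional $\mathfrak{g}$-module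 $V$ is the set of diagonal matrix entries of the action in a triangular basis of $V$ (equivalently, the set of one-dimensional subquotients of $V$). The Jordan–Hölder values of $\mathfrak{g}$ are the elements of $\omega(\operatorname{ad}\mathfrak{g})$, the weights of the adjoint representation; in a sum of Jordan–Hölder values repetitions are allowed. The symbol $2\rho$ denotes the sum of all Jordan–Hölder values counted with multiplicities, i.e. the sum of all $n$ diagonal entries in a triangular basis of $\operatorname{ad}\mathfrak{g}$. *)

theory Defs
  imports Complex_Main "HOL-Library.Poly_Mapping" "HOL-Library.Function_Algebras"
begin

section \<open>Complex vector spaces and Lie algebras\<close>

class complex_vector = ab_group_add +
  fixes scaleC :: "complex \<Rightarrow> 'a \<Rightarrow> 'a" (infixr "*\<^sub>C" 75)
  assumes scaleC_add_right: "a *\<^sub>C (x + y) = a *\<^sub>C x + a *\<^sub>C y"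
    and scaleC_add_left: "(a + b) *\<^sub>C x = a *\<^sub>C x + b *\<^sub>C x"
    and scaleC_scaleC: "a *\<^sub>C (b *\<^sub>C x) = (a * b) *\<^sub>C x"
    and scaleC_one: "1 *\<^sub>C x = x"

global_interpretation complex_vector: vector_space "scaleC :: complex \<Rightarrow> 'a \<Rightarrow> 'a::complex_vector"
  by unfold_locales (simp_all add: scaleC_add_right scaleC_add_left scaleC_scaleC scaleC_one)

abbreviation clinear :: "('a::complex_vector \<Rightarrow> 'b::complex_vector) \<Rightarrow> bool"
  where "clinear \<equiv> Vector_Spaces.linear scaleC scaleC"

lemma clinearI:
  assumes "\<And>x y. f (x + y) = f x + f y" "\<And>c x. f (c *\<^sub>C x) = c *\<^sub>C f x"
  shows "clinear f"
  using assms by unfold_locales auto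

lemma clinear_add: "clinear f \<Longrightarrow> f (x + y) = f x + f y"
  and clinear_scale: "clinear f \<Longrightarrow> f (c *\<^sub>C x) = c *\<^sub>C f x"
  and clinear_zero: "clinear f \<Longrightarrow> f 0 = 0"
  and clinear_diff: "clinear f \<Longrightarrow> f (x - y) = f x - f y"
  and clinear_sum: "clinear f \<Longrightarrow> f (sum g A) = (\<Sum>a\<in>A. f (g a))"
proof -
  assume "clinear f"
  then interpret Vector_Spaces.linear scaleC scaleC f .
  show "f (x + y) = f x + f y" "f (c *\<^sub>C x) = c *\<^sub>C f x" "f 0 = 0" "f (x - y) = f x - f y"
    "f (sum g A) = (\<Sum>a\<in>A. f (g a))"
    by (simp_all add: add scale zero diff sum)
qed

definition finite_dimensional :: "'a::complex_vector itself \<Rightarrow> bool"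
  where "finite_dimensional _ \<longleftrightarrow> (\<exists>B::'a set. finite B \<and> complex_vector.span B = UNIV)"

instantiation complex :: complex_vector
begin
definition scaleC_complex :: "complex \<Rightarrow> complex \<Rightarrow> complex" where [simp]: "scaleC_complex c z = c * z"
instance by standard (simp_all add: algebra_simps)
end

class complex_lie_algebra = complex_vector +
  fixes bracket :: "'a \<Rightarrow> 'a \<Rightarrow> 'a"
  assumes bracket_add_left: "bracket (x + y) z = bracket x z + bracket y z"
    and bracket_add_right: "bracket x (y + z) = bracket x y + bracket x z"
    and bracket_scale_left: "bracket (c *\<^sub>C x) y = c *\<^sub>C bracket x y"
    and bracket_scale_right: "bracket x (c *\<^sub>C y) = c *\<^sub>C bracket x y"
    and bracket_self: "bracket x x = 0"
    and jacobi: "bracket x (bracket y z) + bracket y (bracket z x) + bracket z (bracket x y) = 0"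

primrec derived_series :: "nat \<Rightarrow> 'g::complex_lie_algebra set"
  where
    "derived_series 0 = UNIV"
  | "derived_series (Suc k) = complex_vector.span
      {bracket x y | x y. x \<in> derived_series k \<and> y \<in> derived_series k}"

definition solvable :: "'g::complex_lie_algebra itself \<Rightarrow> bool"
  where "solvable _ \<longleftrightarrow> (\<exists>k. (derived_series k :: 'g set) = {0})"

section \<open>Modules over a Lie algebra\<close>

definition lie_module :: "('g::complex_lie_algebra \<Rightarrow> 'v::complex_vector \<Rightarrow> 'v) \<Rightarrow> bool"
  where "lie_module \<rho> \<longleftrightarrow>
    (\<forall>x. clinear (\<rho> x)) \<and> (\<forall>v. clinear (\<lambda>x. \<rho> x v)) \<and>
    (\<forall>x y v. \<rho> (bracket x y) v = \<rho> x (\<rho> y v) - \<rho> y (\<rho> x v))"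

definition simple_module :: "('g::complex_lie_algebra \<Rightarrow> 'v::complex_vector \<Rightarrow> 'v) \<Rightarrow> bool"
  where "simple_module \<rho> \<longleftrightarrow> lie_module \<rho> \<and> (UNIV :: 'v set) \<noteq> {0} \<and>
    (\<forall>W. complex_vector.subspace W \<and> (\<forall>x. \<forall>w\<in>W. \<rho> x w \<in> W) \<longrightarrow> W = {0} \<or> W = UNIV)"

text \<open>Elements of \<open>(\<gg>/[\<gg>,\<gg>])\<^sup>*\<close>, regarded as functionals on \<open>\<gg>\<close>.\<close>

definition lie_character :: "('g::complex_lie_algebra \<Rightarrow> complex) \<Rightarrow> bool"
  where "lie_character \<chi> \<longleftrightarrow> clinear \<chi> \<and> (\<forall>x y. \<chi> (bracket x y) = 0)"

definition char_module :: "('g \<Rightarrow> complex) \<Rightarrow> 'g \<Rightarrow> complex \<Rightarrow> complex"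
  where "char_module \<chi> x z = \<chi> x * z"

definition trivial_module :: "'g \<Rightarrow> complex \<Rightarrow> complex"
  where "trivial_module x z = 0"

definition triangular_basis :: "('g \<Rightarrow> 'v::complex_vector \<Rightarrow> 'v) \<Rightarrow> 'v list \<Rightarrow> bool"
  where "triangular_basis \<rho> bs \<longleftrightarrow>
    distinct bs \<and> complex_vector.independent (set bs) \<and> complex_vector.span (set bs) = UNIV \<and>
    (\<forall>x. \<forall>j<length bs. \<rho> x (bs ! j) \<in> complex_vector.span (set (take (Suc j) bs)))"

definition diagonal_entry :: "('g \<Rightarrow> 'v::complex_vector \<Rightarrow> 'v) \<Rightarrow> 'v list \<Rightarrow> nat \<Rightarrow> 'g \<Rightarrow> complex"
  where "diagonal_entry \<rho> bs j x =
    complex_vector.representation (set bs) (\<rho> x (bs ! j)) (bs ! j)"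

definition weights :: "('g \<Rightarrow> 'v::complex_vector \<Rightarrow> 'v) \<Rightarrow> ('g \<Rightarrow> complex) set"
  where "weights \<rho> = {\<chi>. \<exists>bs j. triangular_basis \<rho> bs \<and> j < length bs \<and> \<chi> = diagonal_entry \<rho> bs j}"

definition jordan_hoelder_values :: "('g::complex_lie_algebra \<Rightarrow> complex) set"
  where "jordan_hoelder_values = weights (bracket :: 'g \<Rightarrow> 'g \<Rightarrow> 'g)"

text \<open>For solvable finite-dimensional \<open>\<gg>\<close> a triangular basis of the adjoint module exists by Lie's
  theorem, and the sum of its diagonal entries is the trace of the adjoint module, so it does not
  depend on the chosen basis.\<close>

definition two_rho :: "'g::complex_lie_algebra \<Rightarrow> complex"
  where "two_rho =
    (let bs = (SOME bs. triangular_basis (bracket :: 'g \<Rightarrow> 'g \<Rightarrow> 'g) bs)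
     in \<Sum>j<length bs. diagonal_entry bracket bs j)"

section \<open>The universal enveloping algebra\<close>

datatype 'a word = Word (letters: "'a list")

instantiation word :: (type) monoid_add
begin
definition zero_word :: "'a word" where "0 = Word []"
definition plus_word :: "'a word \<Rightarrow> 'a word \<Rightarrow> 'a word" where "u + w = Word (letters u @ letters w)"
instance by standard (simp_all add: zero_word_def plus_word_def)
end

text \<open>\<open>'g word \<Rightarrow>\<^sub>0 complex\<close> is the free unital associative algebra on the set \<open>'g\<close>. The first two
  families of relations turn it into the tensor algebra of the vector space \<open>'g\<close>.\<close>

abbreviation word_of :: "'a list \<Rightarrow> ('a word \<Rightarrow>\<^sub>0 complex)"
  where "word_of xs \<equiv> Poly_Mapping.single (Word xs) 1"

inductive_set uea_ideal :: "('g::complex_lie_algebra word \<Rightarrow>\<^sub>0 complex) set"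
  where
    gen_add: "word_of [x + y] - word_of [x] - word_of [y] \<in> uea_ideal"
  | gen_scale: "word_of [c *\<^sub>C x] - Poly_Mapping.single (Word [x]) c \<in> uea_ideal"
  | gen_bracket: "word_of [x, y] - word_of [y, x] - word_of [bracket x y] \<in> uea_ideal"
  | zero: "0 \<in> uea_ideal"
  | add: "a \<in> uea_ideal \<Longrightarrow> b \<in> uea_ideal \<Longrightarrow> a + b \<in> uea_ideal"
  | mult_left: "a \<in> uea_ideal \<Longrightarrow> p * a \<in> uea_ideal"
  | mult_right: "a \<in> uea_ideal \<Longrightarrow> a * p \<in> uea_ideal"

lemma uea_ideal_eq: "p = q \<Longrightarrow> p - q \<in> uea_ideal"
  by (simp add: uea_ideal.zero)

lemma uea_ideal_uminus: "a \<in> uea_ideal \<Longrightarrow> - a \<in> uea_ideal"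
  using uea_ideal.mult_left[of a "- 1"] by simp

lemma uea_ideal_uminus_diff: "a - b \<in> uea_ideal \<Longrightarrow> b - a \<in> uea_ideal"
  using uea_ideal_uminus[of "a - b"] by simp

quotient_type (overloaded) 'g uea = "'g::complex_lie_algebra word \<Rightarrow>\<^sub>0 complex" / "\<lambda>p q. p - q \<in> uea_ideal"
proof (rule equivpI)
  show "reflp (\<lambda>p q. p - q \<in> uea_ideal)"
    by (simp add: reflp_def uea_ideal.zero)
  show "symp (\<lambda>p q. p - q \<in> uea_ideal)"
    using uea_ideal_uminus_diff by (auto simp: symp_def)
  show "transp (\<lambda>p q. p - q \<in> uea_ideal)"
    unfolding transp_def using uea_ideal.add by fastforce
qed

lift_definition uea_incl :: "'g::complex_lie_algebra \<Rightarrow> 'g uea" is "\<lambda>x. word_of [x]" .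

subsection \<open>The action of the enveloping algebra on a Lie algebra module\<close>

definition free_act ::
    "('g \<Rightarrow> 'v::complex_vector \<Rightarrow> 'v) \<Rightarrow> ('g word \<Rightarrow>\<^sub>0 complex) \<Rightarrow> 'v \<Rightarrow> 'v"
  where "free_act \<rho> p v =
    (\<Sum>w\<in>Poly_Mapping.keys p. Poly_Mapping.lookup p w *\<^sub>C foldr \<rho> (letters w) v)"

lemma poly_mapping_single_plus_induct [case_names zero single_plus]:
  fixes p :: "'a \<Rightarrow>\<^sub>0 'b::ab_group_add"
  assumes zero: "P 0"
    and single_plus: "\<And>k b p. P p \<Longrightarrow> P (Poly_Mapping.single k b + p)"
  shows "P p"
proof (induction "card (Poly_Mapping.keys p)" arbitrary: p)
  case 0
  then have "p = 0" by simp
  then show ?case using zero by simp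
next
  case (Suc n)
  then obtain k where k: "k \<in> Poly_Mapping.keys p"
    by (metis card.empty equals0I nat.distinct(1))
  let ?q = "p - Poly_Mapping.single k (Poly_Mapping.lookup p k)"
  have "Poly_Mapping.keys ?q = Poly_Mapping.keys p - {k}"
    by (auto simp: in_keys_iff lookup_minus lookup_single when_def split: if_splits)
  then have "n = card (Poly_Mapping.keys ?q)"
    using k Suc.hyps(2) by (simp add: card_Diff_singleton)
  then have "P (Poly_Mapping.single k (Poly_Mapping.lookup p k) + ?q)"
    using Suc.hyps(1) single_plus by blast
  then show ?case by simp
qed

lemma sum_keys_add:
  assumes "\<And>k. f k 0 = 0" "\<And>k a b. f k (a + b) = f k a + f k b"
  shows "(\<Sum>k\<in>Poly_Mapping.keys (p + q). f k (Poly_Mapping.lookup (p + q) k)) =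
    (\<Sum>k\<in>Poly_Mapping.keys p. f k (Poly_Mapping.lookup p k)) +
    (\<Sum>k\<in>Poly_Mapping.keys q. f k (Poly_Mapping.lookup q k) :: 'c::ab_group_add)"
  using assms by (intro setsum_keys_plus_distrib) auto

lemma sum_keys_single:
  assumes "\<And>k. f k 0 = (0::'c::ab_group_add)"
  shows "(\<Sum>k\<in>Poly_Mapping.keys (Poly_Mapping.single i b). f k (Poly_Mapping.lookup (Poly_Mapping.single i b) k)) = f i b"
  using assms by (cases "b = 0") auto

lemma free_act_zero [simp]: "free_act \<rho> 0 v = 0"
  by (simp add: free_act_def)

lemma free_act_add: "free_act \<rho> (p + q) v = free_act \<rho> p v + free_act \<rho> q v"
  unfolding free_act_def by (rule sum_keys_add) (simp_all add: scaleC_add_left)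

lemma free_act_diff: "free_act \<rho> (p - q) v = free_act \<rho> p v - free_act \<rho> q v"
  by (metis add_diff_cancel_right' diff_add_cancel free_act_add)

lemma free_act_single: "free_act \<rho> (Poly_Mapping.single (Word xs) c) v = c *\<^sub>C foldr \<rho> xs v"
  unfolding free_act_def by (subst sum_keys_single) simp_all

lemma free_act_one:
  fixes \<rho> :: "'a \<Rightarrow> 'v::complex_vector \<Rightarrow> 'v"
  shows "free_act \<rho> 1 v = v"
proof -
  have one: "(1 :: 'a word \<Rightarrow>\<^sub>0 complex) = Poly_Mapping.single (Word []) 1"
    by (simp flip: single_one zero_word_def)
  show ?thesis by (subst one, subst free_act_single) (simp add: scaleC_one)
qed

lemma foldr_clinear: "(\<And>x. clinear (\<rho> x)) \<Longrightarrow> clinear (foldr \<rho> xs)"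
proof (induction xs)
  case Nil
  show ?case by (rule clinearI) simp_all
next
  case (Cons x xs)
  then show ?case by (intro clinearI) (simp_all add: clinear_add clinear_scale)
qed

lemma free_act_clinear: "(\<And>x. clinear (\<rho> x)) \<Longrightarrow> clinear (free_act \<rho> p)"
  unfolding free_act_def
  by (intro clinearI)
    (simp_all add: clinear_add[OF foldr_clinear] clinear_scale[OF foldr_clinear] scaleC_add_right
      scaleC_scaleC sum.distrib complex_vector.scale_sum_right mult.commute)

lemma free_act_mult:
  assumes lin: "\<And>x. clinear (\<rho> x)"
  shows "free_act \<rho> (p * q) v = free_act \<rho> p (free_act \<rho> q v)"
proof (induction p rule: poly_mapping_single_plus_induct)
  case zero
  then show ?case by simp
next
  case (single_plus u b p)
  have "free_act \<rho> (Poly_Mapping.single u b * q) v = free_act \<rho> (Poly_Mapping.single u b) (free_act \<rho> q v)"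
  proof (induction q rule: poly_mapping_single_plus_induct)
    case zero
    then show ?case by (simp add: clinear_zero[OF free_act_clinear[OF lin]])
  next
    case (single_plus w c q)
    have "free_act \<rho> (Poly_Mapping.single u b * Poly_Mapping.single w c) v =
        free_act \<rho> (Poly_Mapping.single u b) (free_act \<rho> (Poly_Mapping.single w c) v)"
      by (cases u; cases w)
        (simp add: mult_single plus_word_def free_act_single clinear_scale[OF foldr_clinear[OF lin]] scaleC_scaleC)
    with single_plus show ?case
      by (simp add: distrib_left free_act_add clinear_add[OF free_act_clinear[OF lin]])
  qed
  with single_plus show ?case
    by (simp add: distrib_right free_act_add)
qed

lemma free_act_ideal:
  assumes \<rho>: "lie_module \<rho>" and "a \<in> uea_ideal"
  shows "free_act \<rho> a v = 0"
  using assms(2)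
proof (induction a arbitrary: v)
  case (gen_add x y)
  have "clinear (\<lambda>x. \<rho> x v)" using \<rho> by (simp add: lie_module_def)
  from clinear_add[OF this] show ?case
    by (simp add: free_act_diff free_act_single scaleC_one)
next
  case (gen_scale c x)
  have "clinear (\<lambda>x. \<rho> x v)" using \<rho> by (simp add: lie_module_def)
  from clinear_scale[OF this] show ?case
    by (simp add: free_act_diff free_act_single scaleC_one)
next
  case (gen_bracket x y)
  show ?case using \<rho> by (simp add: lie_module_def free_act_diff free_act_single scaleC_one)
next
  case (mult_left a p)
  then show ?case using \<rho>
    by (simp add: free_act_mult lie_module_def clinear_zero[OF free_act_clinear])
next
  case (mult_right a p)
  then show ?case using \<rho> by (simp add: free_act_mult lie_module_def)
qed (simp_all add: free_act_add)

lemma trivial_lie_module: "lie_module (trivial_module :: 'g::complex_lie_algebra \<Rightarrow> _)"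
  unfolding lie_module_def trivial_module_def by (auto intro!: clinearI)

instantiation uea :: (complex_lie_algebra) ring_1
begin

lift_definition zero_uea :: "'a uea" is 0 .
lift_definition one_uea :: "'a uea" is 1 .
lift_definition plus_uea :: "'a uea \<Rightarrow> 'a uea \<Rightarrow> 'a uea" is "(+)"
  using uea_ideal.add by (metis add_diff_add)
lift_definition minus_uea :: "'a uea \<Rightarrow> 'a uea \<Rightarrow> 'a uea" is "(-)"
proof -
  fix p p' q q' :: "'a word \<Rightarrow>\<^sub>0 complex"
  assume "p - p' \<in> uea_ideal" "q - q' \<in> uea_ideal"
  then have "(p - p') + (q' - q) \<in> uea_ideal"
    using uea_ideal.add uea_ideal_uminus_diff by blast
  moreover have "(p - p') + (q' - q) = p - q - (p' - q')" by simp
  ultimately show "p - q - (p' - q') \<in> uea_ideal" by metis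
qed
lift_definition uminus_uea :: "'a uea \<Rightarrow> 'a uea" is "uminus"
  by (metis minus_diff_minus uea_ideal_uminus)
lift_definition times_uea :: "'a uea \<Rightarrow> 'a uea \<Rightarrow> 'a uea" is "(*)"
proof -
  fix p p' q q' :: "'a word \<Rightarrow>\<^sub>0 complex"
  assume "p - p' \<in> uea_ideal" "q - q' \<in> uea_ideal"
  then have "(p - p') * q + p' * (q - q') \<in> uea_ideal"
    by (intro uea_ideal.add uea_ideal.mult_left uea_ideal.mult_right)
  moreover have "(p - p') * q + p' * (q - q') = p * q - p' * q'"
    by (simp add: left_diff_distrib right_diff_distrib)
  ultimately show "p * q - p' * q' \<in> uea_ideal" by metis
qed

instance
proof
  fix a b c :: "'a uea"
  show "a + b + c = a + (b + c)" by transfer (rule uea_ideal_eq, rule add.assoc)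
  show "a + b = b + a" by transfer (rule uea_ideal_eq, rule add.commute)
  show "0 + a = a" by transfer (rule uea_ideal_eq, simp)
  show "- a + a = 0" by transfer (rule uea_ideal_eq, simp)
  show "a - b = a + - b" by transfer (rule uea_ideal_eq, simp)
  show "a * b * c = a * (b * c)" by transfer (rule uea_ideal_eq, rule mult.assoc)
  show "(a + b) * c = a * c + b * c" by transfer (rule uea_ideal_eq, rule distrib_right)
  show "a * (b + c) = a * b + a * c" by transfer (rule uea_ideal_eq, rule distrib_left)
  show "1 * a = a" by transfer (rule uea_ideal_eq, simp)
  show "a * 1 = a" by transfer (rule uea_ideal_eq, simp)
  show "(0::'a uea) \<noteq> 1"
  proof transfer
    have "free_act trivial_module (0 - 1 :: 'a word \<Rightarrow>\<^sub>0 complex) (1::complex) \<noteq> 0"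
      by (simp only: free_act_diff free_act_one free_act_zero) simp
    then show "(0 :: 'a word \<Rightarrow>\<^sub>0 complex) - 1 \<notin> uea_ideal"
      using free_act_ideal[OF trivial_lie_module, of "0 - 1" 1] by metis
  qed
qed

end

text \<open>Independent of the chosen representative of \<open>u\<close> whenever \<open>\<rho>\<close> is a Lie algebra module.\<close>

definition uea_act ::
    "('g::complex_lie_algebra \<Rightarrow> 'v::complex_vector \<Rightarrow> 'v) \<Rightarrow> 'g uea \<Rightarrow> 'v \<Rightarrow> 'v"
  where "uea_act \<rho> u = free_act \<rho> (rep_uea u)"

lemma uea_act_abs: "lie_module \<rho> \<Longrightarrow> uea_act \<rho> (abs_uea p) v = free_act \<rho> p v"
proof -
  assume \<rho>: "lie_module \<rho>"
  have "rep_uea (abs_uea p) - p \<in> uea_ideal"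
    using Quotient_rep_abs[OF Quotient_uea, of p] by (simp add: uea_ideal.zero)
  from free_act_ideal[OF \<rho> this] show ?thesis
    by (simp add: uea_act_def free_act_diff)
qed

lemma uea_act_incl: "lie_module \<rho> \<Longrightarrow> uea_act \<rho> (uea_incl x) v = \<rho> x v"
  unfolding uea_incl.abs_eq by (simp add: uea_act_abs free_act_single scaleC_one)

section \<open>Tor\<close>

definition left_module :: "('r::ring_1 \<Rightarrow> 'v::ab_group_add \<Rightarrow> 'v) \<Rightarrow> bool"
  where "left_module act \<longleftrightarrow>
    (\<forall>r v w. act r (v + w) = act r v + act r w) \<and> (\<forall>r s v. act (r + s) v = act r v + act s v) \<and>
    (\<forall>r s v. act (r * s) v = act r (act s v)) \<and> (\<forall>v. act 1 v = v)"

lemma uea_cases: obtains p where "u = abs_uea p"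
  using Quotient_abs_rep[OF Quotient_uea, of u] by metis

lemma left_module_uea_act:
  assumes "lie_module \<rho>"
  shows "left_module (uea_act \<rho>)"
proof -
  have lin: "clinear (\<rho> x)" for x using assms by (simp add: lie_module_def)
  have "uea_act \<rho> u (v + w) = uea_act \<rho> u v + uea_act \<rho> u w" for u v w
    by (simp add: uea_act_def clinear_add[OF free_act_clinear[OF lin]])
  moreover have "uea_act \<rho> (r + s) v = uea_act \<rho> r v + uea_act \<rho> s v" for r s v
    by (cases r rule: uea_cases; cases s rule: uea_cases)
      (simp add: plus_uea.abs_eq uea_act_abs[OF assms] free_act_add)
  moreover have "uea_act \<rho> (r * s) v = uea_act \<rho> r (uea_act \<rho> s v)" for r s v
    by (cases r rule: uea_cases; cases s rule: uea_cases)
      (simp add: times_uea.abs_eq uea_act_abs[OF assms] free_act_mult[OF lin])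
  moreover have "uea_act \<rho> 1 v = v" for v
    by (simp add: one_uea.abs_eq uea_act_abs[OF assms] free_act_one)
  ultimately show ?thesis unfolding left_module_def by blast
qed

subsection \<open>Free resolutions\<close>

text \<open>\<open>free_mod I\<close> with the operation \<open>smult\<close> is the free left module with basis \<open>I\<close>.\<close>

definition free_mod :: "'i set \<Rightarrow> ('i \<Rightarrow>\<^sub>0 'r::ring_1) set"
  where "free_mod I = {p. Poly_Mapping.keys p \<subseteq> I}"

definition smult :: "'r::ring_1 \<Rightarrow> ('i \<Rightarrow>\<^sub>0 'r) \<Rightarrow> ('i \<Rightarrow>\<^sub>0 'r)"
  where "smult r = Poly_Mapping.map ((*) r)"

definition linear_on ::
    "'a::ab_group_add set \<Rightarrow> ('r \<Rightarrow> 'a \<Rightarrow> 'a) \<Rightarrow> ('r \<Rightarrow> 'b::ab_group_add \<Rightarrow> 'b) \<Rightarrow> ('a \<Rightarrow> 'b) \<Rightarrow> bool"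
  where "linear_on P s t f \<longleftrightarrow>
    (\<forall>p\<in>P. \<forall>q\<in>P. f (p + q) = f p + f q) \<and> (\<forall>r. \<forall>p\<in>P. f (s r p) = t r (f p))"

text \<open>A sequence \<open>\<dots> \<rightarrow> F 2 \<rightarrow> F 1 \<rightarrow> F 0 \<rightarrow> V \<rightarrow> 0\<close>, where \<open>F k = free_mod (res_gens k)\<close>,
  \<open>res_diff k : F (k + 1) \<rightarrow> F k\<close> and \<open>res_aug : F 0 \<rightarrow> V\<close>.\<close>

record (overloaded) ('i, 'r, 'v) resolution =
  res_gens :: "nat \<Rightarrow> 'i set"
  res_diff :: "nat \<Rightarrow> ('i \<Rightarrow>\<^sub>0 'r) \<Rightarrow> ('i \<Rightarrow>\<^sub>0 'r)"
  res_aug :: "('i \<Rightarrow>\<^sub>0 'r) \<Rightarrow> 'v"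

definition free_resolution ::
    "('r::ring_1 \<Rightarrow> 'v::ab_group_add \<Rightarrow> 'v) \<Rightarrow> ('i, 'r, 'v) resolution \<Rightarrow> bool"
  where "free_resolution act R \<longleftrightarrow>
    (let F = (\<lambda>k. free_mod (res_gens R k)); d = res_diff R; \<epsilon> = res_aug R in
      linear_on (F 0) smult act \<epsilon> \<and> \<epsilon> ` F 0 = UNIV \<and>
      (\<forall>k. linear_on (F (Suc k)) smult smult (d k)) \<and>
      d 0 ` F 1 = {p \<in> F 0. \<epsilon> p = 0} \<and>
      (\<forall>k. d (Suc k) ` F (Suc (Suc k)) = {p \<in> F (Suc k). d k p = 0}))"

text \<open>An index type that is large enough to carry a free resolution of every left module \<open>'v\<close> over
  every ring \<open>'r\<close>: the generators in degree \<open>0\<close> are the elements of \<open>'v\<close>, and those in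
  degree \<open>k + 1\<close> are linear combinations, as expressions, of generators in degree \<open>k\<close>.\<close>

datatype ('v, 'r) generator = Base 'v | Comb "(('v, 'r) generator \<times> 'r) list"

definition free_extend :: "('r \<Rightarrow> 'b \<Rightarrow> 'b) \<Rightarrow> ('i \<Rightarrow> 'b) \<Rightarrow> ('i \<Rightarrow>\<^sub>0 'r::ring_1) \<Rightarrow> 'b::ab_group_add"
  where "free_extend t h p = (\<Sum>i\<in>Poly_Mapping.keys p. t (Poly_Mapping.lookup p i) (h i))"

lemma left_module_zero: "left_module act \<Longrightarrow> act 0 v = 0"
  unfolding left_module_def by (metis add_cancel_right_right add.right_neutral)

lemma left_module_zero_right: "left_module act \<Longrightarrow> act r 0 = 0"
  unfolding left_module_def by (metis add_cancel_right_right add.right_neutral)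

lemma lookup_smult: "Poly_Mapping.lookup (smult r p) i = r * Poly_Mapping.lookup p i"
  unfolding smult_def by transfer (simp add: when_def)

lemma smult_single: "smult r (Poly_Mapping.single i s) = Poly_Mapping.single i (r * s)"
  by (rule poly_mapping_eqI) (simp add: lookup_smult lookup_single when_def)

lemma left_module_smult: "left_module (smult :: 'r::ring_1 \<Rightarrow> ('i \<Rightarrow>\<^sub>0 'r) \<Rightarrow> _)"
  unfolding left_module_def
  by (auto intro!: poly_mapping_eqI simp: lookup_smult lookup_add algebra_simps)

lemma free_extend_single:
  "left_module t \<Longrightarrow> free_extend t h (Poly_Mapping.single i r) = t r (h i)"
  unfolding free_extend_def by (subst sum_keys_single) (simp_all add: left_module_zero)

lemma free_extend_add:
  "left_module t \<Longrightarrow> free_extend t h (p + q) = free_extend t h p + free_extend t h q"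
  unfolding free_extend_def
  by (rule sum_keys_add) (simp_all add: left_module_zero, simp add: left_module_def)

lemma free_extend_smult:
  assumes t: "left_module t"
  shows "free_extend t h (smult r p) = t r (free_extend t h p)"
proof (induction p rule: poly_mapping_single_plus_induct)
  case zero
  then show ?case
    by (simp add: left_module_zero_right[OF left_module_smult] left_module_zero_right[OF t] free_extend_def)
next
  case (single_plus k b p)
  have "smult r (Poly_Mapping.single k b + p) = Poly_Mapping.single k (r * b) + smult r p"
    by (rule poly_mapping_eqI) (simp add: lookup_smult lookup_add lookup_single when_def algebra_simps)
  with single_plus t show ?case
    by (simp add: free_extend_add free_extend_single) (simp add: left_module_def)
qed

lemma linear_on_free_extend: "left_module t \<Longrightarrow> linear_on P smult t (free_extend t h)"
  by (simp add: linear_on_def free_extend_add free_extend_smult)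

definition comb_value :: "('i \<times> 'r::ring_1) list \<Rightarrow> ('i \<Rightarrow>\<^sub>0 'r)"
  where "comb_value l = (\<Sum>(i, r)\<leftarrow>l. Poly_Mapping.single i r)"

lemma comb_value_surj: "\<exists>l. comb_value l = p"
proof (induction p rule: poly_mapping_single_plus_induct)
  case zero
  have "comb_value [] = 0" by (simp add: comb_value_def)
  then show ?case by blast
next
  case (single_plus k b p)
  then obtain l where "comb_value l = p" by blast
  then have "comb_value ((k, b) # l) = Poly_Mapping.single k b + p" by (simp add: comb_value_def)
  then show ?case by blast
qed

definition free_cover_diff :: "(('v, 'r) generator \<Rightarrow>\<^sub>0 'r) \<Rightarrow> (('v, 'r::ring_1) generator \<Rightarrow>\<^sub>0 'r)"
  where "free_cover_diff = free_extend smult (\<lambda>g. case g of Base v \<Rightarrow> 0 | Comb l \<Rightarrow> comb_value l)"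

definition free_cover_aug :: "('r \<Rightarrow> 'v \<Rightarrow> 'v) \<Rightarrow> (('v, 'r) generator \<Rightarrow>\<^sub>0 'r::ring_1) \<Rightarrow> 'v::ab_group_add"
  where "free_cover_aug act = free_extend act (\<lambda>g. case g of Base v \<Rightarrow> v | Comb l \<Rightarrow> 0)"

primrec free_cover_gens :: "('r::ring_1 \<Rightarrow> 'v::ab_group_add \<Rightarrow> 'v) \<Rightarrow> nat \<Rightarrow> ('v, 'r) generator set"
  where
    "free_cover_gens act 0 = range Base"
  | "free_cover_gens act (Suc k) =
      {Comb l | l. comb_value l \<in> free_mod (free_cover_gens act k) \<and>
        (if k = 0 then free_cover_aug act (comb_value l) = 0 else free_cover_diff (comb_value l) = 0)}"

lemma linear_on_kernel_image:
  assumes "left_module t" and p: "p \<in> free_mod I" and h: "\<And>i. i \<in> I \<Longrightarrow> h i \<in> K"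
    and K: "0 \<in> K" "\<And>a b. a \<in> K \<Longrightarrow> b \<in> K \<Longrightarrow> a + b \<in> K" "\<And>r a. a \<in> K \<Longrightarrow> t r a \<in> K"
  shows "free_extend t h p \<in> K"
  unfolding free_extend_def
proof -
  have "(\<Sum>i\<in>A. t (Poly_Mapping.lookup p i) (h i)) \<in> K" if "finite A" "A \<subseteq> I" for A
    using that by (induction A rule: finite_induct) (auto intro: K h)
  then show "(\<Sum>i\<in>Poly_Mapping.keys p. t (Poly_Mapping.lookup p i) (h i)) \<in> K"
    using p by (simp add: free_mod_def)
qed

lemma zero_in_free_mod: "0 \<in> free_mod I"
  by (simp add: free_mod_def)

lemma add_in_free_mod: "a \<in> free_mod I \<Longrightarrow> b \<in> free_mod I \<Longrightarrow> a + b \<in> free_mod I"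
  by (simp add: free_mod_def) (meson keys_add Un_least subset_trans)

lemma smult_in_free_mod: "a \<in> free_mod I \<Longrightarrow> smult r a \<in> free_mod I"
  by (auto simp: free_mod_def subset_iff in_keys_iff lookup_smult dest: mult_not_zero)

lemma free_resolution_exists:
  assumes act: "left_module act"
  shows "\<exists>R :: (('v::ab_group_add, 'r::ring_1) generator, 'r, 'v) resolution. free_resolution act R"
proof -
  note sm = left_module_smult
  let ?F = "\<lambda>k. free_mod (free_cover_gens act k)"
  let ?d = "free_cover_diff :: (('v, 'r) generator \<Rightarrow>\<^sub>0 'r) \<Rightarrow> _"
  let ?K = "\<lambda>k. {p \<in> ?F k. if k = 0 then free_cover_aug act p = 0 else ?d p = 0}"
  let ?e = "free_cover_aug act"
  have d_add: "?d (p + q) = ?d p + ?d q" and d_sm: "?d (smult r p) = smult r (?d p)" for p q r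
    by (simp_all add: free_cover_diff_def free_extend_add[OF sm] free_extend_smult[OF sm])
  have e_add: "?e (p + q) = ?e p + ?e q" and e_sm: "?e (smult r p) = act r (?e p)" for p q r
    by (simp_all add: free_cover_aug_def free_extend_add[OF act] free_extend_smult[OF act])
  have z: "?d 0 = 0" "?e 0 = 0"
    by (simp_all add: free_cover_diff_def free_cover_aug_def free_extend_def)
  have K: "0 \<in> ?K k" "\<And>a b. a \<in> ?K k \<Longrightarrow> b \<in> ?K k \<Longrightarrow> a + b \<in> ?K k"
    "\<And>r a. a \<in> ?K k \<Longrightarrow> smult r a \<in> ?K k" for k
    by (auto simp: zero_in_free_mod add_in_free_mod smult_in_free_mod d_add d_sm e_add e_sm z
        left_module_zero_right[OF sm] left_module_zero_right[OF act])
  have sub: "?d p \<in> ?K k" if "p \<in> ?F (Suc k)" for p k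
  proof -
    let ?h = "\<lambda>g. case g of Base v \<Rightarrow> 0 | Comb l \<Rightarrow> comb_value l"
    have "?h g \<in> ?K k" if "g \<in> free_cover_gens act (Suc k)" for g
      using that by (cases "k = 0") auto
    then have "free_extend smult ?h p \<in> ?K k"
      using linear_on_kernel_image[OF sm that _ K] by blast
    then show ?thesis by (simp only: free_cover_diff_def)
  qed
  have sup: "p \<in> ?d ` ?F (Suc k)" if p: "p \<in> ?K k" for p k
  proof -
    obtain l where l: "comb_value l = p" using comb_value_surj by blast
    have one: "smult 1 q = q" for q :: "('v, 'r) generator \<Rightarrow>\<^sub>0 'r"
      by (rule poly_mapping_eqI) (simp add: lookup_smult)
    have "Poly_Mapping.single (Comb l) 1 \<in> ?F (Suc k)"
      using p l by (auto simp: free_mod_def)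
    moreover have "?d (Poly_Mapping.single (Comb l) 1) = p"
      by (simp add: free_cover_diff_def free_extend_single[OF sm] l one)
    ultimately show ?thesis by (metis imageI)
  qed
  have ex: "?d ` ?F (Suc k) = ?K k" for k
    using sub sup by blast
  have surj: "v \<in> ?e ` ?F 0" for v
  proof -
    have "Poly_Mapping.single (Base v) 1 \<in> ?F 0" by (simp add: free_mod_def)
    moreover have "?e (Poly_Mapping.single (Base v) 1) = v"
      using act by (simp add: free_cover_aug_def free_extend_single[OF act] left_module_def)
    ultimately show ?thesis by (metis imageI)
  qed
  have "?d ` ?F 1 = {p \<in> ?F 0. ?e p = 0}" using ex[of 0] by (simp only: if_True One_nat_def refl)
  moreover have "?d ` ?F (Suc (Suc k)) = {p \<in> ?F (Suc k). ?d p = 0}" for k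
    using ex[of "Suc k"] by (simp only: nat.distinct if_False)
  moreover have "?e ` ?F 0 = UNIV" using surj by blast
  moreover have "linear_on (?F 0) smult act ?e"
    by (simp add: free_cover_aug_def linear_on_free_extend[OF act])
  moreover have "linear_on (?F (Suc k)) smult smult ?d" for k
    by (simp add: free_cover_diff_def linear_on_free_extend[OF sm])
  ultimately have "free_resolution act \<lparr>res_gens = free_cover_gens act, res_diff = \<lambda>_. ?d, res_aug = ?e\<rparr>"
    unfolding free_resolution_def Let_def resolution.simps by blast
  then show ?thesis ..
qed

definition chosen_resolution ::
    "('r::ring_1 \<Rightarrow> 'v::ab_group_add \<Rightarrow> 'v) \<Rightarrow> (('v, 'r) generator, 'r, 'v) resolution"
  where "chosen_resolution act = (SOME R. free_resolution act R)"

lemma free_resolution_chosen: "left_module act \<Longrightarrow> free_resolution act (chosen_resolution act)"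
  unfolding chosen_resolution_def using someI_ex[OF free_resolution_exists] .

subsection \<open>Tensor products and homology\<close>

text \<open>The tensor product of a right module \<open>M\<close> (with action \<open>ract\<close>) and a left module \<open>P\<close> is the
  free abelian group \<open>tensor_free M P\<close> on \<open>M \<times> P\<close> modulo \<open>tensor_rel M ract P s\<close>.\<close>

definition tensor_free :: "'m set \<Rightarrow> 'p set \<Rightarrow> ('m \<times> 'p \<Rightarrow>\<^sub>0 int) set"
  where "tensor_free M P = {z. Poly_Mapping.keys z \<subseteq> M \<times> P}"

inductive_set tensor_rel ::
    "'m::ab_group_add set \<Rightarrow> ('m \<Rightarrow> 'r \<Rightarrow> 'm) \<Rightarrow> 'p::ab_group_add set \<Rightarrow> ('r \<Rightarrow> 'p \<Rightarrow> 'p) \<Rightarrow> ('m \<times> 'p \<Rightarrow>\<^sub>0 int) set"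
  for M ract P s
  where
    add_left: "m \<in> M \<Longrightarrow> m' \<in> M \<Longrightarrow> p \<in> P \<Longrightarrow>
      frag_of (m + m', p) - frag_of (m, p) - frag_of (m', p) \<in> tensor_rel M ract P s"
  | add_right: "m \<in> M \<Longrightarrow> p \<in> P \<Longrightarrow> p' \<in> P \<Longrightarrow>
      frag_of (m, p + p') - frag_of (m, p) - frag_of (m, p') \<in> tensor_rel M ract P s"
  | balanced: "m \<in> M \<Longrightarrow> p \<in> P \<Longrightarrow>
      frag_of (ract m r, p) - frag_of (m, s r p) \<in> tensor_rel M ract P s"
  | zero: "0 \<in> tensor_rel M ract P s"
  | diff: "a \<in> tensor_rel M ract P s \<Longrightarrow> b \<in> tensor_rel M ract P s \<Longrightarrow> a - b \<in> tensor_rel M ract P s"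

definition tensor_map :: "('p \<Rightarrow> 'q) \<Rightarrow> ('m \<times> 'p \<Rightarrow>\<^sub>0 int) \<Rightarrow> ('m \<times> 'q \<Rightarrow>\<^sub>0 int)"
  where "tensor_map f = frag_extend (\<lambda>(m, p). frag_of (m, f p))"

text \<open>The preimages in \<open>tensor_free M (F k)\<close> of the \<open>k\<close>-cycles and of the \<open>k\<close>-boundaries of the
  complex obtained from the resolution by deleting the augmentation and tensoring with \<open>M\<close>.\<close>

definition tensor_cycles ::
    "nat \<Rightarrow> 'm::ab_group_add set \<Rightarrow> ('m \<Rightarrow> 'r::ring_1 \<Rightarrow> 'm) \<Rightarrow> ('i, 'r, 'v) resolution
      \<Rightarrow> ('m \<times> ('i \<Rightarrow>\<^sub>0 'r) \<Rightarrow>\<^sub>0 int) set"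
  where "tensor_cycles k M ract R =
    {z \<in> tensor_free M (free_mod (res_gens R k)).
      \<forall>j. k = Suc j \<longrightarrow> tensor_map (res_diff R j) z \<in> tensor_rel M ract (free_mod (res_gens R j)) smult}"

definition tensor_boundaries ::
    "nat \<Rightarrow> 'm::ab_group_add set \<Rightarrow> ('m \<Rightarrow> 'r::ring_1 \<Rightarrow> 'm) \<Rightarrow> ('i, 'r, 'v) resolution
      \<Rightarrow> ('m \<times> ('i \<Rightarrow>\<^sub>0 'r) \<Rightarrow>\<^sub>0 int) set"
  where "tensor_boundaries k M ract R =
    {tensor_map (res_diff R k) w + r | w r.
      w \<in> tensor_free M (free_mod (res_gens R (Suc k))) \<and>
      r \<in> tensor_rel M ract (free_mod (res_gens R k)) smult}"

definition tor ::
    "nat \<Rightarrow> 'm::ab_group_add set \<Rightarrow> ('m \<Rightarrow> 'r::ring_1 \<Rightarrow> 'm) \<Rightarrow> ('r \<Rightarrow> 'v::ab_group_add \<Rightarrow> 'v)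
      \<Rightarrow> ('m \<times> (('v, 'r) generator \<Rightarrow>\<^sub>0 'r) \<Rightarrow>\<^sub>0 int) set set"
  where "tor k M ract act =
    (let R = chosen_resolution act; Z = tensor_cycles k M ract R; B = tensor_boundaries k M ract R
     in Z // {(x, y). x \<in> Z \<and> y \<in> Z \<and> x - y \<in> B})"

text \<open>\<open>tor k M ract act\<close> is a group of cosets, hence it vanishes iff it is a singleton.\<close>

definition tor_nonzero ::
    "nat \<Rightarrow> 'm::ab_group_add set \<Rightarrow> ('m \<Rightarrow> 'r::ring_1 \<Rightarrow> 'm) \<Rightarrow> ('r \<Rightarrow> 'v::ab_group_add \<Rightarrow> 'v) \<Rightarrow> bool"
  where "tor_nonzero k M ract act \<longleftrightarrow> \<not> is_singleton (tor k M ract act)"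

section \<open>The Taylor spectrum\<close>

definition dual_space :: "('s::complex_vector \<Rightarrow> complex) set"
  where "dual_space = {f. clinear f}"

text \<open>The right action \<open>(f \<cdot> u)(s) = f (u \<cdot> s)\<close> of the enveloping algebra on the dual.\<close>

definition dual_act ::
    "('g::complex_lie_algebra \<Rightarrow> 's::complex_vector \<Rightarrow> 's) \<Rightarrow> ('s \<Rightarrow> complex) \<Rightarrow> 'g uea \<Rightarrow> ('s \<Rightarrow> complex)"
  where "dual_act \<tau> f u = (\<lambda>s. f (uea_act \<tau> u s))"

definition in_taylor_spectrum ::
    "('g::complex_lie_algebra \<Rightarrow> 's::complex_vector \<Rightarrow> 's) \<Rightarrow> ('g \<Rightarrow> 'v::complex_vector \<Rightarrow> 'v) \<Rightarrow> bool"
  where "in_taylor_spectrum \<tau> \<rho> \<longleftrightarrow>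
    finite_dimensional TYPE('s) \<and> simple_module \<tau> \<and>
    (\<exists>k. tor_nonzero k dual_space (dual_act \<tau>) (uea_act \<rho>))"

text \<open>The part of the Taylor spectrum consisting of one-dimensional modules, identified with their
  characters; this is the whole spectrum when the Lie algebra is solvable and finite-dimensional.\<close>

definition taylor_spectrum ::
    "('g::complex_lie_algebra \<Rightarrow> 'v::complex_vector \<Rightarrow> 'v) \<Rightarrow> ('g \<Rightarrow> complex) set"
  where "taylor_spectrum \<rho> = {\<chi>. lie_character \<chi> \<and> in_taylor_spectrum (char_module \<chi>) \<rho>}"

end

theory Submission
  imports Defs "HOL-Computational_Algebra.Fundamental_Theorem_Algebra"
begin

text \<open>
  By Lie's theorem \<open>\<gg>\<close> has a basis whose initial segments span ideals \<open>\<gg>\<^sub>i\<close>. The complex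
  \<open>U\<gg> \<otimes> \<Lambda>\<gg>\<close> is an iterated mapping cone along this flag, hence a resolution of the trivial module
  as soon as right multiplication by \<open>x\<^sub>i\<close> is injective on \<open>U\<gg> / U\<gg> \<gg>\<^sub>i\<close>; this is all that is needed
  from the Poincare-Birkhoff-Witt theorem. So \<open>\<lambda>\<close> lies in the spectrum iff the finite-dimensional complex
  \<open>\<Lambda>\<gg>\<close> with the differential twisted by \<open>\<lambda>\<close> is not exact. By Cartan's formula
  \<open>\<lambda>(x) - ad x\<close> is null-homotopic there, and it is triangular with diagonal entries \<open>\<lambda>(x)\<close> minus sums of
  distinct diagonal entries of \<open>ad x\<close>; if \<open>\<lambda>\<close> were none of these sums, it would be invertible for
  some \<open>x\<close>. Finally, the pairing \<open>\<Lambda>\<^sup>k\<gg> \<times> \<Lambda>\<^sup>n\<^sup>-\<^sup>k\<gg> \<rightarrow> \<Lambda>\<^sup>n\<gg>\<close> makes the differentials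
  twisted by \<open>\<lambda>\<close> and \<open>2\<rho> - \<lambda>\<close> adjoint up to sign.
\<close>

text \<open>Injectivity requires reading off from normal forms whether an element lies in
  \<open>left_ideal i\<close>. For this the normal words are the decreasing ones, with small letters
  last: as the first \<open>i\<close> basis vectors span an ideal, rewriting never loses all letters
  below \<open>i\<close>, and a decreasing word with such a letter ends in one. The differential is
  built from wedge and contraction operators instead of the usual double sum with signs; Cartan's
  formula then is a recursion along wedge products, and \<open>diff_diff\<close>,
  \<open>diff_lie_der\<close> and the adjointness of the differentials follow by induction on
  generators. \<open>Tor\<close> refers to an unwieldy chosen resolution, so exactness after
  reduction along the character is compared for two arbitrary free resolutions. Degrees are mostly
  forgotten: a complex is exact in all degrees iff it is exact as a whole, and projections bring the
  degree back. The shift by \<open>two_rho\<close> comes from the top exterior power, where the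
  pairing takes its values and where the Lie algebra acts by the trace of the adjoint
  module.\<close>

hide_const (open) Polynomial.smult

abbreviation "lookup \<equiv> Poly_Mapping.lookup"
abbreviation "single \<equiv> Poly_Mapping.single"
abbreviation "keys \<equiv> Poly_Mapping.keys"
abbreviation "cspan \<equiv> complex_vector.span"
abbreviation "csubspace \<equiv> complex_vector.subspace"

section \<open>Lie's theorem\<close>

text \<open>\<open>W\<close> only enlarges the span. If \<open>s N\<close> never fell into it, all
  initial segments of \<open>s\<close> would be independent, in conflict with the size of a finite
  spanning set.\<close>

lemma finite_dimensional_sequence_dependent:
  fixes s :: "nat \<Rightarrow> 'v::complex_vector"
  assumes "finite_dimensional TYPE('v)"
  shows "\<exists>N. s N \<in> cspan (W \<union> s ` {..<N})"
proof (rule ccontr)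
  assume "\<not> ?thesis"
  then have nin: "s N \<notin> cspan (s ` {..<N})" for N
    by (meson complex_vector.span_mono le_sup_iff order_refl subsetD)
  obtain B :: "'v set" where B: "finite B" "cspan B = UNIV"
    using assms by (auto simp: finite_dimensional_def)
  have "complex_vector.independent (s ` {..<N}) \<and> card (s ` {..<N}) = N" for N
  proof (induction N)
    case 0
    then show ?case by (simp add: complex_vector.independent_empty)
  next
    case (Suc N)
    have new: "s N \<notin> s ` {..<N}" using nin by (metis complex_vector.span_base)
    have "s ` {..<Suc N} = insert (s N) (s ` {..<N})" by (simp add: lessThan_Suc)
    moreover have "complex_vector.independent (insert (s N) (s ` {..<N}))"
      using Suc nin[of N] new by (subst complex_vector.independent_insert) simp
    moreover have "card (insert (s N) (s ` {..<N})) = Suc N"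
      using Suc new by (subst card_insert_disjoint) simp_all
    ultimately show ?case by (simp only: simp_thms)
  qed
  from this[of "Suc (card B)"] have "Suc (card B) \<le> card B"
    using complex_vector.independent_span_bound[OF B(1)] B(2) by (metis subset_UNIV)
  then show False by simp
qed

section \<open>Polynomials in an operator and eigenvectors modulo a subspace\<close>

definition poly_op :: "('v \<Rightarrow> 'v) \<Rightarrow> complex poly \<Rightarrow> 'v \<Rightarrow> 'v::complex_vector"
  where "poly_op T p v = (\<Sum>i\<le>degree p. coeff p i *\<^sub>C (T ^^ i) v)"

lemma poly_op_eq_sum:
  assumes "degree p \<le> m"
  shows "poly_op T p v = (\<Sum>i\<le>m. coeff p i *\<^sub>C (T ^^ i) v)"
  unfolding poly_op_def
  by (rule sum.mono_neutral_left) (use assms in \<open>auto simp: coeff_eq_0\<close>)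

lemma poly_op_pCons: "poly_op T (pCons a p) v = a *\<^sub>C v + poly_op T p (T v)"
  by (subst (1) poly_op_eq_sum[of _ "Suc (degree p)"])
    (simp_all add: degree_pCons_le sum.atMost_Suc_shift poly_op_def funpow_swap1 del: sum.atMost_Suc)

lemma poly_op_add: "poly_op T (p + q) v = poly_op T p v + poly_op T q v"
proof -
  let ?m = "max (degree p) (degree q)"
  show ?thesis
    by (simp add: poly_op_eq_sum[of _ ?m] degree_add_le scaleC_add_left sum.distrib)
qed

lemma poly_op_smult: "poly_op T (Polynomial.smult a p) v = a *\<^sub>C poly_op T p v"
  by (simp add: poly_op_eq_sum[of _ "degree p"] degree_smult_le complex_vector.scale_sum_right scaleC_scaleC)

lemma clinear_funpow:
  fixes T :: "'v::complex_vector \<Rightarrow> 'v"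
  shows "clinear T \<Longrightarrow> clinear (T ^^ i)"
proof (induction i)
  case 0
  show ?case by (rule clinearI) simp_all
next
  case (Suc i)
  then show ?case by (intro clinearI) (simp_all add: clinear_add clinear_scale)
qed

lemma clinear_poly_op: "clinear T \<Longrightarrow> clinear (poly_op T p)"
  unfolding poly_op_def
  by (intro clinearI)
    (simp_all add: clinear_add[OF clinear_funpow] clinear_scale[OF clinear_funpow] scaleC_add_right
      scaleC_scaleC sum.distrib complex_vector.scale_sum_right mult.commute)

lemma poly_op_linear_factor:
  assumes "clinear T"
  shows "poly_op T ([:- a, 1:] * q) v = poly_op T q (T v - a *\<^sub>C v)"
proof -
  have "[:- a, 1:] * q = pCons 0 q + Polynomial.smult (- a) q" by simp
  then show ?thesis
    by (simp only: poly_op_add poly_op_smult poly_op_pCons)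
      (simp add: clinear_diff[OF clinear_poly_op[OF assms]] clinear_scale[OF clinear_poly_op[OF assms]])
qed

text \<open>A root \<open>a\<close> of \<open>p\<close> exists over the complex numbers. Either
  \<open>v\<close> itself is an eigenvector modulo \<open>W\<close> for \<open>a\<close>, or
  \<open>T v - a v\<close> is a vector outside \<open>W\<close> that the quotient of
  \<open>p\<close> by the linear factor sends into \<open>W\<close>.\<close>

lemma eigenvector_mod_of_poly:
  assumes T: "clinear T" and V: "csubspace V" "\<And>v. v \<in> V \<Longrightarrow> T v \<in> V"
    and W: "csubspace W"
  shows "p \<noteq> 0 \<Longrightarrow> v \<in> V \<Longrightarrow> v \<notin> W \<Longrightarrow> poly_op T p v \<in> W \<Longrightarrow> \<exists>u\<in>V - W. \<exists>c. T u - c *\<^sub>C u \<in> W"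
proof (induction "degree p" arbitrary: p v)
  case 0
  then obtain a where "p = [:a:]" "a \<noteq> 0" by (metis degree_eq_zeroE pCons_0_0)
  with 0 have "a *\<^sub>C v \<in> W" by (simp add: poly_op_def)
  from complex_vector.subspace_scale[OF W this, of "inverse a"] \<open>a \<noteq> 0\<close> have "v \<in> W"
    by (simp add: scaleC_scaleC scaleC_one)
  with 0 show ?case by simp
next
  case (Suc m)
  then obtain a where "poly p a = 0"
    using fundamental_theorem_of_algebra[of p] constant_degree[of p] by auto
  then obtain q where q: "p = [:- a, 1:] * q" by (metis poly_eq_0_iff_dvd dvdE)
  with Suc.prems have q0: "q \<noteq> 0" by auto
  then have deg: "m = degree q" using Suc.hyps(2) q
    by (metis One_nat_def add_Suc add_left_cancel degree_mult_eq degree_pCons_eq_if one_neq_zero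
        pCons_eq_0_iff plus_1_eq_Suc degree_1 one_pCons)
  let ?u = "T v - a *\<^sub>C v"
  show ?case
  proof (cases "?u \<in> W")
    case True
    then show ?thesis using Suc.prems by blast
  next
    case False
    have "?u \<in> V" using Suc.prems(2) V by (simp add: complex_vector.subspace_diff complex_vector.subspace_scale)
    moreover have "poly_op T q ?u \<in> W" using Suc.prems(4) by (simp only: q poly_op_linear_factor[OF T])
    ultimately show ?thesis using Suc.hyps(1)[OF deg q0] False by blast
  qed
qed

text \<open>Modulo \<open>W\<close>, the span consists of values at \<open>v\<close> of polynomials
  of degree below \<open>N\<close>. The alternative \<open>q = 0\<close> covers
  \<open>N = 0\<close>, since the zero polynomial has degree \<open>0\<close>.\<close>

lemma span_orbit_poly_op:
  assumes W: "csubspace W"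
    and u: "u \<in> cspan (W \<union> (\<lambda>i. (T ^^ i) v) ` {..<N})"
  shows "\<exists>q. (q = 0 \<or> degree q < N) \<and> u - poly_op T q v \<in> W"
  using u
proof (induction rule: complex_vector.span_induct_alt)
  case base
  have "0 - poly_op T 0 v \<in> W" using complex_vector.subspace_0[OF W] by (simp add: poly_op_def)
  then show ?case by blast
next
  case (step c x y)
  then obtain q where q: "q = 0 \<or> degree q < N" "y - poly_op T q v \<in> W" by blast
  from step(1) show ?case
  proof
    assume "x \<in> W"
    then have "(c *\<^sub>C x + y) - poly_op T q v \<in> W"
      using complex_vector.subspace_add[OF W complex_vector.subspace_scale[OF W \<open>x \<in> W\<close>, of c] q(2)]
      by (simp add: add_diff_eq)
    with q(1) show ?thesis by blast
  next
    assume "x \<in> (\<lambda>i. (T ^^ i) v) ` {..<N}"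
    then obtain i where i: "i < N" "x = (T ^^ i) v" by auto
    let ?q = "Polynomial.monom c i + q"
    have mon: "poly_op T (Polynomial.monom c i) v = c *\<^sub>C x"
    proof -
      have "poly_op T (Polynomial.monom c i) v = (\<Sum>j\<le>i. if j = i then c *\<^sub>C (T ^^ i) v else 0)"
        by (subst poly_op_eq_sum[of _ i], rule degree_monom_le, rule sum.cong) auto
      then show ?thesis by (simp add: i)
    qed
    have "degree ?q < N"
      using q(1) i(1) degree_monom_le[of c i] by (intro degree_add_less) auto
    moreover have "(c *\<^sub>C x + y) - poly_op T ?q v \<in> W" using q(2) by (simp add: poly_op_add mon)
    ultimately show ?thesis by blast
  qed
qed

lemma eigenvector_mod_exists:
  fixes T :: "'v::complex_vector \<Rightarrow> 'v"
  assumes fd: "finite_dimensional TYPE('v)"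
    and T: "clinear T" and V: "csubspace V" "\<And>v. v \<in> V \<Longrightarrow> T v \<in> V"
    and W: "csubspace W" and v: "v \<in> V" "v \<notin> W"
  shows "\<exists>u\<in>V - W. \<exists>c. T u - c *\<^sub>C u \<in> W"
proof -
  obtain N where "(T ^^ N) v \<in> cspan (W \<union> (\<lambda>i. (T ^^ i) v) ` {..<N})"
    using finite_dimensional_sequence_dependent[OF fd, of "\<lambda>i. (T ^^ i) v"] by blast
  from span_orbit_poly_op[OF W this] obtain q
    where q: "q = 0 \<or> degree q < N" "(T ^^ N) v - poly_op T q v \<in> W" by blast
  \<comment> \<open>The relation between the iterates, made into a polynomial; it is monic of degree
    \<open>N\<close> because \<open>q\<close> only reaches degrees below \<open>N\<close>.\<close>
  let ?p = "Polynomial.monom 1 N + Polynomial.smult (- 1) q"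
  have "coeff ?p N = 1" using q(1) by (auto simp: coeff_eq_0)
  then have "?p \<noteq> 0" by (metis coeff_0 zero_neq_one)
  moreover have "poly_op T (Polynomial.monom 1 N) v = (\<Sum>j\<le>N. if j = N then (T ^^ N) v else 0)"
    by (subst poly_op_eq_sum[of _ N], rule degree_monom_le, rule sum.cong) (auto simp: scaleC_one)
  then have "poly_op T ?p v = (T ^^ N) v - poly_op T q v"
    by (simp only: poly_op_add poly_op_smult) (simp add: scaleC_one)
  with q(2) have "poly_op T ?p v \<in> W" by simp
  ultimately show ?thesis using eigenvector_mod_of_poly[OF T V W _ v] by blast
qed

lemma lie_moduleD:
  assumes "lie_module \<rho>"
  shows "clinear (\<rho> x)" "clinear (\<lambda>x. \<rho> x v)" "\<rho> (bracket x y) v = \<rho> x (\<rho> y v) - \<rho> y (\<rho> x v)"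
  using assms by (auto simp: lie_module_def)

text \<open>The vectors \<open>v\<close>, \<open>x v\<close>, \<open>x\<^sup>2 v\<close>, \<dots> are treated modulo the span of \<open>W\<close> and their
  predecessors: there \<open>y x\<^sup>k v\<close> equals \<open>\<lambda> y x\<^sup>k v + k \<lambda> [y, x] x\<^sup>k\<^sup>-\<^sup>1 v\<close>, and comparing at the first
  exponent where the vectors become dependent yields \<open>\<lambda> [y, x] = 0\<close> in characteristic zero.\<close>

lemma eigenfunctional_vanishes_on_brackets:
  fixes \<rho> :: "'g::complex_lie_algebra \<Rightarrow> 'v::complex_vector \<Rightarrow> 'v"
  assumes fd: "finite_dimensional TYPE('v)" and \<rho>: "lie_module \<rho>"
    and W: "csubspace W" "\<And>x w. w \<in> W \<Longrightarrow> \<rho> x w \<in> W"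
    and h: "\<And>y. y \<in> h \<Longrightarrow> bracket y x \<in> h"
    and v: "v \<notin> W" "\<And>y. y \<in> h \<Longrightarrow> \<rho> y v - l y *\<^sub>C v \<in> W"
    and y: "y \<in> h"
  shows "l (bracket y x) = 0"
proof -
  define s where "s k = (\<rho> x ^^ k) v" for k
  define U where "U k = cspan (W \<union> s ` {..<k})" for k
  have s: "s 0 = v" "\<And>k. s (Suc k) = \<rho> x (s k)" by (simp_all add: s_def)
  have subU: "csubspace (U k)" for k by (simp add: U_def complex_vector.subspace_span)
  note sub_simps = complex_vector.subspace_add[OF subU] complex_vector.subspace_diff[OF subU]
    complex_vector.subspace_scale[OF subU]
  have mono: "j \<le> k \<Longrightarrow> u \<in> U j \<Longrightarrow> u \<in> U k" for j k u
    unfolding U_def by (meson complex_vector.span_mono Un_mono image_mono lessThan_subset_iff order_refl subsetD)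
  have WU: "w \<in> W \<Longrightarrow> w \<in> U k" for w k by (simp add: U_def complex_vector.span_base)
  have U0: "U 0 = W" using W(1) by (simp add: U_def)
  have sU: "j < k \<Longrightarrow> s j \<in> U k" for j k by (auto simp: U_def intro: complex_vector.span_base)
  note lin = lie_moduleD(1)[OF \<rho>]
  have xU: "\<rho> x u \<in> U k" if "u \<in> U (k - 1)" for u k
  proof -
    have "u \<in> cspan (W \<union> s ` {..<k - 1})" using that by (simp add: U_def)
    then show ?thesis
    proof (induction rule: complex_vector.span_induct_alt)
      case base
      then show ?case by (simp add: clinear_zero[OF lin] complex_vector.subspace_0[OF subU])
    next
      case (step c a b)
      have "\<rho> x a \<in> U k" using step(1)
      proof
        assume "a \<in> s ` {..<k - 1}"
        then obtain j where "j < k - 1" "a = s j" by auto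
        then show ?thesis using sU[of "Suc j" k] s(2)[of j] by simp
      qed (use W(2) WU in blast)
      with step(2) show ?case by (simp add: clinear_add[OF lin] clinear_scale[OF lin] sub_simps)
    qed
  qed
  \<comment> \<open>The commutation formula with its error term. For \<open>k = 0\<close> the
    truncated \<open>k - 1\<close> is harmless: the coefficient vanishes and the claim is the
    assumption on \<open>v\<close>.\<close>
  have C: "\<forall>y\<in>h. \<rho> y (s k) - l y *\<^sub>C s k - (of_nat k * l (bracket y x)) *\<^sub>C s (k - 1) \<in> U (k - 1)" for k
  proof (induction k)
    case 0
    show ?case using v(2) by (simp add: s(1) U0)
  next
    case (Suc k)
    show ?case
    proof
      fix y assume y: "y \<in> h"
      let ?m = "l (bracket y x)"
      define w where "w = \<rho> y (s k) - l y *\<^sub>C s k - (of_nat k * ?m) *\<^sub>C s (k - 1)"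
      have w: "w \<in> U (k - 1)" using Suc y by (simp add: w_def)
      have yk: "\<rho> y (s k) = l y *\<^sub>C s k + (of_nat k * ?m) *\<^sub>C s (k - 1) + w" by (simp add: w_def)
      define w' where "w' = \<rho> (bracket y x) (s k) - ?m *\<^sub>C s k"
      have w': "w' \<in> U k"
      proof -
        let ?t = "(of_nat k * l (bracket (bracket y x) x)) *\<^sub>C s (k - 1)"
        have "w' - ?t \<in> U (k - 1)" using Suc h[OF y] by (simp add: w'_def)
        then have "w' - ?t \<in> U k" by (rule mono[rotated]) simp
        moreover have "?t \<in> U k"
          by (cases k) (simp_all add: complex_vector.subspace_0[OF subU] sU sub_simps)
        ultimately show ?thesis using sub_simps(1) by fastforce
      qed
      have xs: "(of_nat k * ?m) *\<^sub>C \<rho> x (s (k - 1)) = (of_nat k * ?m) *\<^sub>C s k"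
        by (cases k) (simp_all add: s_def)
      have "\<rho> y (s (Suc k)) = \<rho> (bracket y x) (s k) + \<rho> x (\<rho> y (s k))"
        by (simp add: s(2) lie_moduleD(3)[OF \<rho>])
      also have "\<dots> = w' + ?m *\<^sub>C s k + (l y *\<^sub>C s (Suc k) + (of_nat k * ?m) *\<^sub>C s k + \<rho> x w)"
        by (simp only: yk clinear_add[OF lin] clinear_scale[OF lin] s(2) xs) (simp add: w'_def)
      finally have "\<rho> y (s (Suc k)) - l y *\<^sub>C s (Suc k) - (of_nat (Suc k) * ?m) *\<^sub>C s k = w' + \<rho> x w"
        by (simp add: algebra_simps scaleC_add_left)
      then show "\<rho> y (s (Suc k)) - l y *\<^sub>C s (Suc k) - (of_nat (Suc k) * ?m) *\<^sub>C s (Suc k - 1) \<in> U (Suc k - 1)"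
        using w' xU[OF w] by (simp add: sub_simps)
    qed
  qed
  have A: "\<rho> y (s k) - l y *\<^sub>C s k \<in> U k" if "y \<in> h" for y k
  proof -
    let ?t = "(of_nat k * l (bracket y x)) *\<^sub>C s (k - 1)"
    have "\<rho> y (s k) - l y *\<^sub>C s k - ?t \<in> U k" using C that by (intro mono[of "k - 1" k]) auto
    moreover have "?t \<in> U k"
      by (cases k) (simp_all add: complex_vector.subspace_0[OF subU] sU sub_simps)
    ultimately show ?thesis using sub_simps(1) by fastforce
  qed
  \<comment> \<open>\<open>N\<close> is the first exponent at which \<open>s N\<close> depends on
    \<open>W\<close> and its predecessors, so that \<open>s (N - 1)\<close> is not in
    \<open>U (N - 1)\<close>.\<close>
  define N where "N = (LEAST N. s N \<in> U N)"
  have ex: "\<exists>N. s N \<in> U N" unfolding U_def by (rule finite_dimensional_sequence_dependent[OF fd])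
  have N: "s N \<in> U N" unfolding N_def by (rule LeastI_ex[OF ex])
  have "N \<noteq> 0" using N v(1) by (metis U0 s(1))
  then have least: "s (N - 1) \<notin> U (N - 1)" unfolding N_def by (metis diff_less neq0_conv not_less_Least zero_less_one)
  \<comment> \<open>On all of \<open>U N\<close>, \<open>\<rho> y\<close> acts as the scalar
    \<open>l y\<close> modulo \<open>U (N - 1)\<close>. Applied to \<open>s N\<close>, which lies in
    \<open>U N\<close>, and compared with \<open>C\<close>, this puts
    \<open>N * l (bracket y x)\<close> times \<open>s (N - 1)\<close> into
    \<open>U (N - 1)\<close>.\<close>
  have "\<rho> y u - l y *\<^sub>C u \<in> U (N - 1)" if "u \<in> U N" for u
    using that[unfolded U_def]
  proof (induction rule: complex_vector.span_induct_alt)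
    case base
    then show ?case by (simp add: clinear_zero[OF lin] complex_vector.subspace_0[OF subU])
  next
    case (step c a b)
    have "\<rho> y a - l y *\<^sub>C a \<in> U (N - 1)" using step(1)
    proof
      assume "a \<in> s ` {..<N}"
      then obtain j where "j < N" "a = s j" by auto
      then show ?thesis using mono[OF _ A[OF y], of j "N - 1"] by simp
    next
      assume "a \<in> W"
      then show ?thesis using W by (intro WU) (simp add: complex_vector.subspace_diff complex_vector.subspace_scale)
    qed
    then have "c *\<^sub>C (\<rho> y a - l y *\<^sub>C a) + (\<rho> y b - l y *\<^sub>C b) \<in> U (N - 1)"
      using step(2) by (simp add: sub_simps)
    also have "c *\<^sub>C (\<rho> y a - l y *\<^sub>C a) + (\<rho> y b - l y *\<^sub>C b) = \<rho> y (c *\<^sub>C a + b) - l y *\<^sub>C (c *\<^sub>C a + b)"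
      by (simp add: clinear_add[OF lin] clinear_scale[OF lin] scaleC_add_right
          complex_vector.scale_right_diff_distrib scaleC_scaleC mult.commute)
    finally show ?case .
  qed
  from this[OF N] C[of N] y have "(of_nat N * l (bracket y x)) *\<^sub>C s (N - 1) \<in> U (N - 1)"
    using sub_simps(2)[of "\<rho> y (s N) - l y *\<^sub>C s N" "N - 1" "\<rho> y (s N) - l y *\<^sub>C s N - (of_nat N * l (bracket y x)) *\<^sub>C s (N - 1)"]
    by simp
  from complex_vector.subspace_scale[OF subU this, of "inverse (of_nat N * l (bracket y x))"]
  have "of_nat N * l (bracket y x) = 0"
    using least by (cases "of_nat N * l (bracket y x) = 0") (simp_all only: scaleC_scaleC left_inverse scaleC_one not_False_eq_True simp_thms)
  then show ?thesis using \<open>N \<noteq> 0\<close> by simp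
qed

text \<open>A common eigenvector in the quotient by \<open>W\<close>, expressed in the space itself,
  because the quotient by a subspace that varies in the proof is not a type.\<close>

definition common_eigenvector_mod ::
    "('g \<Rightarrow> 'v::complex_vector \<Rightarrow> 'v) \<Rightarrow> 'v set \<Rightarrow> 'g set \<Rightarrow> bool"
  where "common_eigenvector_mod \<rho> W h \<longleftrightarrow> (\<exists>v. v \<notin> W \<and> (\<forall>y\<in>h. \<exists>c. \<rho> y v - c *\<^sub>C v \<in> W))"

text \<open>The space of vectors on which \<open>h\<close> acts by \<open>l\<close> modulo
  \<open>W\<close> is stable under \<open>x\<close>, because \<open>l\<close> vanishes on brackets
  with \<open>x\<close>. An eigenvector of \<open>x\<close> in that space serves for
  \<open>h\<close> and \<open>x\<close> together.\<close>

lemma common_eigenvector_mod_insert: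
  fixes \<rho> :: "'g::complex_lie_algebra \<Rightarrow> 'v::complex_vector \<Rightarrow> 'v"
  assumes fd: "finite_dimensional TYPE('v)" and \<rho>: "lie_module \<rho>"
    and W: "csubspace W" "\<And>x w. w \<in> W \<Longrightarrow> \<rho> x w \<in> W"
    and h: "csubspace h" "\<And>y. y \<in> h \<Longrightarrow> bracket y x \<in> h"
    and ev: "common_eigenvector_mod \<rho> W h"
  shows "common_eigenvector_mod \<rho> W (cspan (insert x h))"
proof -
  note lin = lie_moduleD(1)[OF \<rho>]
  obtain v l where v: "v \<notin> W" "\<And>y. y \<in> h \<Longrightarrow> \<rho> y v - l y *\<^sub>C v \<in> W"
    using ev unfolding common_eigenvector_mod_def by metis
  have l0: "l (bracket y x) = 0" if "y \<in> h" for y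
    by (rule eigenfunctional_vanishes_on_brackets[OF fd \<rho> W h(2) v that])
  define V where "V = {v. \<forall>y\<in>h. \<rho> y v - l y *\<^sub>C v \<in> W}"
  have V: "csubspace V"
  proof (rule complex_vector.subspaceI)
    show "0 \<in> V" by (simp add: V_def clinear_zero[OF lin] complex_vector.subspace_0[OF W(1)])
    show "a + b \<in> V" if "a \<in> V" "b \<in> V" for a b
    proof -
      have "(\<rho> y a - l y *\<^sub>C a) + (\<rho> y b - l y *\<^sub>C b) \<in> W" if "y \<in> h" for y
        using \<open>a \<in> V\<close> \<open>b \<in> V\<close> that complex_vector.subspace_add[OF W(1)] by (simp add: V_def)
      then show ?thesis by (simp add: V_def clinear_add[OF lin] scaleC_add_right algebra_simps)
    qed
    show "c *\<^sub>C a \<in> V" if "a \<in> V" for c a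
    proof -
      have "c *\<^sub>C (\<rho> y a - l y *\<^sub>C a) \<in> W" if "y \<in> h" for y
        using \<open>a \<in> V\<close> that complex_vector.subspace_scale[OF W(1)] by (simp add: V_def)
      then show ?thesis
        by (simp add: V_def clinear_scale[OF lin] complex_vector.scale_right_diff_distrib scaleC_scaleC mult.commute)
    qed
  qed
  have xV: "\<rho> x a \<in> V" if a: "a \<in> V" for a
    unfolding V_def
  proof (intro CollectI ballI)
    fix y assume y: "y \<in> h"
    have 1: "\<rho> x (\<rho> y a - l y *\<^sub>C a) \<in> W" using a y W(2) by (simp add: V_def)
    have 2: "\<rho> (bracket y x) a \<in> W" using a h(2)[OF y] l0[OF y] by (simp add: V_def) (metis complex_vector.scale_zero_left diff_zero)
    have "\<rho> y (\<rho> x a) - l y *\<^sub>C \<rho> x a = \<rho> x (\<rho> y a - l y *\<^sub>C a) + \<rho> (bracket y x) a"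
      by (simp add: clinear_diff[OF lin] clinear_scale[OF lin] lie_moduleD(3)[OF \<rho>])
    then show "\<rho> y (\<rho> x a) - l y *\<^sub>C \<rho> x a \<in> W" using complex_vector.subspace_add[OF W(1) 1 2] by simp
  qed
  have "v \<in> V" using v by (simp add: V_def)
  from eigenvector_mod_exists[OF fd lin V xV W(1) this v(1)]
  obtain u c where u: "u \<in> V" "u \<notin> W" "\<rho> x u - c *\<^sub>C u \<in> W" by blast
  have "\<exists>d. \<rho> z u - d *\<^sub>C u \<in> W" if z: "z \<in> cspan (insert x h)" for z
  proof -
    have "cspan h = h" using h(1) by simp
    then obtain k where k: "z - k *\<^sub>C x \<in> h"
      using z complex_vector.span_breakdown_eq[of z x h] by metis
    have "\<rho> (z - k *\<^sub>C x) u - l (z - k *\<^sub>C x) *\<^sub>C u \<in> W" using u(1) k by (simp add: V_def)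
    from complex_vector.subspace_add[OF W(1) this complex_vector.subspace_scale[OF W(1) u(3), of k]]
    have "\<rho> z u - (l (z - k *\<^sub>C x) + k * c) *\<^sub>C u \<in> W"
      by (simp add: clinear_diff[OF lie_moduleD(2)[OF \<rho>]] clinear_scale[OF lie_moduleD(2)[OF \<rho>]]
          complex_vector.scale_right_diff_distrib scaleC_scaleC scaleC_add_left algebra_simps)
    then show ?thesis by blast
  qed
  with u(2) show ?thesis unfolding common_eigenvector_mod_def by blast
qed

lemma derived_series_subspace: "csubspace (derived_series k)"
  by (cases k) (simp_all add: complex_vector.subspace_span)

lemma bracket_skew: "bracket x y = - bracket y (x :: 'g::complex_lie_algebra)"
proof -
  have "0 = bracket (x + y) (x + y)" by (simp only: bracket_self)
  also have "\<dots> = bracket x y + bracket y x"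
    by (simp only: bracket_add_left bracket_add_right) (simp add: bracket_self)
  finally show ?thesis by (metis eq_neg_iff_add_eq_0)
qed

lemma bracket_clinear: "clinear (bracket x)" "clinear (\<lambda>x. bracket x y)"
  by (auto intro!: clinearI simp: bracket_add_left bracket_add_right bracket_scale_left bracket_scale_right)

lemma bracket_minus_right: "bracket x (- y) = - bracket x (y :: 'g::complex_lie_algebra)"
  using clinear_diff[OF bracket_clinear(1), of x 0 y] clinear_zero[OF bracket_clinear(1), of x] by simp

lemma jacobi_left: "bracket (bracket x y) z = bracket x (bracket y z) - bracket y (bracket x (z :: 'g::complex_lie_algebra))"
proof -
  have "bracket (bracket x y) z = - bracket z (bracket x y)" by (rule bracket_skew)
  also have "\<dots> = bracket x (bracket y z) + bracket y (bracket z x)"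
    using jacobi[of x y z] by (metis add_eq_0_iff minus_minus)
  also have "bracket y (bracket z x) = - bracket y (bracket x z)"
    by (subst bracket_skew[of z x]) (rule bracket_minus_right)
  finally show ?thesis by simp
qed

lemma lie_module_bracket: "lie_module (bracket :: 'g::complex_lie_algebra \<Rightarrow> 'g \<Rightarrow> 'g)"
  unfolding lie_module_def by (simp add: bracket_clinear jacobi_left)

lemma derived_series_bracket: "x \<in> derived_series k \<Longrightarrow> y \<in> derived_series k \<Longrightarrow> bracket x y \<in> derived_series (Suc k)"
  by (auto intro: complex_vector.span_base)

lemma derived_series_decreasing: "derived_series (Suc k) \<subseteq> derived_series k"
proof (induction k)
  case (Suc k)
  have "{bracket x y | x y. x \<in> A \<and> y \<in> A} \<subseteq> {bracket x y | x y. x \<in> B \<and> y \<in> B}"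
    if "A \<subseteq> B" for A B :: "'a set"
    using that by blast
  from complex_vector.span_mono[OF this[OF Suc]] show ?case by (simp only: derived_series.simps)
qed simp

text \<open>The subalgebra that has a common eigenvector grows from the zero space at the end of the
  derived series up to the whole Lie algebra, one vector at a time.\<close>

theorem lie_common_eigenvector_mod:
  fixes \<rho> :: "'g::complex_lie_algebra \<Rightarrow> 'v::complex_vector \<Rightarrow> 'v"
  assumes fdg: "finite_dimensional TYPE('g)" and sol: "solvable TYPE('g)"
    and fd: "finite_dimensional TYPE('v)" and \<rho>: "lie_module \<rho>"
    and W: "csubspace W" "\<And>x w. w \<in> W \<Longrightarrow> \<rho> x w \<in> W" "W \<noteq> UNIV"
  shows "common_eigenvector_mod \<rho> W UNIV"
proof -
  let ?D = "derived_series :: nat \<Rightarrow> 'g set"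
  obtain E :: "'g set" where E: "finite E" "cspan E = UNIV"
    using fdg by (auto simp: finite_dimensional_def)
  obtain m where m: "?D m = {0}" using sol by (auto simp: solvable_def)
  have step: "common_eigenvector_mod \<rho> W (?D k)" if IH: "common_eigenvector_mod \<rho> W (?D (Suc k))" for k
  proof -
    obtain B where B: "B \<subseteq> ?D k" "complex_vector.independent B" "?D k \<subseteq> cspan B"
      using complex_vector.maximal_independent_subset by blast
    have "finite B" using complex_vector.independent_span_bound[OF E(1) B(2)] E(2) by simp
    have "common_eigenvector_mod \<rho> W (cspan (?D (Suc k) \<union> C))" if "finite C" "C \<subseteq> ?D k" for C
      using that
    proof (induction C rule: finite_induct)
      case empty
      have "cspan (?D (Suc k)) = ?D (Suc k)"
        by (rule complex_vector.span_eq_iff[THEN iffD2, OF derived_series_subspace])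
      then show ?case using IH by (metis Un_empty_right)
    next
      case (insert x C)
      let ?h = "cspan (?D (Suc k) \<union> C)"
      have hD: "?h \<subseteq> ?D k"
        using insert.prems derived_series_decreasing[of k]
        by (intro complex_vector.span_minimal derived_series_subspace) blast
      \<comment> \<open>Any space between two consecutive members of the derived series contains the
        brackets of the larger one, so it absorbs the bracket with \<open>x\<close>.\<close>
      have "bracket y x \<in> ?h" if "y \<in> ?h" for y
        using derived_series_bracket[of y k x] that hD insert.prems complex_vector.span_base by blast
      from common_eigenvector_mod_insert[OF fd \<rho> W(1,2) complex_vector.subspace_span this]
      have "common_eigenvector_mod \<rho> W (cspan (insert x ?h))" using insert by blast
      moreover have "cspan (?D (Suc k) \<union> insert x C) \<subseteq> cspan (insert x ?h)"
        by (intro complex_vector.span_mono) (auto intro: complex_vector.span_base)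
      ultimately show ?case unfolding common_eigenvector_mod_def by blast
    qed
    from this[OF \<open>finite B\<close> B(1)] have "common_eigenvector_mod \<rho> W (cspan (?D (Suc k) \<union> B))" .
    moreover have "?D k \<subseteq> cspan (?D (Suc k) \<union> B)"
      using B(3) complex_vector.span_mono[of B "?D (Suc k) \<union> B"] by blast
    ultimately show ?thesis unfolding common_eigenvector_mod_def by blast
  qed
  obtain w where "w \<notin> W" using W(3) by blast
  moreover have "\<rho> 0 w - 0 *\<^sub>C w \<in> W"
    by (simp add: clinear_zero[OF lie_moduleD(2)[OF \<rho>]] complex_vector.subspace_0[OF W(1)])
  ultimately have "common_eigenvector_mod \<rho> W (?D m)"
    unfolding m common_eigenvector_mod_def by blast
  then have "common_eigenvector_mod \<rho> W (?D (m - j))" for j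
  proof (induction j)
    case (Suc j)
    show ?case
    proof (cases "j < m")
      case True
      then have "Suc (m - Suc j) = m - j" by simp
      then show ?thesis using step[of "m - Suc j"] Suc by simp
    qed (use Suc in simp)
  qed simp
  from this[of m] show ?thesis by simp
qed

text \<open>A partial triangular basis spans a submodule; a common eigenvector modulo this submodule
  is the next basis vector.\<close>

theorem lie_triangular_basis:
  fixes \<rho> :: "'g::complex_lie_algebra \<Rightarrow> 'v::complex_vector \<Rightarrow> 'v"
  assumes fdg: "finite_dimensional TYPE('g)" and sol: "solvable TYPE('g)"
    and fd: "finite_dimensional TYPE('v)" and \<rho>: "lie_module \<rho>"
  shows "\<exists>bs. triangular_basis \<rho> bs"
proof -
  let ?n = "complex_vector.dim (UNIV :: 'v set)"
  obtain E :: "'v set" where E: "finite E" "cspan E = UNIV"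
    using fd by (auto simp: finite_dimensional_def)
  let ?P = "\<lambda>bs. distinct bs \<and> complex_vector.independent (set bs) \<and>
    (\<forall>x. \<forall>j<length bs. \<rho> x (bs ! j) \<in> cspan (set (take (Suc j) bs)))"
  \<comment> \<open>Either the process has stopped with a basis or it reaches length
    \<open>m\<close>; a length beyond \<open>card E\<close> is impossible.\<close>
  have ex: "(\<exists>bs. triangular_basis \<rho> bs) \<or> (\<exists>bs. ?P bs \<and> length bs = m)" for m
  proof (induction m)
    case 0
    have "?P []" by (simp add: complex_vector.independent_empty)
    then show ?case by (metis list.size(3))
  next
    case (Suc m)
    show ?case
    proof (cases "\<exists>bs. triangular_basis \<rho> bs")
      case False
      then obtain bs where bs: "?P bs" "length bs = m" using Suc by blast
      let ?W = "cspan (set bs)"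
      note lin = lie_moduleD(1)[OF \<rho>]
      have inv: "\<rho> x w \<in> ?W" if "w \<in> ?W" for x w
        using that
      proof (induction rule: complex_vector.span_induct_alt)
        case base
        then show ?case by (simp add: clinear_zero[OF lin] complex_vector.span_zero)
      next
        case (step c a b)
        from step(1) obtain j where j: "j < length bs" "a = bs ! j" by (metis in_set_conv_nth)
        then have "\<rho> x a \<in> cspan (set (take (Suc j) bs))" using bs by blast
        then have "\<rho> x a \<in> ?W" using complex_vector.span_mono[OF set_take_subset] by blast
        with step(2) show ?case
          by (simp add: clinear_add[OF lin] clinear_scale[OF lin] complex_vector.span_add complex_vector.span_scale)
      qed
      have "?W \<noteq> UNIV" using False bs unfolding triangular_basis_def by blast
      from lie_common_eigenvector_mod[OF fdg sol fd \<rho> complex_vector.subspace_span inv this]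
      obtain v where v: "v \<notin> ?W" "\<And>y. \<exists>c. \<rho> y v - c *\<^sub>C v \<in> ?W" unfolding common_eigenvector_mod_def by blast
      have "v \<notin> set bs" using v(1) complex_vector.span_base by blast
      then have 1: "distinct (bs @ [v])" "complex_vector.independent (set (bs @ [v]))"
        using bs v(1) by (simp_all add: complex_vector.independent_insert)
      have 2: "\<rho> x v \<in> cspan (insert v (set bs))" for x
        using v(2)[of x] complex_vector.span_breakdown_eq[of "\<rho> x v" v "set bs"] by blast
      have "?P (bs @ [v])"
        using 1 2 bs by (auto simp: nth_append less_Suc_eq)
      moreover have "length (bs @ [v]) = Suc m" using bs(2) by simp
      ultimately show ?thesis by blast
    qed simp
  qed
  show ?thesis
  proof (rule ccontr)
    assume "\<not> ?thesis"
    then obtain bs where bs: "?P bs" "length bs = Suc (card E)" using ex by blast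
    then have "card (set bs) \<le> card E" using complex_vector.independent_span_bound[OF E(1)] E(2) by blast
    with bs show False by (simp add: distinct_card)
  qed
qed

section \<open>Monomial bases of the enveloping algebra\<close>

instantiation poly_mapping :: (type, complex_vector) complex_vector
begin

lift_definition scaleC_poly_mapping :: "complex \<Rightarrow> ('a \<Rightarrow>\<^sub>0 'b) \<Rightarrow> ('a \<Rightarrow>\<^sub>0 'b)" is "\<lambda>c p k. c *\<^sub>C p k"
  by (rule finite_subset[rotated]) auto

instance
  by standard (transfer; simp add: fun_eq_iff scaleC_add_right scaleC_add_left scaleC_scaleC scaleC_one)+

end

lemma lookup_scaleC [simp]: "lookup (c *\<^sub>C p) k = c *\<^sub>C lookup p k"
  by transfer simp

lemma keys_scaleC: "keys (c *\<^sub>C p) \<subseteq> keys p"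
  by (auto simp: in_keys_iff)

lemma single_scaleC: "single k (c *\<^sub>C a) = c *\<^sub>C single k a"
  by (rule poly_mapping_eqI) (simp add: lookup_single when_def)

definition linear_extension :: "('i \<Rightarrow> 'v::complex_vector) \<Rightarrow> ('i \<Rightarrow>\<^sub>0 complex) \<Rightarrow> 'v"
  where "linear_extension f p = (\<Sum>k\<in>keys p. lookup p k *\<^sub>C f k)"

lemma linear_extension_single [simp]: "linear_extension f (single k c) = c *\<^sub>C f k"
  unfolding linear_extension_def by (subst sum_keys_single) simp_all

lemma clinear_linear_extension: "clinear (linear_extension f)"
proof (rule clinearI)
  show add: "linear_extension f (p + q) = linear_extension f p + linear_extension f q" for p q
    unfolding linear_extension_def by (rule sum_keys_add) (simp_all add: scaleC_add_left)
  show "linear_extension f (c *\<^sub>C p) = c *\<^sub>C linear_extension f p" for c p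
    by (induction p rule: poly_mapping_single_plus_induct)
      (simp_all add: add scaleC_add_right scaleC_scaleC flip: single_scaleC, simp add: linear_extension_def)
qed

lemma clinear_poly_mapping_eqI:
  assumes "clinear F" "clinear G" "\<And>k. F (single k 1) = G (single k 1)"
  shows "F p = G (p :: 'i \<Rightarrow>\<^sub>0 complex)"
proof (induction p rule: poly_mapping_single_plus_induct)
  case zero
  show ?case using assms by (simp add: clinear_zero)
next
  case (single_plus k c p)
  have "single k c = c *\<^sub>C single k 1" by (simp flip: single_scaleC)
  with single_plus assms show ?case by (simp add: clinear_add clinear_scale)
qed

instantiation uea :: (complex_lie_algebra) complex_vector
begin

definition scaleC_uea :: "complex \<Rightarrow> 'a uea \<Rightarrow> 'a uea"
  where "scaleC_uea c u = abs_uea (single 0 c) * u"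

instance
proof
  fix a b :: complex and x y :: "'a uea"
  show "a *\<^sub>C (x + y) = a *\<^sub>C x + a *\<^sub>C y" by (simp add: scaleC_uea_def distrib_left)
  show "(a + b) *\<^sub>C x = a *\<^sub>C x + b *\<^sub>C x"
    by (simp add: scaleC_uea_def single_add distrib_right flip: plus_uea.abs_eq)
  show "a *\<^sub>C (b *\<^sub>C x) = (a * b) *\<^sub>C x"
    by (simp add: scaleC_uea_def mult_single times_uea.abs_eq flip: mult.assoc)
  show "1 *\<^sub>C x = x" by (simp add: scaleC_uea_def flip: one_uea.abs_eq)
qed

end

text \<open>\<open>single 0 c\<close> is the multiple of the empty word by which the scalar
  \<open>c\<close> acts; its centrality makes the product of the enveloping algebra bilinear over
  the complex numbers.\<close>

lemma single_zero_central: "single 0 c * p = p * single (0::'a::monoid_add) (c::complex)"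
  by (induction p rule: poly_mapping_single_plus_induct)
    (simp_all add: distrib_left distrib_right mult_single mult.commute)

lemma uea_mult_scaleC_right: "u * (c *\<^sub>C v) = c *\<^sub>C (u * (v :: 'g::complex_lie_algebra uea))"
proof -
  obtain p where p: "u = abs_uea p" by (rule uea_cases)
  have "u * abs_uea (single 0 c) = abs_uea (single 0 c) * u"
    unfolding p times_uea.abs_eq by (simp only: single_zero_central)
  then show ?thesis by (simp add: scaleC_uea_def flip: mult.assoc)
qed

lemma uea_mult_scaleC_left: "(c *\<^sub>C u) * v = c *\<^sub>C (u * (v :: 'g::complex_lie_algebra uea))"
  by (simp add: scaleC_uea_def mult.assoc)

lemma uea_incl_clinear: "clinear (uea_incl :: 'g::complex_lie_algebra \<Rightarrow> _)"
proof (rule clinearI)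
  fix x y :: 'g and c
  show "uea_incl (x + y) = uea_incl x + uea_incl y"
  proof transfer
    show "word_of [x + y] - (word_of [x] + word_of [y]) \<in> uea_ideal" for x y :: 'g
      using uea_ideal.gen_add[of x y] by (simp add: diff_diff_eq)
  qed
  have "abs_uea (word_of [c *\<^sub>C x]) = abs_uea (single (Word [x]) c)"
    using uea_ideal.gen_scale[of c x] by (simp add: uea.abs_eq_iff)
  also have "single (Word [x]) c = single 0 c * word_of [x]"
    by (simp add: mult_single)
  finally show "uea_incl (c *\<^sub>C x) = c *\<^sub>C uea_incl x"
    by (simp add: uea_incl.abs_eq scaleC_uea_def times_uea.abs_eq)
qed

lemma uea_incl_bracket: "uea_incl (bracket x y) = uea_incl x * uea_incl y - uea_incl y * uea_incl x"
proof -
  have "word_of [x] * word_of [y] - word_of [y] * word_of [x] - word_of [bracket x y] \<in> uea_ideal"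
    using uea_ideal.gen_bracket[of x y] by (simp add: mult_single plus_word_def)
  then show ?thesis
    by (simp add: uea_incl.abs_eq times_uea.abs_eq minus_uea.abs_eq uea.abs_eq_iff uea_ideal_uminus_diff)
qed

lemma abs_uea_single_Word:
  "abs_uea (single (Word xs) c) = c *\<^sub>C prod_list (map uea_incl (xs :: 'g::complex_lie_algebra list))"
proof -
  have "abs_uea (word_of xs) = prod_list (map uea_incl xs)"
  proof (induction xs)
    case Nil
    show ?case by (simp add: one_uea.abs_eq flip: zero_word_def single_one)
  next
    case (Cons x xs)
    have "word_of (x # xs) = word_of [x] * word_of xs" by (simp add: mult_single plus_word_def)
    with Cons show ?case by (simp add: uea_incl.abs_eq flip: times_uea.abs_eq)
  qed
  moreover have "single (Word xs) c = single 0 c * word_of xs"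
    by (simp add: mult_single)
  ultimately show ?thesis by (simp add: scaleC_uea_def flip: times_uea.abs_eq)
qed

lemma uea_act_scaleC: "lie_module \<rho> \<Longrightarrow> uea_act \<rho> (c *\<^sub>C u) v = c *\<^sub>C uea_act \<rho> u v"
proof -
  assume \<rho>: "lie_module \<rho>"
  have "uea_act \<rho> (c *\<^sub>C u) v = uea_act \<rho> (abs_uea (single 0 c)) (uea_act \<rho> u v)"
    using left_module_uea_act[OF \<rho>] by (simp add: scaleC_uea_def left_module_def)
  also have "\<dots> = c *\<^sub>C uea_act \<rho> u v"
    by (simp add: uea_act_abs[OF \<rho>] zero_word_def free_act_single)
  finally show ?thesis .
qed

text \<open>The assumption \<open>flag\<close> says that \<open>b 0, \<dots>, b (i - 1)\<close> span an ideal for every \<open>i \<le> n\<close>.\<close>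

locale ideal_flag =
  fixes b :: "nat \<Rightarrow> 'g::complex_lie_algebra" and n :: nat and \<xi> :: "nat \<Rightarrow> 'g \<Rightarrow> complex"
  assumes clinear_coord: "clinear (\<xi> i)"
    and expand: "(\<Sum>i<n. \<xi> i x *\<^sub>C b i) = x"
    and coord_basis: "i < n \<Longrightarrow> j < n \<Longrightarrow> \<xi> i (b j) = (if i = j then 1 else 0)"
    and flag: "j < n \<Longrightarrow> k < n \<Longrightarrow> j < k \<Longrightarrow> \<xi> k (bracket x (b j)) = 0"
begin

lemma clinear_expand: "clinear f \<Longrightarrow> f x = (\<Sum>i<n. \<xi> i x *\<^sub>C f (b i))"
  by (subst expand[of x, symmetric]) (simp add: clinear_sum clinear_scale)

lemma flag_left: "j < n \<Longrightarrow> k < n \<Longrightarrow> j < k \<Longrightarrow> \<xi> k (bracket (b j) x) = 0"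
  using flag[of j k x] bracket_skew[of "b j" x] clinear_diff[OF clinear_coord, of k 0 "bracket x (b j)"]
    clinear_zero[OF clinear_coord, of k] by simp

section \<open>Rewriting words into decreasing ones, and its confluence\<close>

definition ascent :: "nat list \<Rightarrow> nat list \<times> nat \<times> nat \<times> nat list \<Rightarrow> bool"
  where "ascent w = (\<lambda>(u, j, k, v). w = u @ j # k # v \<and> j < k)"

text \<open>The words in a bracket term are shorter. Exchanging \<open>j < k\<close> to
  \<open>k, j\<close> keeps the length, and after reversal the first letter that changes is the
  former \<open>k\<close>, which becomes \<open>j\<close>.\<close>

definition word_less :: "(nat list \<times> nat list) set"
  where "word_less = inv_image (lenlex less_than) rev"

lemma wf_word_less: "wf word_less"
  unfolding word_less_def by (intro wf_inv_image wf_lenlex wf_less_than)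

lemma word_less_swap: "j < k \<Longrightarrow> (u @ k # j # v, u @ j # k # v) \<in> word_less"
proof -
  assume "j < k"
  then have "(rev v @ j # k # rev u, rev v @ k # j # rev u) \<in> lenlex less_than"
    by (auto simp: lenlex_conv lex_conv)
  then show ?thesis by (simp add: word_less_def)
qed

lemma word_less_shorter: "length w' < length w \<Longrightarrow> (w', w) \<in> word_less"
  by (simp add: word_less_def lenlex_conv)

lemma word_less_trans: "(w, w') \<in> word_less \<Longrightarrow> (w', w'') \<in> word_less \<Longrightarrow> (w, w'') \<in> word_less"
  unfolding word_less_def in_inv_image using lenlex_trans trans_less_than by blast

text \<open>Words are rewritten along \<open>x y = y x + [x, y]\<close>; the choice of the ascent will turn out not to matter.\<close>

function straighten :: "nat list \<Rightarrow> (nat list \<Rightarrow>\<^sub>0 complex)"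
  where "straighten w =
    (if \<exists>t. ascent w t then
      (case SOME t. ascent w t of (u, j, k, v) \<Rightarrow>
        straighten (u @ k # j # v) + (\<Sum>m<n. \<xi> m (bracket (b j) (b k)) *\<^sub>C straighten (u @ m # v)))
     else single w 1)"
  by pat_completeness auto
termination
proof (relation word_less)
  show "wf word_less" by (rule wf_word_less)
next
  fix w u y j z k v
  assume "Ex (ascent w)" "(u, y) = Eps (ascent w)" "(j, z) = y" "(k, v) = z"
  then have "ascent w (u, j, k, v)" by (metis someI_ex)
  then show "(u @ k # j # v, w) \<in> word_less" by (auto simp: ascent_def word_less_swap)
next
  fix w u y j z k v m
  assume "Ex (ascent w)" "(u, y) = Eps (ascent w)" "(j, z) = y" "(k, v) = z"
  then have "ascent w (u, j, k, v)" by (metis someI_ex)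
  then show "(u @ m # v, w) \<in> word_less" by (auto simp: ascent_def word_less_shorter)
qed

declare straighten.simps [simp del]

text \<open>Bracket terms are vectors, not letters; expanding them linearly makes identities of the
  Lie algebra, such as Jacobi, available inside a word.\<close>

definition straighten_at :: "nat list \<Rightarrow> 'g \<Rightarrow> nat list \<Rightarrow> (nat list \<Rightarrow>\<^sub>0 complex)"
  where "straighten_at u x v = (\<Sum>m<n. \<xi> m x *\<^sub>C straighten (u @ m # v))"

lemma clinear_straighten_at: "clinear (\<lambda>x. straighten_at u x v)"
  unfolding straighten_at_def
  by (rule clinearI)
    (simp_all add: clinear_add[OF clinear_coord] clinear_scale[OF clinear_coord] scaleC_add_left sum.distrib
      complex_vector.scale_sum_right scaleC_scaleC)

lemma straighten_normal: "(\<And>t. \<not> ascent w t) \<Longrightarrow> straighten w = single w 1"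
  by (subst straighten.simps) simp

lemma straighten_ascent:
  assumes "\<exists>t. ascent w t"
  obtains u j k v where "w = u @ j # k # v" "j < k"
    "straighten w = straighten (u @ k # j # v) + straighten_at u (bracket (b j) (b k)) v"
proof -
  obtain u j k v where t: "(SOME t. ascent w t) = (u, j, k, v)" using prod_cases4 by blast
  with someI_ex[OF assms] have "w = u @ j # k # v" "j < k" by (auto simp: ascent_def)
  moreover have "straighten w = straighten (u @ k # j # v) + straighten_at u (bracket (b j) (b k)) v"
    using assms t by (subst straighten.simps) (simp add: straighten_at_def)
  ultimately show ?thesis by (rule that)
qed

text \<open>The relation \<open>x y - y x = [x, y]\<close> of the enveloping algebra, asked of
  straightened words in the context \<open>u\<close>, \<open>v\<close>. That it always holds is the
  confluence of the rewriting.\<close>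

definition swap_rel :: "nat list \<Rightarrow> nat \<Rightarrow> nat \<Rightarrow> nat list \<Rightarrow> bool"
  where "swap_rel u j k v \<longleftrightarrow>
    straighten (u @ j # k # v) - straighten (u @ k # j # v) = straighten_at u (bracket (b j) (b k)) v"

lemma swap_rel_sym: "swap_rel u j k v \<Longrightarrow> swap_rel u k j v"
proof -
  assume *: "swap_rel u j k v"
  have "straighten_at u (bracket (b k) (b j)) v = - straighten_at u (bracket (b j) (b k)) v"
    using clinear_diff[OF clinear_straighten_at, of u 0 "bracket (b j) (b k)" v]
      clinear_zero[OF clinear_straighten_at, of u v]
    by (simp add: bracket_skew[of "b k"])
  with * show ?thesis unfolding swap_rel_def by (metis minus_diff_eq)
qed

lemma swap_rel_refl: "swap_rel u j j v"
  by (simp add: swap_rel_def bracket_self clinear_zero[OF clinear_straighten_at])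

lemma straighten_at_commute:
  assumes "\<And>m. swap_rel u m a v"
  shows "straighten_at u x (a # v) - straighten_at (u @ [a]) x v = straighten_at u (bracket x (b a)) v"
proof -
  have "straighten_at u x (a # v) - straighten_at (u @ [a]) x v
      = (\<Sum>m<n. \<xi> m x *\<^sub>C (straighten (u @ m # a # v) - straighten (u @ a # m # v)))"
    by (simp add: straighten_at_def complex_vector.scale_right_diff_distrib sum_subtractf)
  also have "\<dots> = (\<Sum>m<n. \<xi> m x *\<^sub>C straighten_at u (bracket (b m) (b a)) v)"
    using assms by (simp add: swap_rel_def)
  also have "\<dots> = straighten_at u (bracket x (b a)) v"
  proof -
    have "clinear (\<lambda>x. straighten_at u (bracket x (b a)) v)"
      by (rule clinearI) (simp_all add: bracket_add_left bracket_scale_left clinear_add[OF clinear_straighten_at]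
        clinear_scale[OF clinear_straighten_at])
    from clinear_expand[OF this, of x] show ?thesis by simp
  qed
  finally show ?thesis .
qed

text \<open>When the two ascents overlap, this is the Jacobi identity.\<close>

lemma straighten_confluent:
  assumes IH: "\<And>u j k v. (u @ j # k # v, w) \<in> word_less \<Longrightarrow> (u @ k # j # v, w) \<in> word_less \<Longrightarrow> swap_rel u j k v"
    and w1: "w = u1 @ j1 # k1 # v1" "j1 < k1" and w2: "w = u2 @ j2 # k2 # v2" "j2 < k2"
    and le: "length u1 \<le> length u2"
  shows "straighten (u1 @ k1 # j1 # v1) + straighten_at u1 (bracket (b j1) (b k1)) v1 =
    straighten (u2 @ k2 # j2 # v2) + straighten_at u2 (bracket (b j2) (b k2)) v2"
proof -
  obtain t where t: "u2 = u1 @ t" "j1 # k1 # v1 = t @ j2 # k2 # v2"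
  proof -
    have "u1 @ j1 # k1 # v1 = u2 @ j2 # k2 # v2" using w1(1) w2(1) by simp
    then consider us where "u1 = u2 @ us" "us @ j1 # k1 # v1 = j2 # k2 # v2"
      | us where "u2 = u1 @ us" "j1 # k1 # v1 = us @ j2 # k2 # v2"
      by (auto simp: append_eq_append_conv2)
    then show ?thesis
    proof cases
      case 1
      then show ?thesis using le that[of "[]"] by simp
    qed (use that in blast)
  qed
  have short: "swap_rel u j k v" if "length u + length v + 2 < length w" for u j k v
    using that by (intro IH word_less_shorter) simp_all
  \<comment> \<open>The same ascent, two overlapping ascents, or two disjoint ones.\<close>
  consider "t = []" | "t = [j1]" | x where "t = j1 # k1 # x"
    using t(2) by (cases t; cases "tl t") auto
  then show ?thesis
  proof cases
    case 1
    then show ?thesis using t by simp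
  next
    case 2
    \<comment> \<open>Both rewritings of \<open>a b c\<close> end at \<open>c b a\<close>: one
      passes \<open>b a c\<close> and \<open>b c a\<close>, the other \<open>a c b\<close> and
      \<open>c a b\<close>. All words on the way are below \<open>w\<close>, so the induction
      hypothesis applies to each exchange.\<close>
    let ?a = "j1" and ?b = "k1" and ?c = "k2" and ?u = "u1" and ?v = "v2"
    have eq: "j2 = ?b" "v1 = ?c # ?v" "u2 = ?u @ [?a]" using t 2 by auto
    have abc: "?a < ?b" "?b < ?c" using w1 w2 eq by auto
    have w: "w = ?u @ ?a # ?b # ?c # ?v" using w1 eq by simp
    have l1: "(?u @ ?b # ?a # ?c # ?v, w) \<in> word_less" using word_less_swap[OF abc(1), of ?u "?c # ?v"] w by simp
    have l2: "(?u @ ?b # ?c # ?a # ?v, ?u @ ?b # ?a # ?c # ?v) \<in> word_less"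
      using word_less_swap[of ?a ?c "?u @ [?b]" ?v] abc by simp
    have l3: "(?u @ ?c # ?b # ?a # ?v, ?u @ ?b # ?c # ?a # ?v) \<in> word_less"
      using word_less_swap[of ?b ?c ?u "?a # ?v"] abc by simp
    have m1: "(?u @ ?a # ?c # ?b # ?v, w) \<in> word_less" using word_less_swap[OF abc(2), of "?u @ [?a]" ?v] w by simp
    have m2: "(?u @ ?c # ?a # ?b # ?v, ?u @ ?a # ?c # ?b # ?v) \<in> word_less"
      using word_less_swap[of ?a ?c ?u "?b # ?v"] abc by simp
    note tr = word_less_trans
    have "swap_rel (?u @ [?b]) ?a ?c ?v" by (rule IH) (use l1 l2 tr in \<open>auto\<close>)
    then have e1: "straighten (?u @ ?b # ?a # ?c # ?v) = straighten (?u @ ?b # ?c # ?a # ?v) + straighten_at (?u @ [?b]) (bracket (b ?a) (b ?c)) ?v"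
      by (simp add: swap_rel_def algebra_simps)
    have "swap_rel ?u ?b ?c (?a # ?v)" by (rule IH) (use l1 l2 l3 tr in \<open>blast+\<close>)
    then have e2: "straighten (?u @ ?b # ?c # ?a # ?v) = straighten (?u @ ?c # ?b # ?a # ?v) + straighten_at ?u (bracket (b ?b) (b ?c)) (?a # ?v)"
      by (simp add: swap_rel_def algebra_simps)
    have "swap_rel ?u ?a ?c (?b # ?v)" by (rule IH) (use m1 m2 tr in \<open>blast+\<close>)
    then have e3: "straighten (?u @ ?a # ?c # ?b # ?v) = straighten (?u @ ?c # ?a # ?b # ?v) + straighten_at ?u (bracket (b ?a) (b ?c)) (?b # ?v)"
      by (simp add: swap_rel_def algebra_simps)
    have "(?u @ ?c # ?b # ?a # ?v, w) \<in> word_less" using l1 l2 l3 tr by blast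
    moreover have "(?u @ ?c # ?a # ?b # ?v, w) \<in> word_less" using m1 m2 tr by blast
    ultimately have "swap_rel (?u @ [?c]) ?a ?b ?v" by (intro IH) simp_all
    then have e4: "straighten (?u @ ?c # ?a # ?b # ?v) = straighten (?u @ ?c # ?b # ?a # ?v) + straighten_at (?u @ [?c]) (bracket (b ?a) (b ?b)) ?v"
      by (simp add: swap_rel_def algebra_simps)
    \<comment> \<open>Moves the letter outside the bracket to the same side in all correction terms;
      what remains are the double brackets of \<open>jac\<close>.\<close>
    have comm: "straighten_at ?u x (a # ?v) = straighten_at (?u @ [a]) x ?v + straighten_at ?u (bracket x (b a)) ?v" for x a
    proof -
      have "swap_rel ?u m a ?v" for m by (rule short) (simp add: w)
      from straighten_at_commute[OF this] show ?thesis by (simp add: algebra_simps)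
    qed
    have "bracket (bracket (b ?b) (b ?c)) (b ?a) + bracket (bracket (b ?a) (b ?b)) (b ?c)
        = bracket (bracket (b ?a) (b ?c)) (b ?b)"
      using bracket_skew[of "bracket (b ?b) (b ?c)" "b ?a"] bracket_skew[of "bracket (b ?a) (b ?c)" "b ?b"]
        jacobi_left[of "b ?a" "b ?b" "b ?c"] by simp
    then have jac: "straighten_at ?u (bracket (bracket (b ?b) (b ?c)) (b ?a)) ?v + straighten_at ?u (bracket (bracket (b ?a) (b ?b)) (b ?c)) ?v
        = straighten_at ?u (bracket (bracket (b ?a) (b ?c)) (b ?b)) ?v"
      by (simp flip: clinear_add[OF clinear_straighten_at])
    show ?thesis
      unfolding eq
      using jac by (simp add: e1 e2 e3 e4 comm algebra_simps)
  next
    case (3 x)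
    have eq: "u2 = u1 @ j1 # k1 # x" "v1 = x @ j2 # k2 # v2" using t 3 by auto
    have w: "w = u1 @ j1 # k1 # x @ j2 # k2 # v2" using w1 eq by simp
    have l1: "(u1 @ k1 # j1 # x @ j2 # k2 # v2, w) \<in> word_less"
      using word_less_swap[OF w1(2), of u1] w by simp
    have l2: "(u1 @ j1 # k1 # x @ k2 # j2 # v2, w) \<in> word_less"
      using word_less_swap[OF w2(2), of "u1 @ j1 # k1 # x"] w by simp
    have "(u1 @ k1 # j1 # x @ k2 # j2 # v2, u1 @ k1 # j1 # x @ j2 # k2 # v2) \<in> word_less"
      using word_less_swap[OF w2(2), of "u1 @ k1 # j1 # x"] by simp
    then have l3: "(u1 @ k1 # j1 # x @ k2 # j2 # v2, w) \<in> word_less" using l1 word_less_trans by blast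
    have "swap_rel (u1 @ k1 # j1 # x) j2 k2 v2" by (rule IH) (use l1 l3 in simp_all)
    then have e1: "straighten (u1 @ k1 # j1 # x @ j2 # k2 # v2) = straighten (u1 @ k1 # j1 # x @ k2 # j2 # v2)
        + straighten_at (u1 @ k1 # j1 # x) (bracket (b j2) (b k2)) v2"
      by (simp add: swap_rel_def algebra_simps)
    have "swap_rel u1 j1 k1 (x @ k2 # j2 # v2)" by (rule IH) (use l2 l3 in simp_all)
    then have e2: "straighten (u1 @ j1 # k1 # x @ k2 # j2 # v2) = straighten (u1 @ k1 # j1 # x @ k2 # j2 # v2)
        + straighten_at u1 (bracket (b j1) (b k1)) (x @ k2 # j2 # v2)"
      by (simp add: swap_rel_def algebra_simps)
    have r1: "straighten ((u1 @ m # x) @ j2 # k2 # v2) = straighten ((u1 @ m # x) @ k2 # j2 # v2)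
        + straighten_at (u1 @ m # x) (bracket (b j2) (b k2)) v2" for m
      using short[of "u1 @ m # x" v2 j2 k2] w unfolding swap_rel_def by (simp add: algebra_simps)
    have r2: "straighten (u1 @ j1 # k1 # x @ m # v2) = straighten (u1 @ k1 # j1 # x @ m # v2)
        + straighten_at u1 (bracket (b j1) (b k1)) (x @ m # v2)" for m
      using short[of u1 "x @ m # v2" j1 k1] w unfolding swap_rel_def by (simp add: algebra_simps)
    \<comment> \<open>Each exchange changes the correction term of the other by the term in which
      both pairs are replaced by brackets. This double sum is the same on both sides.\<close>
    let ?p = "bracket (b j1) (b k1)" and ?q = "bracket (b j2) (b k2)"
    have f1: "straighten_at u1 ?p (x @ j2 # k2 # v2) = straighten_at u1 ?p (x @ k2 # j2 # v2)
        + (\<Sum>m<n. \<Sum>l<n. (\<xi> m ?p * \<xi> l ?q) *\<^sub>C straighten (u1 @ m # x @ l # v2))"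
      using r1 by (simp add: straighten_at_def scaleC_add_right sum.distrib complex_vector.scale_sum_right scaleC_scaleC)
    have "straighten_at (u1 @ j1 # k1 # x) ?q v2 = straighten_at (u1 @ k1 # j1 # x) ?q v2
        + (\<Sum>l<n. \<Sum>m<n. (\<xi> m ?p * \<xi> l ?q) *\<^sub>C straighten (u1 @ m # x @ l # v2))"
      using r2 by (simp add: straighten_at_def scaleC_add_right sum.distrib complex_vector.scale_sum_right scaleC_scaleC mult.commute)
    also have "(\<Sum>l<n. \<Sum>m<n. (\<xi> m ?p * \<xi> l ?q) *\<^sub>C straighten (u1 @ m # x @ l # v2))
        = (\<Sum>m<n. \<Sum>l<n. (\<xi> m ?p * \<xi> l ?q) *\<^sub>C straighten (u1 @ m # x @ l # v2))"
      by (rule sum.swap)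
    finally have f2: "straighten_at (u1 @ j1 # k1 # x) ?q v2 = straighten_at (u1 @ k1 # j1 # x) ?q v2
        + (\<Sum>m<n. \<Sum>l<n. (\<xi> m ?p * \<xi> l ?q) *\<^sub>C straighten (u1 @ m # x @ l # v2))" .
    show ?thesis unfolding eq by (simp add: e1 e2 f1 f2 algebra_simps)
  qed
qed

text \<open>\<open>straighten\<close> rewrites at one chosen ascent; by
  \<open>straighten_confluent\<close> any other ascent of the same word gives the same result. The
  induction supplies the exchange relation for the smaller words, in either order of the two
  letters.\<close>

lemma swap_rel_ascent: "w = u @ j # k # v \<Longrightarrow> j < k \<Longrightarrow> swap_rel u j k v"
proof (induction w arbitrary: u j k v rule: wf_induct_rule[OF wf_word_less])
  case (1 w)
  have IH: "swap_rel u j k v" if "(u @ j # k # v, w) \<in> word_less" "(u @ k # j # v, w) \<in> word_less" for u j k v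
    using 1(1)[OF that(1) refl] 1(1)[OF that(2) refl] swap_rel_sym swap_rel_refl
    by (metis linorder_neqE_nat)
  have "\<exists>t. ascent w t" using 1(2,3) by (auto simp: ascent_def)
  then obtain u' j' k' v' where s: "w = u' @ j' # k' # v'" "j' < k'"
    "straighten w = straighten (u' @ k' # j' # v') + straighten_at u' (bracket (b j') (b k')) v'"
    by (rule straighten_ascent)
  have "straighten w = straighten (u @ k # j # v) + straighten_at u (bracket (b j) (b k)) v"
  proof (cases "length u \<le> length u'")
    case True
    show ?thesis using straighten_confluent[OF IH 1(2,3) s(1,2) True] s(3) by simp
  next
    case False
    then show ?thesis using straighten_confluent[OF IH s(1,2) 1(2,3)] s(3) by simp
  qed
  then show ?case using 1(2) by (simp add: swap_rel_def)
qed

lemma swap_holds: "swap_rel u j k v"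
  using swap_rel_ascent[OF refl] swap_rel_sym swap_rel_refl by (metis linorder_neqE_nat)

text \<open>The step speaks of an arbitrary ascent instead of the chosen one, which fits
  \<open>straighten_step\<close>.\<close>

lemma straighten_induct [consumes 0, case_names normal step]:
  assumes "\<And>w. (\<And>t. \<not> ascent w t) \<Longrightarrow> P w"
    and "\<And>u j k v. j < k \<Longrightarrow> P (u @ k # j # v) \<Longrightarrow> (\<And>m. P (u @ m # v)) \<Longrightarrow> P (u @ j # k # v)"
  shows "P w"
proof (induction w rule: wf_induct_rule[OF wf_word_less])
  case (1 w)
  show ?case
  proof (cases "\<exists>t. ascent w t")
    case True
    then obtain u j k v where w: "w = u @ j # k # v" "j < k" by (auto simp: ascent_def)
    then show ?thesis using assms(2)[of j k u v] 1 word_less_swap word_less_shorter by simp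
  qed (use assms(1) in blast)
qed

lemma straighten_step:
  "straighten (u @ j # k # v) = straighten (u @ k # j # v) + (\<Sum>m<n. \<xi> m (bracket (b j) (b k)) *\<^sub>C straighten (u @ m # v))"
  using swap_holds[of u j k v] by (simp add: swap_rel_def straighten_at_def algebra_simps)

text \<open>The representation behind the linear independence in the Poincare-Birkhoff-Witt theorem:
  \<open>x\<close> is put in front of a word and the result is straightened.\<close>

definition pbw_act :: "'g \<Rightarrow> (nat list \<Rightarrow>\<^sub>0 complex) \<Rightarrow> (nat list \<Rightarrow>\<^sub>0 complex)"
  where "pbw_act x = linear_extension (straighten_at [] x)"

lemma clinear_pbw_act: "clinear (pbw_act x)"
  unfolding pbw_act_def by (rule clinear_linear_extension)

text \<open>It does not matter whether a word is straightened before \<open>x\<close> is put in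
  front, because the same rewriting steps are available behind an additional first letter.\<close>

lemma pbw_act_straighten: "pbw_act x (straighten w) = straighten_at [] x w"
proof (induction w rule: straighten_induct)
  case (normal w)
  then show ?case by (simp add: straighten_normal pbw_act_def scaleC_one)
next
  case (step u j k v)
  have "pbw_act x (straighten (u @ j # k # v)) =
      straighten_at [] x (u @ k # j # v) + (\<Sum>m<n. \<xi> m (bracket (b j) (b k)) *\<^sub>C straighten_at [] x (u @ m # v))"
    using step by (simp add: straighten_step[of u j k v] clinear_add[OF clinear_pbw_act] clinear_sum[OF clinear_pbw_act]
      clinear_scale[OF clinear_pbw_act])
  also have "(\<Sum>m<n. \<xi> m (bracket (b j) (b k)) *\<^sub>C straighten_at [] x (u @ m # v)) =
      (\<Sum>i<n. \<Sum>m<n. (\<xi> m (bracket (b j) (b k)) * \<xi> i x) *\<^sub>C straighten (i # u @ m # v))"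
    by (subst sum.swap) (simp add: straighten_at_def complex_vector.scale_sum_right scaleC_scaleC)
  also have "straighten_at [] x (u @ k # j # v) + \<dots> = straighten_at [] x (u @ j # k # v)"
    using straighten_step[of "_ # u" j k v]
    by (simp add: straighten_at_def scaleC_add_right sum.distrib complex_vector.scale_sum_right scaleC_scaleC mult.commute)
  finally show ?case .
qed

text \<open>On a single word the bracket relation is \<open>swap_rel\<close> with empty left
  context, summed over the coordinates of \<open>x\<close> and \<open>y\<close>.\<close>

lemma lie_module_pbw_act: "lie_module pbw_act"
proof -
  have lin: "clinear (\<lambda>x. pbw_act x p)" for p
    unfolding pbw_act_def linear_extension_def
    by (rule clinearI)
      (simp_all add: clinear_add[OF clinear_straighten_at] clinear_scale[OF clinear_straighten_at] scaleC_add_right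
        sum.distrib complex_vector.scale_sum_right scaleC_scaleC mult.commute)
  have single: "pbw_act y (single w 1) = straighten_at [] y w" for y w
    by (simp add: pbw_act_def scaleC_one)
  have two: "pbw_act x (straighten_at [] y w) = (\<Sum>j<n. \<Sum>k<n. (\<xi> j x * \<xi> k y) *\<^sub>C straighten (j # k # w))" for x y w
  proof -
    have "pbw_act x (straighten_at [] y w) = (\<Sum>k<n. \<xi> k y *\<^sub>C straighten_at [] x (k # w))"
      by (simp add: straighten_at_def[of "[]" y] clinear_sum[OF clinear_pbw_act] clinear_scale[OF clinear_pbw_act]
          pbw_act_straighten)
    also have "\<dots> = (\<Sum>k<n. \<Sum>j<n. (\<xi> j x * \<xi> k y) *\<^sub>C straighten (j # k # w))"
      by (simp add: straighten_at_def complex_vector.scale_sum_right scaleC_scaleC mult.commute)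
    finally show ?thesis by (subst sum.swap) simp
  qed
  have br: "pbw_act (bracket x y) (single w 1) =
      pbw_act x (pbw_act y (single w 1)) - pbw_act y (pbw_act x (single w 1))" for x y w
  proof -
    have "pbw_act x (straighten_at [] y w) - pbw_act y (straighten_at [] x w)
       = (\<Sum>j<n. \<Sum>k<n. (\<xi> j x * \<xi> k y) *\<^sub>C straighten (j # k # w))
         - (\<Sum>j<n. \<Sum>k<n. (\<xi> j x * \<xi> k y) *\<^sub>C straighten (k # j # w))"
      unfolding two by (subst (3) sum.swap) (simp add: mult.commute)
    also have "\<dots> = (\<Sum>j<n. \<Sum>k<n. (\<xi> j x * \<xi> k y) *\<^sub>C straighten_at [] (bracket (b j) (b k)) w)"
      using swap_holds[of "[]" _ _ w]
      by (simp add: swap_rel_def flip: sum_subtractf complex_vector.scale_right_diff_distrib)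
    also have "\<dots> = (\<Sum>j<n. \<xi> j x *\<^sub>C straighten_at [] (bracket (b j) y) w)"
    proof (rule sum.cong[OF refl])
      fix j
      have "clinear (\<lambda>y. straighten_at [] (bracket (b j) y) w)"
        by (rule clinearI) (simp_all add: bracket_add_right bracket_scale_right clinear_add[OF clinear_straighten_at]
          clinear_scale[OF clinear_straighten_at])
      from clinear_expand[OF this, of y]
      show "(\<Sum>k<n. (\<xi> j x * \<xi> k y) *\<^sub>C straighten_at [] (bracket (b j) (b k)) w) = \<xi> j x *\<^sub>C straighten_at [] (bracket (b j) y) w"
        by (simp add: complex_vector.scale_sum_right scaleC_scaleC)
    qed
    also have "\<dots> = straighten_at [] (bracket x y) w"
    proof -
      have "clinear (\<lambda>x. straighten_at [] (bracket x y) w)"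
        by (rule clinearI) (simp_all add: bracket_add_left bracket_scale_left clinear_add[OF clinear_straighten_at]
          clinear_scale[OF clinear_straighten_at])
      from clinear_expand[OF this, of x] show ?thesis by simp
    qed
    finally show ?thesis by (simp add: single)
  qed
  have "pbw_act (bracket x y) p = pbw_act x (pbw_act y p) - pbw_act y (pbw_act x p)" for x y p
    by (rule clinear_poly_mapping_eqI[of "pbw_act (bracket x y)" "\<lambda>p. pbw_act x (pbw_act y p) - pbw_act y (pbw_act x p)"])
      (auto intro!: clinear_pbw_act clinearI simp: br clinear_add[OF clinear_pbw_act] clinear_scale[OF clinear_pbw_act]
        complex_vector.scale_right_diff_distrib)
  then show ?thesis unfolding lie_module_def using lin clinear_pbw_act by blast
qed

section \<open>Monomials and normal forms\<close>

definition monomial :: "nat list \<Rightarrow> 'g uea"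
  where "monomial w = prod_list (map (\<lambda>i. uea_incl (b i)) w)"

lemma monomial_simps [simp]: "monomial [] = 1" "monomial (i # w) = uea_incl (b i) * monomial w"
  "monomial (u @ v) = monomial u * monomial v"
  by (simp_all add: monomial_def)

lemma monomial_step:
  "monomial (u @ j # k # v) = monomial (u @ k # j # v) + (\<Sum>m<n. \<xi> m (bracket (b j) (b k)) *\<^sub>C monomial (u @ m # v))"
proof -
  have "(\<Sum>m<n. \<xi> m (bracket (b j) (b k)) *\<^sub>C monomial (u @ m # v)) = monomial u * uea_incl (bracket (b j) (b k)) * monomial v"
    by (subst clinear_expand[OF uea_incl_clinear, of "bracket (b j) (b k)"])
      (simp add: sum_distrib_left sum_distrib_right uea_mult_scaleC_left uea_mult_scaleC_right mult.assoc)
  then show ?thesis by (simp add: uea_incl_bracket algebra_simps)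
qed

lemma uea_span_monomials: "u \<in> cspan (monomial ` {w. set w \<subseteq> {..<n}})"
proof -
  let ?S = "cspan (monomial ` {w. set w \<subseteq> {..<n}})"
  have b: "uea_incl (b i) * v \<in> ?S" if "v \<in> ?S" "i < n" for v i
    using that(1)
  proof (induction rule: complex_vector.span_induct_alt)
    case base
    then show ?case by (simp add: complex_vector.span_zero)
  next
    case (step c x y)
    then obtain w where "set w \<subseteq> {..<n}" "x = monomial w" by blast
    then have "uea_incl (b i) * x = monomial (i # w)" "set (i # w) \<subseteq> {..<n}" using that(2) by simp_all
    then have "uea_incl (b i) * x \<in> ?S" by (metis complex_vector.span_base imageI mem_Collect_eq)
    then show ?case using step(2)
      by (simp add: distrib_left uea_mult_scaleC_right complex_vector.span_add complex_vector.span_scale)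
  qed
  have x: "uea_incl x * v \<in> ?S" if "v \<in> ?S" for x v
    by (subst clinear_expand[OF uea_incl_clinear, of x])
      (auto simp: sum_distrib_right uea_mult_scaleC_left intro!: complex_vector.span_sum complex_vector.span_scale b that)
  have one: "1 \<in> ?S" by (rule complex_vector.span_base, rule image_eqI[of _ _ "[]"]) simp_all
  have p: "prod_list (map uea_incl xs) \<in> ?S" for xs
    by (induction xs) (simp_all add: one x)
  obtain q where q: "u = abs_uea q" by (rule uea_cases)
  have "abs_uea q \<in> ?S"
  proof (induction q rule: poly_mapping_single_plus_induct)
    case zero
    show ?case by (simp add: complex_vector.span_zero flip: zero_uea.abs_eq)
  next
    case (single_plus w c q)
    then show ?case
      by (cases w) (simp add: abs_uea_single_Word complex_vector.span_add complex_vector.span_scale p flip: plus_uea.abs_eq)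
  qed
  then show ?thesis by (simp add: q)
qed

text \<open>The enveloping algebra acts on the empty word. Since this is an action of the quotient
  algebra, the result depends on the element only and not on how it is written by monomials.\<close>

definition normal_form :: "'g uea \<Rightarrow> (nat list \<Rightarrow>\<^sub>0 complex)"
  where "normal_form u = uea_act pbw_act u (single [] 1)"

lemma left_module_pbw: "left_module (uea_act pbw_act)"
  by (rule left_module_uea_act[OF lie_module_pbw_act])

lemma clinear_normal_form: "clinear normal_form"
  unfolding normal_form_def
  by (rule clinearI) (use left_module_pbw in \<open>simp_all add: left_module_def uea_act_scaleC[OF lie_module_pbw_act]\<close>)

lemma normal_form_monomial: "set w \<subseteq> {..<n} \<Longrightarrow> normal_form (monomial w) = straighten w"
proof (induction w)
  case Nil
  have "straighten [] = single [] 1" by (rule straighten_normal) (auto simp: ascent_def)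
  then show ?case using left_module_pbw by (simp add: normal_form_def left_module_def)
next
  case (Cons i w)
  have "normal_form (monomial (i # w)) = pbw_act (b i) (straighten w)"
    using left_module_pbw Cons by (simp add: normal_form_def left_module_def uea_act_incl[OF lie_module_pbw_act])
  also have "\<dots> = (\<Sum>m<n. if m = i then straighten (i # w) else 0)"
    unfolding pbw_act_straighten straighten_at_def
    using Cons.prems by (intro sum.cong) (auto simp: coord_basis scaleC_one)
  also have "\<dots> = straighten (i # w)" using Cons.prems by simp
  finally show ?case .
qed

text \<open>Words and monomials obey the same rewriting step, so replacing the words of a normal
  form by monomials undoes it.\<close>

lemma linear_extension_normal_form: "linear_extension monomial (normal_form u) = u"
proof -
  have str: "linear_extension monomial (straighten w) = monomial w" for w
  proof (induction w rule: straighten_induct)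
    case (normal w)
    then show ?case by (simp add: straighten_normal scaleC_one)
  next
    case (step u j k v)
    then show ?case
      by (simp only: straighten_step[of u j k v] monomial_step[of u j k v] clinear_add[OF clinear_linear_extension]
        clinear_sum[OF clinear_linear_extension] clinear_scale[OF clinear_linear_extension])
  qed
  show ?thesis
    using uea_span_monomials[of u]
  proof (induction rule: complex_vector.span_induct_alt)
    case base
    show ?case by (simp add: clinear_zero[OF clinear_normal_form] clinear_zero[OF clinear_linear_extension])
  next
    case (step c x y)
    then show ?case
      by (auto simp: clinear_add[OF clinear_normal_form] clinear_add[OF clinear_linear_extension]
        clinear_scale[OF clinear_normal_form] clinear_scale[OF clinear_linear_extension] normal_form_monomial str)
  qed
qed

text \<open>Transports any predicate preserved by both kinds of rewriting to the words of a
  straightened form; applied to the range of the letters and to \<open>low\<close>.\<close>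

lemma keys_straighten:
  assumes Q: "Q w"
    and step: "\<And>u j k v. Q (u @ j # k # v) \<Longrightarrow> Q (u @ k # j # v)"
      "\<And>u j k v m. Q (u @ j # k # v) \<Longrightarrow> m < n \<Longrightarrow> \<xi> m (bracket (b j) (b k)) \<noteq> 0 \<Longrightarrow> Q (u @ m # v)"
  shows "w' \<in> keys (straighten w) \<Longrightarrow> Q w' \<and> (\<forall>t. \<not> ascent w' t)"
  using Q
proof (induction w rule: straighten_induct)
  case (normal w)
  then show ?case by (simp add: straighten_normal)
next
  case (step u j k v)
  have "w' \<in> keys (straighten (u @ k # j # v)) \<or>
    (\<exists>m<n. \<xi> m (bracket (b j) (b k)) \<noteq> 0 \<and> w' \<in> keys (straighten (u @ m # v)))"
  proof (rule ccontr)
    assume no: "\<not> ?thesis"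
    then have "(\<Sum>m<n. \<xi> m (bracket (b j) (b k)) * lookup (straighten (u @ m # v)) w') = 0"
      by (intro sum.neutral) (auto simp: in_keys_iff)
    with no have "lookup (straighten (u @ j # k # v)) w' = 0"
      by (simp add: straighten_step[of u j k v] lookup_add lookup_sum in_keys_iff)
    then show False using step.prems by (simp add: in_keys_iff)
  qed
  then show ?case
  proof (elim disjE exE conjE)
    assume "w' \<in> keys (straighten (u @ k # j # v))"
    then show ?thesis using step.IH(1) assms(2)[OF step.prems(2)] by simp
  next
    fix m assume "m < n" "\<xi> m (bracket (b j) (b k)) \<noteq> 0" "w' \<in> keys (straighten (u @ m # v))"
    then show ?thesis using step.IH(2)[of m] assms(3)[OF step.prems(2)] by simp
  qed
qed

definition low :: "nat \<Rightarrow> nat list \<Rightarrow> bool"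
  where "low i w \<longleftrightarrow> set w \<subseteq> {..<n} \<and> (\<exists>j\<in>set w. j < i)"

text \<open>By the flag, the bracket of two basis vectors involves only indices up to the smaller of
  the two. So a letter below \<open>i\<close> is replaced by letters below \<open>i\<close>.\<close>

lemma keys_straighten_low:
  assumes "low i w" "w' \<in> keys (straighten w)"
  shows "low i w'"
proof -
  have "low i (u @ m # v)" if "low i (u @ j # k # v)" "m < n" "\<xi> m (bracket (b j) (b k)) \<noteq> 0" for u j k v m
  proof -
    have "j < n" "k < n" using that(1) by (auto simp: low_def)
    then have "m \<le> j" "m \<le> k" using flag[of k m "b j"] flag_left[of j m "b k"] that(2,3) by (auto simp: not_le[symmetric])
    then show ?thesis using that(1,2) by (auto simp: low_def)
  qed
  moreover have "low i (u @ k # j # v)" if "low i (u @ j # k # v)" for u j k v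
    using that by (auto simp: low_def)
  ultimately show ?thesis using keys_straighten[of "low i", OF assms(1) _ _ assms(2)] by blast
qed

lemma keys_normal_form:
  assumes "w \<in> keys (normal_form u)"
  shows "set w \<subseteq> {..<n}" "\<And>t. \<not> ascent w t"
proof -
  let ?P = "\<lambda>p. \<forall>w\<in>keys p. set w \<subseteq> {..<n} \<and> (\<forall>t. \<not> ascent w t)"
  have "?P (normal_form u)"
    using uea_span_monomials[of u]
  proof (induction rule: complex_vector.span_induct_alt)
    case base
    show ?case by (simp add: clinear_zero[OF clinear_normal_form])
  next
    case (step c x y)
    then obtain w where w: "set w \<subseteq> {..<n}" "x = monomial w" by blast
    have "?P (straighten w)"
      using keys_straighten[of "\<lambda>w. set w \<subseteq> {..<n}" w] w(1) by auto
    then show ?case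
      using step(2) w
      by (auto simp: clinear_add[OF clinear_normal_form] clinear_scale[OF clinear_normal_form] normal_form_monomial
        dest!: subsetD[OF keys_add] subsetD[OF keys_scaleC])
  qed
  with assms show "set w \<subseteq> {..<n}" "\<And>t. \<not> ascent w t" by auto
qed

section \<open>The left ideals generated by the flag, and regularity\<close>

definition left_ideal :: "nat \<Rightarrow> 'g uea set"
  where "left_ideal i = {(\<Sum>j<i. f j * uea_incl (b j)) | f. True}"

lemma left_idealI: "(\<Sum>j<i. f j * uea_incl (b j)) \<in> left_ideal i"
  by (auto simp: left_ideal_def)

lemma left_ideal_gen: "j < i \<Longrightarrow> u * uea_incl (b j) \<in> left_ideal i"
  using left_idealI[of "\<lambda>l. if l = j then u else 0" i] by (simp add: if_distrib[of "\<lambda>z. z * _"] cong: if_cong)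

lemma left_ideal_add: "u \<in> left_ideal i \<Longrightarrow> v \<in> left_ideal i \<Longrightarrow> u + v \<in> left_ideal i"
  by (auto simp: left_ideal_def distrib_right sum.distrib intro: exI[of _ "\<lambda>j. f j + g j" for f g])

lemma left_ideal_mult: "v \<in> left_ideal i \<Longrightarrow> u * v \<in> left_ideal i"
  by (auto simp: left_ideal_def sum_distrib_left mult.assoc intro: exI[of _ "\<lambda>j. u * f j" for f])

lemma left_ideal_diff: "u \<in> left_ideal i \<Longrightarrow> v \<in> left_ideal i \<Longrightarrow> u - v \<in> left_ideal i"
  using left_ideal_add[of u i "(- 1) * v"] left_ideal_mult[of v i "- 1"] by simp

lemma left_ideal_sum: "finite A \<Longrightarrow> (\<And>a. a \<in> A \<Longrightarrow> f a \<in> left_ideal i) \<Longrightarrow> sum f A \<in> left_ideal i"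
proof (induction A rule: finite_induct)
  case empty
  show ?case using left_idealI[of "\<lambda>_. 0" i] by simp
qed (simp add: left_ideal_add)

lemma left_ideal_scaleC: "v \<in> left_ideal i \<Longrightarrow> c *\<^sub>C v \<in> left_ideal i"
  by (simp add: scaleC_uea_def left_ideal_mult)

text \<open>The first \<open>i\<close> vectors span an ideal, so
  \<open>b j b k = b k b j + [b j, b k]\<close> stays in the left ideal for
  \<open>j < i\<close>.\<close>

lemma left_ideal_mult_right:
  assumes "u \<in> left_ideal i" "i \<le> n" "k < n"
  shows "u * uea_incl (b k) \<in> left_ideal i"
proof -
  obtain f where u: "u = (\<Sum>j<i. f j * uea_incl (b j))" using assms(1) by (auto simp: left_ideal_def)
  have "f j * uea_incl (b j) * uea_incl (b k) \<in> left_ideal i" if j: "j < i" for j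
  proof -
    have "uea_incl (b j) * uea_incl (b k) = uea_incl (b k) * uea_incl (b j) + uea_incl (bracket (b j) (b k))"
      by (simp add: uea_incl_bracket)
    moreover have "uea_incl (bracket (b j) (b k)) \<in> left_ideal i"
    proof (subst clinear_expand[OF uea_incl_clinear], rule left_ideal_sum)
      fix m assume "m \<in> {..<n}"
      show "\<xi> m (bracket (b j) (b k)) *\<^sub>C uea_incl (b m) \<in> left_ideal i"
      proof (cases "m < i")
        case True
        then show ?thesis using left_ideal_gen[of m i 1] by (simp add: left_ideal_scaleC)
      next
        case False
        then have "\<xi> m (bracket (b j) (b k)) = 0" using flag_left[of j m "b k"] j assms(2) \<open>m \<in> {..<n}\<close> by simp
        then show ?thesis using left_ideal_sum[of "{}"] by simp
      qed
    qed simp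
    ultimately have "uea_incl (b j) * uea_incl (b k) \<in> left_ideal i"
      using j by (simp add: left_ideal_add left_ideal_gen)
    then show ?thesis by (simp add: mult.assoc left_ideal_mult)
  qed
  then show ?thesis unfolding u sum_distrib_right by (intro left_ideal_sum) auto
qed

text \<open>For a monomial, right multiplication by \<open>b j\<close> with \<open>j < i\<close>
  appends the letter \<open>j\<close>, and low words stay low under straightening.\<close>

lemma normal_form_left_ideal:
  assumes "u \<in> left_ideal i" "i \<le> n" "w \<in> keys (normal_form u)"
  shows "low i w"
proof -
  let ?K = "{p. \<forall>w\<in>keys p. low i w}"
  have K: "csubspace ?K"
    by (rule complex_vector.subspaceI) (auto dest: subsetD[OF keys_add] subsetD[OF keys_scaleC])
  have "normal_form (v * uea_incl (b j)) \<in> ?K" if j: "j < i" for v j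
    using uea_span_monomials[of v]
  proof (induction rule: complex_vector.span_induct_alt)
    case base
    show ?case by (simp add: clinear_zero[OF clinear_normal_form])
  next
    case (step c x y)
    then obtain w where w: "set w \<subseteq> {..<n}" "x = monomial w" by blast
    then have "low i (w @ [j])" using j assms(2) by (auto simp: low_def)
    then have "straighten (w @ [j]) \<in> ?K" using keys_straighten_low by blast
    moreover have "x * uea_incl (b j) = monomial (w @ [j])" by (simp add: w)
    moreover have "set (w @ [j]) \<subseteq> {..<n}" using w j assms(2) by simp
    ultimately have "normal_form (x * uea_incl (b j)) \<in> ?K" by (simp only: normal_form_monomial)
    with step(2) show ?case
      using complex_vector.subspace_add[OF K complex_vector.subspace_scale[OF K]]
      by (simp only: distrib_right uea_mult_scaleC_left clinear_add[OF clinear_normal_form] clinear_scale[OF clinear_normal_form])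
  qed
  moreover obtain f where "u = (\<Sum>j<i. f j * uea_incl (b j))" using assms(1) by (auto simp: left_ideal_def)
  ultimately have "normal_form u \<in> ?K"
    by (simp only: clinear_sum[OF clinear_normal_form]) (rule complex_vector.subspace_sum[OF K], simp)
  then show ?thesis using assms(3) by blast
qed

lemma no_ascent_iff: "(\<forall>t. \<not> ascent w t) \<longleftrightarrow> sorted_wrt (\<ge>) w"
proof
  assume no: "\<forall>t. \<not> ascent w t"
  have "w ! Suc i \<le> w ! i" if "Suc i < length w" for i
  proof -
    have "w = take i w @ w ! i # w ! Suc i # drop (Suc (Suc i)) w"
      using that by (metis Cons_nth_drop_Suc Suc_lessD append_take_drop_id)
    then show ?thesis using no by (auto simp: ascent_def not_less[symmetric])
  qed
  then show "sorted_wrt (\<ge>) w"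
    by (subst sorted_wrt_iff_nth_Suc_transp) (auto simp: transp_def)
qed (auto simp: ascent_def sorted_wrt_append)

text \<open>In the basis of decreasing monomials, those ending in a letter below \<open>i\<close> span \<open>left_ideal i\<close>, and
  right multiplication by \<open>b i\<close> just appends a letter to the others.\<close>

theorem left_ideal_regular:
  assumes i: "i < n" and u: "u * uea_incl (b i) \<in> left_ideal i"
  shows "u \<in> left_ideal i"
proof -
  define p where "p = normal_form u"
  \<comment> \<open>\<open>H\<close> collects the normal words without letters below
    \<open>i\<close>; only this part of \<open>u\<close> can obstruct.\<close>
  define H where "H = {w \<in> keys p. \<not> low i w}"
  define uh where "uh = (\<Sum>w\<in>H. lookup p w *\<^sub>C monomial w)"
  define ul where "ul = (\<Sum>w\<in>keys p - H. lookup p w *\<^sub>C monomial w)"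
  have fin: "finite H" by (simp add: H_def)
  have "u = ul + uh"
    using linear_extension_normal_form[of u] sum.subset_diff[of H "keys p" "\<lambda>w. lookup p w *\<^sub>C monomial w"]
    by (auto simp: linear_extension_def p_def[symmetric] ul_def uh_def H_def)
  have keys: "set w \<subseteq> {..<n}" "sorted_wrt (\<ge>) w" if "w \<in> keys p" for w
    using that keys_normal_form[of w u] by (auto simp: p_def no_ascent_iff[symmetric])
  have ul: "ul \<in> left_ideal i"
    unfolding ul_def
  proof (rule left_ideal_sum)
    fix w assume "w \<in> keys p - H"
    then have w: "low i w" "sorted_wrt (\<ge>) w" using keys(2) by (auto simp: H_def)
    then obtain w' j where w': "w = w' @ [j]" by (metis low_def empty_iff empty_set rev_exhaust)
    then have "j < i" using w by (auto simp: low_def sorted_wrt_append)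
    then show "lookup p w *\<^sub>C monomial w \<in> left_ideal i"
      using left_ideal_gen[of j i "monomial w'"] by (simp add: w' left_ideal_scaleC)
  qed simp
  \<comment> \<open>A decreasing word with all letters at least \<open>i\<close> stays decreasing
    when \<open>i\<close> is appended, so no rewriting takes place.\<close>
  have Hi: "set (w @ [i]) \<subseteq> {..<n}" "straighten (w @ [i]) = single (w @ [i]) 1" "\<not> low i (w @ [i])" if "w \<in> H" for w
  proof -
    from that have w: "w \<in> keys p" "\<forall>j\<in>set w. i \<le> j" using keys(1) by (fastforce simp: H_def low_def)+
    show "set (w @ [i]) \<subseteq> {..<n}" using keys(1)[OF w(1)] i by simp
    have "sorted_wrt (\<ge>) (w @ [i])" using keys(2)[OF w(1)] w(2) by (simp add: sorted_wrt_append)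
    then show "straighten (w @ [i]) = single (w @ [i]) 1"
      by (intro straighten_normal) (metis no_ascent_iff)
    show "\<not> low i (w @ [i])" using w(2) by (force simp: low_def)
  qed
  have "uh * uea_incl (b i) = u * uea_incl (b i) - ul * uea_incl (b i)"
    by (simp add: \<open>u = ul + uh\<close> distrib_right)
  also have "\<dots> \<in> left_ideal i" using u left_ideal_mult_right[OF ul _ i] i by (simp add: left_ideal_diff)
  finally have uhi: "uh * uea_incl (b i) \<in> left_ideal i" .
  have "uh * uea_incl (b i) = (\<Sum>w\<in>H. lookup p w *\<^sub>C monomial (w @ [i]))"
    by (simp add: uh_def sum_distrib_right uea_mult_scaleC_left)
  then have nf: "normal_form (uh * uea_incl (b i)) = (\<Sum>w\<in>H. lookup p w *\<^sub>C single (w @ [i]) 1)"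
    by (simp only: clinear_sum[OF clinear_normal_form] clinear_scale[OF clinear_normal_form])
      (rule sum.cong[OF refl], metis Hi(1,2) normal_form_monomial)
  \<comment> \<open>Appending \<open>i\<close> is injective, so a coefficient of \<open>uh\<close>
    would survive at a word that is not low, against \<open>normal_form_left_ideal\<close>.\<close>
  have "H = {}"
  proof (rule ccontr)
    assume "H \<noteq> {}"
    then obtain w where w: "w \<in> H" by blast
    have "lookup (normal_form (uh * uea_incl (b i))) (w @ [i]) = (\<Sum>w'\<in>H. if w' = w then lookup p w else 0)"
      unfolding nf lookup_sum by (rule sum.cong) (auto simp: lookup_single when_def)
    also have "\<dots> = lookup p w" using w fin by simp
    also have "\<dots> \<noteq> 0" using w by (simp add: H_def in_keys_iff)
    finally have "w @ [i] \<in> keys (normal_form (uh * uea_incl (b i)))" by (simp add: in_keys_iff)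
    then show False using normal_form_left_ideal[OF uhi] i Hi(3)[OF w] by simp
  qed
  then show ?thesis using \<open>u = ul + uh\<close> ul by (simp add: uh_def)
qed

end

section \<open>The exterior algebra and the Chevalley--Eilenberg differential\<close>

lemma clinear_comp: "clinear f \<Longrightarrow> clinear g \<Longrightarrow> clinear (\<lambda>p. f (g p))"
  by (rule clinearI) (simp_all add: clinear_add clinear_scale)

lemma clinear_sum_fun: "(\<And>i. i \<in> A \<Longrightarrow> clinear (f i)) \<Longrightarrow> clinear (\<lambda>p. \<Sum>i\<in>A. f i p)"
  by (rule clinearI) (simp_all add: clinear_add clinear_scale sum.distrib complex_vector.scale_sum_right)

lemma clinear_diff_fun: "clinear f \<Longrightarrow> clinear g \<Longrightarrow> clinear (\<lambda>p. f p - g p)"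
  by (rule clinearI) (simp_all add: clinear_add clinear_scale complex_vector.scale_right_diff_distrib)

lemma clinear_scale_fun: "clinear f \<Longrightarrow> clinear (\<lambda>p. c *\<^sub>C f p)"
  by (rule clinearI) (simp_all add: clinear_add clinear_scale scaleC_add_right scaleC_scaleC mult.commute)

lift_definition coeff_map :: "('m::zero \<Rightarrow> 'n::zero) \<Rightarrow> ('i \<Rightarrow>\<^sub>0 'm) \<Rightarrow> ('i \<Rightarrow>\<^sub>0 'n)"
  is "\<lambda>f p k. if p k = 0 then 0 else f (p k)"
  by (rule finite_subset[rotated]) auto

lemma lookup_coeff_map: "f 0 = 0 \<Longrightarrow> lookup (coeff_map f p) k = f (lookup p k)"
  by transfer simp

lemma keys_coeff_map: "keys (coeff_map f p) \<subseteq> keys p"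
  by transfer auto

text \<open>A finitely supported function on finite sets of naturals below \<open>n\<close> stands for an element of
  an exterior algebra with coefficients in \<open>'m\<close>; the set \<open>{a\<^sub>1 < \<dots> < a\<^sub>k}\<close> indexes the basis vector
  \<open>x\<^bsub>a\<^sub>k\<^esub> \<and> \<dots> \<and> x\<^bsub>a\<^sub>1\<^esub>\<close>. Only letters below \<open>n\<close> count for the sign, so that it is
  meaningful on infinite sets too.\<close>

definition wedge_sign :: "nat \<Rightarrow> nat \<Rightarrow> nat set \<Rightarrow> complex"
  where "wedge_sign n i A = (- 1) ^ card {j \<in> A. i < j \<and> j < n}"

text \<open>Exterior multiplication from the left. The sign counts the larger letters that the new
  one has to pass in the decreasing product.\<close>

lift_definition wedge :: "nat \<Rightarrow> nat \<Rightarrow> (nat set \<Rightarrow>\<^sub>0 'm) \<Rightarrow> (nat set \<Rightarrow>\<^sub>0 'm::complex_vector)"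
  is "\<lambda>n i p A. if i \<in> A then wedge_sign n i A *\<^sub>C p (A - {i}) else 0"
proof -
  fix n i and p :: "nat set \<Rightarrow> 'm" assume "finite {A. p A \<noteq> 0}"
  moreover have "{A. (if i \<in> A then wedge_sign n i A *\<^sub>C p (A - {i}) else 0) \<noteq> 0} \<subseteq> insert i ` {A. p A \<noteq> 0}"
  proof
    fix A assume "A \<in> {A. (if i \<in> A then wedge_sign n i A *\<^sub>C p (A - {i}) else 0) \<noteq> 0}"
    then have "i \<in> A" "p (A - {i}) \<noteq> 0" by (auto split: if_splits)
    then show "A \<in> insert i ` {A. p A \<noteq> 0}" by (intro image_eqI[of _ _ "A - {i}"]) auto
  qed
  ultimately show "finite {A. (if i \<in> A then wedge_sign n i A *\<^sub>C p (A - {i}) else 0) \<noteq> 0}"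
    using finite_subset by blast
qed

text \<open>Interior multiplication by the dual basis vector, with the sign that makes it the
  transpose of \<open>wedge\<close>.\<close>

lift_definition contract :: "nat \<Rightarrow> nat \<Rightarrow> (nat set \<Rightarrow>\<^sub>0 'm) \<Rightarrow> (nat set \<Rightarrow>\<^sub>0 'm::complex_vector)"
  is "\<lambda>n i p A. if i \<in> A then 0 else wedge_sign n i A *\<^sub>C p (insert i A)"
proof -
  fix n i and p :: "nat set \<Rightarrow> 'm" assume "finite {A. p A \<noteq> 0}"
  moreover have "{A. (if i \<in> A then 0 else wedge_sign n i A *\<^sub>C p (insert i A)) \<noteq> 0} \<subseteq> (\<lambda>A. A - {i}) ` {A. p A \<noteq> 0}"
  proof
    fix A assume "A \<in> {A. (if i \<in> A then 0 else wedge_sign n i A *\<^sub>C p (insert i A)) \<noteq> 0}"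
    then have "i \<notin> A" "p (insert i A) \<noteq> 0" by (auto split: if_splits)
    then show "A \<in> (\<lambda>A. A - {i}) ` {A. p A \<noteq> 0}" by (intro image_eqI[of _ _ "insert i A"]) auto
  qed
  ultimately show "finite {A. (if i \<in> A then 0 else wedge_sign n i A *\<^sub>C p (insert i A)) \<noteq> 0}"
    using finite_subset by blast
qed

text \<open>Diagonal operators. They provide both the projections to a degree and the sign
  \<open>parity\<close>.\<close>

lift_definition rescale :: "(nat set \<Rightarrow> complex) \<Rightarrow> (nat set \<Rightarrow>\<^sub>0 'm) \<Rightarrow> (nat set \<Rightarrow>\<^sub>0 'm::complex_vector)"
  is "\<lambda>s p A. s A *\<^sub>C p A"
  by (rule finite_subset[rotated]) auto

lemmas lookup_ext = wedge.rep_eq contract.rep_eq rescale.rep_eq lookup_add lookup_minus lookup_scaleC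

lemma wedge_sign_square [simp]: "wedge_sign n i A * wedge_sign n i A = 1"
  unfolding wedge_sign_def power_mult_distrib[symmetric] by simp

lemma wedge_sign_insert:
  "k \<notin> A \<Longrightarrow> wedge_sign n i (insert k A) = (if i < k \<and> k < n then - wedge_sign n i A else wedge_sign n i A)"
proof -
  assume k: "k \<notin> A"
  have fin: "finite {j \<in> A. i < j \<and> j < n}" by (rule finite_subset[of _ "{..<n}"]) auto
  have "{j \<in> insert k A. i < j \<and> j < n} = (if i < k \<and> k < n then insert k {j \<in> A. i < j \<and> j < n} else {j \<in> A. i < j \<and> j < n})"
    by auto
  then show ?thesis using k fin by (simp add: wedge_sign_def)
qed

lemma wedge_sign_remove:
  "k \<in> A \<Longrightarrow> wedge_sign n i (A - {k}) = (if i < k \<and> k < n then - wedge_sign n i A else wedge_sign n i A)"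
proof -
  assume "k \<in> A"
  then have "insert k (A - {k}) = A" by blast
  then show ?thesis using wedge_sign_insert[of k "A - {k}" n i] by (simp split: if_splits)
qed

lemma clinear_wedge: "clinear (wedge n i)" and clinear_contract: "clinear (contract n i)"
  and clinear_rescale: "clinear (rescale s)"
  by (auto intro!: clinearI poly_mapping_eqI simp: lookup_ext scaleC_add_right scaleC_scaleC mult.commute)

lemma clinear_coeff_map: "clinear f \<Longrightarrow> clinear (coeff_map f)"
  by (auto intro!: clinearI poly_mapping_eqI simp: lookup_add lookup_coeff_map clinear_zero clinear_add clinear_scale)

text \<open>The Clifford relation. Through it and \<open>wedge_wedge\<close>, the algebraic
  identities for \<open>ad_ext\<close> and \<open>diff\<close> are derived without touching
  signs.\<close>

lemma contract_wedge:
  assumes "i < n" "j < n"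
  shows "contract n j (wedge n i p) = (if i = j then p else 0) - wedge n i (contract n j p)"
proof (rule poly_mapping_eqI)
  fix A
  show "lookup (contract n j (wedge n i p)) A =
      lookup ((if i = j then p else 0) - wedge n i (contract n j p)) A"
  proof (cases "i = j")
    case True
    then show ?thesis
      by (auto simp: lookup_ext scaleC_scaleC scaleC_one wedge_sign_insert wedge_sign_remove insert_absorb)
  next
    case False
    then have "insert j A - {i} = insert j (A - {i})" by auto
    then show ?thesis using False assms
      by (auto simp: lookup_ext scaleC_scaleC wedge_sign_insert wedge_sign_remove mult.commute)
  qed
qed

lemma wedge_wedge:
  assumes "i < n" "j < n"
  shows "wedge n i (wedge n j p) = - wedge n j (wedge n i p)"
proof (rule poly_mapping_eqI)
  fix A
  have "A - {i} - {j} = A - {j} - {i}" by auto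
  then show "lookup (wedge n i (wedge n j p)) A = lookup (- wedge n j (wedge n i p)) A"
    using assms by (auto simp: lookup_ext scaleC_scaleC wedge_sign_remove mult.commute)
qed

lemma wedge_coeff_map: "clinear f \<Longrightarrow> coeff_map f (wedge n i p) = wedge n i (coeff_map f p)"
  and contract_coeff_map: "clinear f \<Longrightarrow> coeff_map f (contract n i p) = contract n i (coeff_map f p)"
  by (auto intro!: poly_mapping_eqI simp: lookup_ext lookup_coeff_map clinear_zero clinear_scale)

lemma wedge_rescale: "(\<And>A. i \<notin> A \<Longrightarrow> s (insert i A) = s' A) \<Longrightarrow> wedge n i (rescale s' p) = rescale s (wedge n i p)"
proof (rule poly_mapping_eqI)
  fix A
  assume *: "\<And>A. i \<notin> A \<Longrightarrow> s (insert i A) = s' A"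
  have "i \<in> A \<Longrightarrow> s A = s' (A - {i})" using *[of "A - {i}"] by (simp add: insert_absorb)
  then show "lookup (wedge n i (rescale s' p)) A = lookup (rescale s (wedge n i p)) A"
    by (simp add: lookup_ext scaleC_scaleC mult.commute)
qed

lemma contract_rescale: "(\<And>A. i \<notin> A \<Longrightarrow> s (insert i A) = s' A) \<Longrightarrow> contract n i (rescale s p) = rescale s' (contract n i p)"
  by (rule poly_mapping_eqI) (auto simp: lookup_ext scaleC_scaleC mult.commute)

lemma coeff_map_rescale: "clinear f \<Longrightarrow> coeff_map f (rescale s p) = rescale s (coeff_map f p)"
  by (auto intro!: poly_mapping_eqI simp: lookup_ext lookup_coeff_map clinear_zero clinear_scale)

section \<open>The exterior algebras of the flag\<close>

definition ext :: "nat \<Rightarrow> (nat set \<Rightarrow>\<^sub>0 'm::complex_vector) set"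
  where "ext i = {p. keys p \<subseteq> Pow {..<i}}"

lemma ext_iff: "p \<in> ext i \<longleftrightarrow> (\<forall>A. \<not> A \<subseteq> {..<i} \<longrightarrow> lookup p A = 0)"
  by (auto simp: ext_def in_keys_iff)

lemma subspace_ext: "csubspace (ext i)"
  by (rule complex_vector.subspaceI) (auto simp: ext_iff lookup_add)

lemmas ext_closed = complex_vector.subspace_0[OF subspace_ext] complex_vector.subspace_add[OF subspace_ext]
  complex_vector.subspace_diff[OF subspace_ext] complex_vector.subspace_scale[OF subspace_ext]
  complex_vector.subspace_sum[OF subspace_ext] complex_vector.subspace_neg[OF subspace_ext]

lemma wedge_ext:
  assumes "p \<in> ext i" "j < i"
  shows "wedge n j p \<in> ext i"
  unfolding ext_iff
proof (intro allI impI)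
  fix A assume "\<not> A \<subseteq> {..<i}"
  then have "\<not> A - {j} \<subseteq> {..<i}" using assms(2) by auto
  then show "lookup (wedge n j p) A = 0" using assms(1) by (simp add: ext_iff lookup_ext)
qed

lemma contract_ext: "p \<in> ext i \<Longrightarrow> contract n j p \<in> ext i"
  by (simp add: ext_iff lookup_ext)

lemma contract_ext_zero: "p \<in> ext i \<Longrightarrow> i \<le> j \<Longrightarrow> contract n j p = 0"
  by (rule poly_mapping_eqI) (auto simp: ext_iff lookup_ext)

lemma contract_ext_Suc:
  assumes "p \<in> ext (Suc i)"
  shows "contract n i p \<in> ext i"
  unfolding ext_iff
proof (intro allI impI)
  fix A assume "\<not> A \<subseteq> {..<i}"
  then have "i \<notin> A \<Longrightarrow> \<not> insert i A \<subseteq> {..<Suc i}" by (auto simp: less_Suc_eq)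
  then show "lookup (contract n i p) A = 0" using assms by (simp add: ext_iff lookup_ext)
qed

lemma coeff_map_ext: "clinear f \<Longrightarrow> p \<in> ext i \<Longrightarrow> coeff_map f p \<in> ext i"
  by (simp add: ext_iff lookup_coeff_map clinear_zero)

lemma rescale_ext: "p \<in> ext i \<Longrightarrow> rescale s p \<in> ext i"
  by (simp add: ext_iff lookup_ext)

lemma ext_mono: "i \<le> j \<Longrightarrow> p \<in> ext i \<Longrightarrow> p \<in> ext j"
  unfolding ext_def by (metis Pow_mono lessThan_subset_iff mem_Collect_eq order_trans)

text \<open>The Clifford relation for equal indices writes the identity as the sum of two
  projections, \<open>contract\<close> after \<open>wedge\<close> and \<open>wedge\<close> after
  \<open>contract\<close>.\<close>

lemma ext_split:
  assumes "p \<in> ext (Suc i)" "i < n"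
  obtains p0 p1 where "p0 \<in> ext i" "p1 \<in> ext i" "p = p0 + wedge n i p1"
proof -
  have "p = contract n i (wedge n i p) + wedge n i (contract n i p)"
    using contract_wedge[of i n i p] assms(2) by simp
  moreover have "contract n i (wedge n i p) \<in> ext i"
    using assms by (intro contract_ext_Suc wedge_ext) auto
  ultimately show ?thesis using contract_ext_Suc[OF assms(1)] that by blast
qed

lemma ext_split_unique:
  assumes "p0 \<in> ext i" "p1 \<in> ext i" "i < n" "p0 + wedge n i p1 = 0"
  shows "p0 = 0" "p1 = 0"
proof -
  have "contract n i (p0 + wedge n i p1) = p1"
    using assms(1-3) by (simp add: clinear_add[OF clinear_contract] contract_ext_zero contract_wedge clinear_zero[OF clinear_wedge])
  then show "p1 = 0" using assms(4) by (simp add: clinear_zero[OF clinear_contract])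
  then show "p0 = 0" using assms(4) by (simp add: clinear_zero[OF clinear_wedge])
qed

text \<open>Reduces operator identities to scalars and to wedging with a basis vector, as every
  basis element of the exterior algebra is built from the empty set in this way.\<close>

lemma ext_induct [consumes 1, case_names one add wedge]:
  fixes p :: "nat set \<Rightarrow>\<^sub>0 'm::complex_vector"
  assumes p: "p \<in> ext n"
    and one: "\<And>m. P (single {} m)"
    and add: "\<And>p q. p \<in> ext n \<Longrightarrow> q \<in> ext n \<Longrightarrow> P p \<Longrightarrow> P q \<Longrightarrow> P (p + q)"
    and wedge: "\<And>i p. i < n \<Longrightarrow> p \<in> ext n \<Longrightarrow> P p \<Longrightarrow> P (wedge n i p)"
  shows "P p"
proof -
  have single: "P (single A m) \<and> single A m \<in> ext n" if "finite A" "A \<subseteq> {..<n}" for A m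
    using that
  proof (induction A arbitrary: m rule: finite_induct)
    case empty
    show ?case using one by (auto simp: ext_iff lookup_single when_def)
  next
    case (insert i A)
    have "wedge n i (single A (wedge_sign n i (insert i A) *\<^sub>C m)) = single (insert i A) m"
      using insert.hyps
      by (intro poly_mapping_eqI) (auto simp: lookup_ext lookup_single when_def scaleC_scaleC scaleC_one insert_absorb)
    moreover have "single (insert i A) m \<in> ext n"
      using insert.prems by (auto simp: ext_iff lookup_single when_def)
    ultimately show ?case using insert wedge[of i "single A (wedge_sign n i (insert i A) *\<^sub>C m)"] by simp
  qed
  have "P (\<Sum>A\<in>K. single A (lookup p A))" if "finite K" "K \<subseteq> Pow {..<n}" for K
    using that
  proof (induction K rule: finite_induct)
    case empty
    show ?case using one[of 0] by simp
  next
    case (insert A K)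
    have "finite A" using insert.prems finite_subset[of A "{..<n}"] by blast
    moreover have "(\<Sum>A\<in>K. single A (lookup p A)) \<in> ext n"
      using single insert.prems by (intro ext_closed) (meson finite_lessThan finite_subset insert_subset PowD subsetD)
    ultimately show ?case using insert single[of A] add by simp
  qed
  moreover have "p = (\<Sum>A\<in>keys p. single A (lookup p A))"
  proof (rule poly_mapping_eqI)
    fix B
    have "lookup (\<Sum>A\<in>keys p. single A (lookup p A)) B =
        (\<Sum>A\<in>keys p. if A = B then lookup p B else 0)"
      unfolding lookup_sum by (rule sum.cong) (auto simp: lookup_single when_def)
    then show "lookup p B = lookup (\<Sum>A\<in>keys p. single A (lookup p A)) B"
      by (simp add: in_keys_iff)
  qed
  ultimately show ?thesis using p by (metis ext_def finite_keys mem_Collect_eq)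
qed

lemma contract_single_empty: "contract n j (single {} m) = 0"
  by (rule poly_mapping_eqI) (auto simp: lookup_ext lookup_single when_def)

section \<open>The adjoint action on the exterior algebra\<close>

context ideal_flag
begin

definition wedge_vec :: "'g \<Rightarrow> (nat set \<Rightarrow>\<^sub>0 'm::complex_vector) \<Rightarrow> (nat set \<Rightarrow>\<^sub>0 'm)"
  where "wedge_vec x p = (\<Sum>i<n. \<xi> i x *\<^sub>C wedge n i p)"

text \<open>The extension of \<open>bracket x\<close> to a derivation: \<open>contract\<close> takes
  out a factor \<open>b j\<close>, which is then replaced by \<open>bracket x (b j)\<close>.\<close>

definition ad_ext :: "'g \<Rightarrow> (nat set \<Rightarrow>\<^sub>0 'm::complex_vector) \<Rightarrow> (nat set \<Rightarrow>\<^sub>0 'm)"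
  where "ad_ext x p = (\<Sum>j<n. wedge_vec (bracket x (b j)) (contract n j p))"

lemma clinear_wedge_vec: "clinear (wedge_vec x)" "clinear (\<lambda>x. wedge_vec x p)"
  unfolding wedge_vec_def
  by (auto intro!: clinearI simp: clinear_add[OF clinear_coord] clinear_scale[OF clinear_coord]
    clinear_add[OF clinear_wedge] clinear_scale[OF clinear_wedge]
    scaleC_add_left scaleC_add_right sum.distrib complex_vector.scale_sum_right scaleC_scaleC mult.commute)

lemma wedge_vec_basis: "i < n \<Longrightarrow> wedge_vec (b i) p = wedge n i p"
proof -
  assume i: "i < n"
  have "wedge_vec (b i) p = (\<Sum>j<n. if j = i then wedge n i p else 0)"
    unfolding wedge_vec_def using i by (intro sum.cong) (auto simp: coord_basis scaleC_one)
  then show ?thesis using i by simp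
qed

lemma wedge_vec_anticommute: "wedge_vec x (wedge_vec y p) = - wedge_vec y (wedge_vec x p)"
proof -
  have "wedge_vec x (wedge_vec y p) = (\<Sum>i<n. \<Sum>j<n. (\<xi> i x * \<xi> j y) *\<^sub>C wedge n i (wedge n j p))" for x y
    by (simp add: wedge_vec_def clinear_sum[OF clinear_wedge] clinear_scale[OF clinear_wedge] complex_vector.scale_sum_right scaleC_scaleC)
  note e = this
  have "wedge_vec x (wedge_vec y p) = (\<Sum>i<n. \<Sum>j<n. (\<xi> i x * \<xi> j y) *\<^sub>C (- wedge n j (wedge n i p)))"
    unfolding e by (intro sum.cong refl arg_cong[where f = "scaleC _"] wedge_wedge) auto
  also have "\<dots> = - (\<Sum>i<n. \<Sum>j<n. (\<xi> j y * \<xi> i x) *\<^sub>C wedge n j (wedge n i p))"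
    by (simp add: sum_negf mult.commute)
  also have "(\<Sum>i<n. \<Sum>j<n. (\<xi> j y * \<xi> i x) *\<^sub>C wedge n j (wedge n i p)) = wedge_vec y (wedge_vec x p)"
    unfolding e by (rule sum.swap)
  finally show ?thesis .
qed

lemma contract_wedge_vec:
  assumes j: "j < n"
  shows "contract n j (wedge_vec y p) = \<xi> j y *\<^sub>C p - wedge_vec y (contract n j p)"
proof -
  have "contract n j (wedge_vec y p) = (\<Sum>i<n. \<xi> i y *\<^sub>C ((if i = j then p else 0) - wedge n i (contract n j p)))"
    using j by (simp add: wedge_vec_def clinear_sum[OF clinear_contract] clinear_scale[OF clinear_contract] contract_wedge)
  also have "\<dots> = (\<Sum>i<n. \<xi> i y *\<^sub>C (if i = j then p else 0)) - wedge_vec y (contract n j p)"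
    by (simp only: wedge_vec_def complex_vector.scale_right_diff_distrib sum_subtractf)
  also have "(\<Sum>i<n. \<xi> i y *\<^sub>C (if i = j then p else 0)) = (\<Sum>i<n. if i = j then \<xi> j y *\<^sub>C p else 0)"
    by (rule sum.cong) auto
  finally show ?thesis using j by simp
qed

lemma clinear_ad_ext: "clinear (ad_ext x)" "clinear (\<lambda>x. ad_ext x p)"
  unfolding ad_ext_def
  by (intro clinear_sum_fun clinear_comp[OF clinear_wedge_vec(1) clinear_contract],
    intro clinear_sum_fun clinear_comp[OF clinear_wedge_vec(2) bracket_clinear(2)])

lemma ad_ext_wedge_vec: "ad_ext x (wedge_vec y p) = wedge_vec (bracket x y) p + wedge_vec y (ad_ext x p)"
proof -
  have "ad_ext x (wedge_vec y p) = (\<Sum>j<n. \<xi> j y *\<^sub>C wedge_vec (bracket x (b j)) p)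
      - (\<Sum>j<n. wedge_vec (bracket x (b j)) (wedge_vec y (contract n j p)))"
    by (simp add: ad_ext_def contract_wedge_vec clinear_diff[OF clinear_wedge_vec(1)] clinear_scale[OF clinear_wedge_vec(1)] sum_subtractf)
  also have "(\<Sum>j<n. wedge_vec (bracket x (b j)) (wedge_vec y (contract n j p))) = - wedge_vec y (ad_ext x p)"
    by (simp add: ad_ext_def clinear_sum[OF clinear_wedge_vec(1)] wedge_vec_anticommute[of "bracket x _" y] sum_negf)
  also have "(\<Sum>j<n. \<xi> j y *\<^sub>C wedge_vec (bracket x (b j)) p) = wedge_vec (bracket x y) p"
  proof -
    have "clinear (\<lambda>y. wedge_vec (bracket x y) p)"
      by (rule clinearI) (simp_all add: bracket_add_right bracket_scale_right clinear_add[OF clinear_wedge_vec(2)]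
        clinear_scale[OF clinear_wedge_vec(2)])
    from clinear_expand[OF this, of y] show ?thesis by simp
  qed
  finally show ?thesis by simp
qed

lemma ad_ext_coeff_map:
  assumes f: "clinear f"
  shows "coeff_map f (ad_ext x p) = ad_ext x (coeff_map f p)"
proof -
  have "coeff_map f (wedge_vec y q) = wedge_vec y (coeff_map f q)" for y q
    by (simp add: wedge_vec_def clinear_sum[OF clinear_coeff_map[OF f]] clinear_scale[OF clinear_coeff_map[OF f]]
      wedge_coeff_map[OF f])
  then show ?thesis
    by (simp add: ad_ext_def clinear_sum[OF clinear_coeff_map[OF f]] contract_coeff_map[OF f])
qed

lemma ad_ext_one: "ad_ext x (single {} m) = 0"
  by (simp add: ad_ext_def contract_single_empty clinear_zero[OF clinear_wedge_vec(1)])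

lemma wedge_vec_ext: "p \<in> ext n \<Longrightarrow> wedge_vec x p \<in> ext n"
  unfolding wedge_vec_def by (intro ext_closed wedge_ext) auto

lemma wedge_vec_ext_flag: "p \<in> ext i \<Longrightarrow> i \<le> n \<Longrightarrow> (\<And>k. i \<le> k \<Longrightarrow> k < n \<Longrightarrow> \<xi> k x = 0) \<Longrightarrow> wedge_vec x p \<in> ext i"
  unfolding wedge_vec_def
proof (rule ext_closed(5))
  fix k assume *: "p \<in> ext i" "i \<le> n" "\<And>k. i \<le> k \<Longrightarrow> k < n \<Longrightarrow> \<xi> k x = 0" "k \<in> {..<n}"
  show "\<xi> k x *\<^sub>C wedge n k p \<in> ext i"
    by (cases "k < i") (use * in \<open>simp_all add: ext_closed wedge_ext\<close>)
qed

lemma ad_ext_ext: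
  assumes p: "p \<in> ext i" and i: "i \<le> n"
  shows "ad_ext x p \<in> ext i"
  unfolding ad_ext_def
proof (rule ext_closed(5))
  fix j assume j: "j \<in> {..<n}"
  show "wedge_vec (bracket x (b j)) (contract n j p) \<in> ext i"
  proof (cases "j < i")
    case True
    then show ?thesis using p i j flag[of j _ x] by (intro wedge_vec_ext_flag contract_ext) auto
  next
    case False
    then show ?thesis using contract_ext_zero[OF p, of j] by (simp add: clinear_zero[OF clinear_wedge_vec(1)] ext_closed)
  qed
qed

lemma ad_ext_bracket:
  assumes "p \<in> ext n"
  shows "ad_ext (bracket x y) p = ad_ext x (ad_ext y p) - ad_ext y (ad_ext x p)"
  using assms
proof (induction p rule: ext_induct)
  case (one m)
  show ?case by (simp add: ad_ext_one clinear_zero[OF clinear_ad_ext(1)])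
next
  case (add p q)
  then show ?case by (simp add: clinear_add[OF clinear_ad_ext(1)])
next
  case (wedge i p)
  show ?case unfolding wedge_vec_basis[OF wedge(1), symmetric]
    by (simp add: ad_ext_wedge_vec clinear_add[OF clinear_ad_ext(1)] jacobi_left wedge(3)
      clinear_diff[OF clinear_wedge_vec(1)] clinear_diff[OF clinear_wedge_vec(2)])
qed

lemma ad_ext_rescale:
  assumes s: "\<And>i A. i < n \<Longrightarrow> i \<notin> A \<Longrightarrow> s (insert i A) = s' A"
  shows "ad_ext x (rescale s p) = rescale s (ad_ext x p)"
proof -
  have w: "wedge_vec y (rescale s' q) = rescale s (wedge_vec y q)" for y q
    using s by (simp add: wedge_vec_def wedge_rescale[of _ s s'] clinear_sum[OF clinear_rescale] clinear_scale[OF clinear_rescale])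
  show ?thesis using s
    by (simp add: ad_ext_def contract_rescale[of _ s s'] w clinear_sum[OF clinear_rescale])
qed

end

text \<open>\<open>R\<close> is a right module, hence the reversed order in
  \<open>R_bracket\<close>. It is instantiated with right multiplication on the enveloping algebra,
  which gives the resolution, and with a character, which gives the complex that computes
  \<open>Tor\<close>.\<close>

locale koszul_complex = ideal_flag b n \<xi>
  for b :: "nat \<Rightarrow> 'g::complex_lie_algebra" and n \<xi> +
  fixes R :: "'g \<Rightarrow> 'm::complex_vector \<Rightarrow> 'm"
  assumes clinear_R: "clinear (R x)" "clinear (\<lambda>x. R x m)"
    and R_bracket: "R (bracket x y) m = R y (R x m) - R x (R y m)"
begin

definition R_ext :: "'g \<Rightarrow> (nat set \<Rightarrow>\<^sub>0 'm) \<Rightarrow> (nat set \<Rightarrow>\<^sub>0 'm)"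
  where "R_ext x = coeff_map (R x)"

text \<open>Halving compensates for summing over all ordered pairs in \<open>ad_ext (b j) (contract n j p)\<close>.\<close>

definition diff :: "(nat set \<Rightarrow>\<^sub>0 'm) \<Rightarrow> (nat set \<Rightarrow>\<^sub>0 'm)"
  where "diff p = (\<Sum>j<n. R_ext (b j) (contract n j p) - (1/2) *\<^sub>C ad_ext (b j) (contract n j p))"

text \<open>The minus sign turns the left action \<open>ad_ext\<close> into a right action, to match
  \<open>R\<close>.\<close>

definition lie_der :: "'g \<Rightarrow> (nat set \<Rightarrow>\<^sub>0 'm) \<Rightarrow> (nat set \<Rightarrow>\<^sub>0 'm)"
  where "lie_der x p = R_ext x p - ad_ext x p"

lemma clinear_R_ext: "clinear (R_ext x)" "clinear (\<lambda>x. R_ext x p)"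
  using clinear_coeff_map[OF clinear_R(1)]
  by (auto intro!: clinearI poly_mapping_eqI simp: R_ext_def lookup_add lookup_coeff_map clinear_zero[OF clinear_R(1)]
    clinear_add[OF clinear_R(1)] clinear_scale[OF clinear_R(1)] clinear_add[OF clinear_R(2)] clinear_scale[OF clinear_R(2)])

lemma R_ext_bracket: "R_ext (bracket x y) p = R_ext y (R_ext x p) - R_ext x (R_ext y p)"
  by (rule poly_mapping_eqI) (simp add: R_ext_def lookup_minus lookup_coeff_map clinear_zero[OF clinear_R(1)] R_bracket)

lemma R_ext_wedge_vec: "R_ext x (wedge_vec y p) = wedge_vec y (R_ext x p)"
  by (simp add: R_ext_def wedge_vec_def clinear_sum[OF clinear_coeff_map[OF clinear_R(1)]]
    clinear_scale[OF clinear_coeff_map[OF clinear_R(1)]] wedge_coeff_map[OF clinear_R(1)])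

lemma R_ext_ad_ext: "R_ext x (ad_ext y p) = ad_ext y (R_ext x p)"
  by (simp add: ad_ext_def clinear_sum[OF clinear_R_ext(1)] R_ext_wedge_vec)
    (simp add: R_ext_def contract_coeff_map[OF clinear_R(1)])

lemma R_ext_ext: "p \<in> ext i \<Longrightarrow> R_ext x p \<in> ext i"
  unfolding R_ext_def by (rule coeff_map_ext[OF clinear_R(1)])

lemma clinear_diff_ce: "clinear diff"
  unfolding diff_def
  by (intro clinear_sum_fun clinear_diff_fun clinear_scale_fun clinear_comp[OF clinear_R_ext(1) clinear_contract]
    clinear_comp[OF clinear_ad_ext(1) clinear_contract])

lemma clinear_lie_der: "clinear (lie_der x)" "clinear (\<lambda>x. lie_der x p)"
  unfolding lie_der_def
  by (intro clinear_diff_fun clinear_R_ext clinear_ad_ext)+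

lemma diff_one: "diff (single {} m) = 0"
  by (simp add: diff_def contract_single_empty clinear_zero[OF clinear_R_ext(1)] clinear_zero[OF clinear_ad_ext(1)])

lemma lie_der_one: "lie_der x (single {} m) = single {} (R x m)"
  by (rule poly_mapping_eqI)
    (simp add: lie_der_def ad_ext_one R_ext_def lookup_coeff_map clinear_zero[OF clinear_R(1)] lookup_single when_def)

text \<open>Cartan's formula.\<close>

lemma diff_wedge_vec: "diff (wedge_vec x p) = lie_der x p - wedge_vec x (diff p)"
proof -
  have "diff (wedge_vec x p) = (\<Sum>j<n. \<xi> j x *\<^sub>C R_ext (b j) p) - (1/2) *\<^sub>C (\<Sum>j<n. \<xi> j x *\<^sub>C ad_ext (b j) p)
     - (\<Sum>j<n. wedge_vec x (R_ext (b j) (contract n j p)))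
     + (1/2) *\<^sub>C (\<Sum>j<n. wedge_vec (bracket (b j) x) (contract n j p) + wedge_vec x (ad_ext (b j) (contract n j p)))"
    unfolding diff_def
    by (simp add: contract_wedge_vec clinear_diff[OF clinear_R_ext(1)] clinear_scale[OF clinear_R_ext(1)]
      clinear_diff[OF clinear_ad_ext(1)] clinear_scale[OF clinear_ad_ext(1)] R_ext_wedge_vec ad_ext_wedge_vec
      complex_vector.scale_right_diff_distrib sum_subtractf sum.distrib scaleC_add_right complex_vector.scale_sum_right algebra_simps)
  also have "(\<Sum>j<n. \<xi> j x *\<^sub>C R_ext (b j) p) = R_ext x p"
    using clinear_expand[OF clinear_R_ext(2)[of p], of x] by simp
  also have "(\<Sum>j<n. \<xi> j x *\<^sub>C ad_ext (b j) p) = ad_ext x p"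
    using clinear_expand[OF clinear_ad_ext(2)[of p], of x] by simp
  also have "(\<Sum>j<n. wedge_vec (bracket (b j) x) (contract n j p) + wedge_vec x (ad_ext (b j) (contract n j p)))
      = - ad_ext x p + wedge_vec x (\<Sum>j<n. ad_ext (b j) (contract n j p))"
  proof -
    have "wedge_vec (bracket (b j) x) q = - wedge_vec (bracket x (b j)) q" for j and q :: "nat set \<Rightarrow>\<^sub>0 'm"
      using clinear_diff[OF clinear_wedge_vec(2), of 0 "bracket x (b j)" q] clinear_zero[OF clinear_wedge_vec(2), of q]
      by (simp add: bracket_skew[of "b j" x])
    then show ?thesis by (simp add: sum.distrib ad_ext_def[of x] sum_negf sum_subtractf clinear_sum[OF clinear_wedge_vec(1)])
  qed
  also have "R_ext x p - (1/2) *\<^sub>C ad_ext x p - (\<Sum>j<n. wedge_vec x (R_ext (b j) (contract n j p)))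
     + (1/2) *\<^sub>C (- ad_ext x p + wedge_vec x (\<Sum>j<n. ad_ext (b j) (contract n j p)))
     = R_ext x p - ((1/2) *\<^sub>C ad_ext x p + (1/2) *\<^sub>C ad_ext x p) - wedge_vec x (diff p)"
    by (simp add: diff_def clinear_sum[OF clinear_wedge_vec(1)] clinear_diff[OF clinear_wedge_vec(1)]
      clinear_scale[OF clinear_wedge_vec(1)] sum_subtractf complex_vector.scale_sum_right scaleC_add_right
      complex_vector.scale_right_diff_distrib)
  also have "(1/2) *\<^sub>C ad_ext x p + (1/2) *\<^sub>C ad_ext x p = ad_ext x p"
    by (simp add: scaleC_one flip: scaleC_add_left)
  finally show ?thesis by (simp add: lie_der_def)
qed

lemma lie_der_wedge_vec: "lie_der x (wedge_vec y p) = wedge_vec y (lie_der x p) - wedge_vec (bracket x y) p"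
  by (simp add: lie_der_def R_ext_wedge_vec ad_ext_wedge_vec clinear_diff[OF clinear_wedge_vec(1)])

lemma lie_der_bracket: "p \<in> ext n \<Longrightarrow> lie_der (bracket x y) p = lie_der y (lie_der x p) - lie_der x (lie_der y p)"
  by (simp add: lie_der_def ad_ext_bracket R_ext_bracket clinear_diff[OF clinear_R_ext(1)] clinear_diff[OF clinear_ad_ext(1)]
    R_ext_ad_ext)

lemma diff_ext: "p \<in> ext i \<Longrightarrow> i \<le> n \<Longrightarrow> diff p \<in> ext i"
  unfolding diff_def by (intro ext_closed R_ext_ext ad_ext_ext contract_ext)

lemma lie_der_ext: "p \<in> ext i \<Longrightarrow> i \<le> n \<Longrightarrow> lie_der x p \<in> ext i"
  unfolding lie_der_def by (intro ext_closed R_ext_ext ad_ext_ext)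

text \<open>Cartan's formula expresses \<open>diff\<close> of a wedge product by \<open>diff\<close>
  and \<open>lie_der\<close> of the shorter factor, so both sides can be compared by induction; the
  Lie derivatives that remain cancel by \<open>lie_der_bracket\<close>.\<close>

lemma diff_lie_der:
  assumes "p \<in> ext n"
  shows "diff (lie_der x p) = lie_der x (diff p)"
  using assms
proof (induction p rule: ext_induct)
  case (one m)
  show ?case by (simp add: lie_der_one diff_one clinear_zero[OF clinear_lie_der(1)])
next
  case (add p q)
  then show ?case by (simp add: clinear_add[OF clinear_diff_ce] clinear_add[OF clinear_lie_der(1)])
next
  case (wedge i p)
  show ?case unfolding wedge_vec_basis[OF wedge(1), symmetric]
    by (simp add: lie_der_wedge_vec diff_wedge_vec clinear_diff[OF clinear_diff_ce] clinear_diff[OF clinear_lie_der(1)]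
      lie_der_bracket[OF wedge(2)] wedge(3))
qed

text \<open>By Cartan's formula, applying \<open>diff\<close> twice to \<open>wedge_vec x p\<close>
  leaves the commutator of \<open>diff\<close> and \<open>lie_der x\<close> at \<open>p\<close>,
  which vanishes, and \<open>wedge_vec x (diff (diff p))\<close>.\<close>

lemma diff_diff:
  assumes "p \<in> ext n"
  shows "diff (diff p) = 0"
  using assms
proof (induction p rule: ext_induct)
  case (one m)
  show ?case by (simp add: diff_one clinear_zero[OF clinear_diff_ce])
next
  case (add p q)
  then show ?case by (simp add: clinear_add[OF clinear_diff_ce])
next
  case (wedge i p)
  show ?case unfolding wedge_vec_basis[OF wedge(1), symmetric]
    by (simp add: diff_wedge_vec clinear_diff[OF clinear_diff_ce] diff_lie_der[OF wedge(2)] wedge(3)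
      clinear_zero[OF clinear_wedge_vec(1)])
qed

text \<open>For a weight that depends on the degree alone, \<open>s'\<close> and \<open>s''\<close>
  are its shifts by one and two: \<open>diff\<close> contracts once, and \<open>ad_ext\<close>
  inside it contracts a second time before wedging back.\<close>

lemma diff_rescale:
  assumes s: "\<And>i A. i < n \<Longrightarrow> i \<notin> A \<Longrightarrow> s (insert i A) = s' A"
    and s': "\<And>i A. i < n \<Longrightarrow> i \<notin> A \<Longrightarrow> s' (insert i A) = s'' A"
  shows "diff (rescale s p) = rescale s' (diff p)"
  using s
  by (simp add: diff_def contract_rescale[of _ s s'] ad_ext_rescale[of s' s'', OF s'] R_ext_def coeff_map_rescale[OF clinear_R(1)]
    clinear_sum[OF clinear_rescale] clinear_diff[OF clinear_rescale] clinear_scale[OF clinear_rescale])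

end

section \<open>Homogeneous components\<close>

context koszul_complex
begin

definition homog :: "nat \<Rightarrow> (nat set \<Rightarrow>\<^sub>0 'm) set"
  where "homog k = {p. keys p \<subseteq> {A. A \<subseteq> {..<n} \<and> card A = k}}"

text \<open>Intersecting with \<open>{..<n}\<close> makes the degree finite on every index set, so
  that inserting a new letter below \<open>n\<close> raises it by one even outside
  \<open>ext n\<close>.\<close>

definition degree_proj :: "nat \<Rightarrow> (nat set \<Rightarrow>\<^sub>0 'm) \<Rightarrow> (nat set \<Rightarrow>\<^sub>0 'm)"
  where "degree_proj k = rescale (\<lambda>A. if card (A \<inter> {..<n}) = k then 1 else 0)"

lemma homog_ext: "p \<in> homog k \<Longrightarrow> p \<in> ext n"
  by (auto simp: homog_def ext_def)

lemma degree_proj_homog: "p \<in> ext n \<Longrightarrow> degree_proj k p \<in> homog k"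
  by (auto simp: homog_def ext_def degree_proj_def in_keys_iff lookup_ext Int_absorb2 subset_iff split: if_splits)

lemma homog_iff: "p \<in> homog k \<longleftrightarrow> p \<in> ext n \<and> degree_proj k p = p"
proof
  assume p: "p \<in> homog k"
  have "lookup (degree_proj k p) A = lookup p A" for A
    using p by (cases "A \<in> keys p") (auto simp: homog_def degree_proj_def lookup_ext scaleC_one Int_absorb2 in_keys_iff)
  then show "p \<in> ext n \<and> degree_proj k p = p" using homog_ext[OF p] by (simp add: poly_mapping_eqI)
qed (metis degree_proj_homog)

lemma diff_degree_proj: "diff (degree_proj (Suc k) p) = degree_proj k (diff p)"
proof -
  have c: "card (insert i A \<inter> {..<n}) = Suc (card (A \<inter> {..<n}))" if "i < n" "i \<notin> A" for i A
  proof -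
    have "insert i A \<inter> {..<n} = insert i (A \<inter> {..<n})" using that by auto
    then show ?thesis using that by simp
  qed
  have "diff (rescale (\<lambda>A. if card (A \<inter> {..<n}) = Suc k then 1 else 0) p)
      = rescale (\<lambda>A. if card (A \<inter> {..<n}) = k then 1 else 0) (diff p)"
    by (rule diff_rescale[where s'' = "\<lambda>A. if Suc (card (A \<inter> {..<n})) = k then 1 else 0"]) (simp_all add: c)
  then show ?thesis by (simp add: degree_proj_def)
qed

lemma diff_degree_proj_zero: "diff (degree_proj 0 p) = 0"
proof -
  have "contract n j (degree_proj 0 p) = 0" if "j < n" for j
  proof (rule poly_mapping_eqI)
    fix A
    show "lookup (contract n j (degree_proj 0 p)) A = lookup 0 A"
      using that by (simp add: lookup_ext degree_proj_def)
  qed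
  then show ?thesis by (simp add: diff_def clinear_zero[OF clinear_R_ext(1)] clinear_zero[OF clinear_ad_ext(1)])
qed

lemma diff_homog: "p \<in> homog (Suc k) \<Longrightarrow> diff p \<in> homog k"
  by (metis diff_degree_proj diff_ext homog_iff order_refl)

lemma sum_degree_proj: "p \<in> ext n \<Longrightarrow> p = (\<Sum>k\<le>n. degree_proj k p)"
proof (rule poly_mapping_eqI)
  fix A
  have le: "card (A \<inter> {..<n}) \<le> n" using card_mono[of "{..<n}" "A \<inter> {..<n}"] by simp
  have "lookup (\<Sum>k\<le>n. degree_proj k p) A = (\<Sum>k\<le>n. if k = card (A \<inter> {..<n}) then lookup p A else 0)"
    unfolding lookup_sum by (rule sum.cong) (auto simp: degree_proj_def lookup_ext scaleC_one)
  then show "lookup p A = lookup (\<Sum>k\<le>n. degree_proj k p) A" using le by simp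
qed

text \<open>Projections commute with \<open>diff\<close> up to a shift of the degree, so cycles and
  boundaries decompose into homogeneous ones. This removes the degree from the computation of the
  spectrum.\<close>

lemma homology_nonzero_iff:
  "(\<exists>k. \<exists>p\<in>homog k. diff p = 0 \<and> p \<notin> diff ` homog (Suc k)) \<longleftrightarrow>
    (\<exists>p\<in>ext n. diff p = 0 \<and> p \<notin> diff ` ext n)"
proof
  assume "\<exists>k. \<exists>p\<in>homog k. diff p = 0 \<and> p \<notin> diff ` homog (Suc k)"
  then obtain k p where p: "p \<in> homog k" "diff p = 0" "p \<notin> diff ` homog (Suc k)" by blast
  have "p \<notin> diff ` ext n"
  proof
    assume "p \<in> diff ` ext n"
    then obtain h where h: "h \<in> ext n" "p = diff h" by blast
    then have "p = diff (degree_proj (Suc k) h)" using p(1) by (metis diff_degree_proj homog_iff)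
    then show False using p(3) degree_proj_homog[OF h(1)] by blast
  qed
  then show "\<exists>p\<in>ext n. diff p = 0 \<and> p \<notin> diff ` ext n" using p homog_ext by blast
next
  assume "\<exists>p\<in>ext n. diff p = 0 \<and> p \<notin> diff ` ext n"
  then obtain p where p: "p \<in> ext n" "diff p = 0" "p \<notin> diff ` ext n" by blast
  have z: "diff (degree_proj k p) = 0" for k
  proof (cases k)
    case (Suc j)
    have "degree_proj j 0 = 0" unfolding degree_proj_def by (rule clinear_zero[OF clinear_rescale])
    then show ?thesis using p(2) Suc by (simp add: diff_degree_proj)
  qed (simp add: diff_degree_proj_zero)
  show "\<exists>k. \<exists>p\<in>homog k. diff p = 0 \<and> p \<notin> diff ` homog (Suc k)"
  proof (rule ccontr)
    assume "\<not> ?thesis"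
    then have "\<forall>k. \<exists>h\<in>homog (Suc k). degree_proj k p = diff h" using z degree_proj_homog[OF p(1)] by blast
    then obtain h where h: "\<And>k. h k \<in> homog (Suc k)" "\<And>k. degree_proj k p = diff (h k)" by metis
    have "p = diff (\<Sum>k\<le>n. h k)" using sum_degree_proj[OF p(1)] by (simp add: h(2) clinear_sum[OF clinear_diff_ce])
    moreover have "(\<Sum>k\<le>n. h k) \<in> ext n" using h(1) homog_ext by (intro ext_closed) blast
    ultimately show False using p(3) by blast
  qed
qed

end

section \<open>Weights of the exterior algebra\<close>

context ideal_flag
begin

definition jh_value :: "nat \<Rightarrow> 'g \<Rightarrow> complex"
  where "jh_value i x = \<xi> i (bracket x (b i))"

text \<open>\<open>bracket x (b i)\<close> is \<open>jh_value i x\<close> times \<open>b i\<close>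
  plus a combination of earlier basis vectors, whose wedge with \<open>p\<close> stays in
  \<open>ext i\<close>.\<close>

lemma ad_ext_wedge:
  assumes i: "i < n" and p: "p \<in> ext i"
  obtains q where "q \<in> ext i" "ad_ext x (wedge n i p) = q + wedge n i (jh_value i x *\<^sub>C p + ad_ext x p)"
proof -
  let ?y = "bracket x (b i) - jh_value i x *\<^sub>C b i"
  have "\<xi> k ?y = 0" if "i \<le> k" "k < n" for k
    using that i flag[of i k x] by (auto simp: clinear_diff[OF clinear_coord] clinear_scale[OF clinear_coord] coord_basis jh_value_def)
  then have "wedge_vec ?y p \<in> ext i" using wedge_vec_ext_flag[OF p, of ?y] i by simp
  moreover have "ad_ext x (wedge n i p) = wedge_vec ?y p + wedge n i (jh_value i x *\<^sub>C p + ad_ext x p)"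
    unfolding wedge_vec_basis[OF i, symmetric]
    by (simp add: ad_ext_wedge_vec clinear_diff[OF clinear_wedge_vec(2)] clinear_scale[OF clinear_wedge_vec(2)]
        clinear_add[OF clinear_wedge_vec(1)] clinear_scale[OF clinear_wedge_vec(1)])
  ultimately show ?thesis by (rule that)
qed

text \<open>With respect to \<open>ext_split\<close> the operator \<open>c - ad_ext x\<close> is
  block triangular, and its diagonal blocks are the same operator on \<open>ext i\<close> with
  constants \<open>c\<close> and \<open>c - jh_value i x\<close>. Sums over subsets without
  \<open>i\<close> matter for the first block, sums over subsets with \<open>i\<close> for the
  second.\<close>

lemma ad_ext_regular_value:
  fixes x :: 'g
  assumes "i \<le> n" "\<And>A. A \<subseteq> {..<i} \<Longrightarrow> c \<noteq> (\<Sum>j\<in>A. jh_value j x)"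
  shows "(\<forall>q\<in>ext i. \<exists>p\<in>ext i. c *\<^sub>C p - ad_ext x p = (q :: nat set \<Rightarrow>\<^sub>0 'm::complex_vector)) \<and>
    (\<forall>p\<in>ext i. c *\<^sub>C p - ad_ext x p = (0 :: nat set \<Rightarrow>\<^sub>0 'm) \<longrightarrow> p = 0)"
  using assms
proof (induction i arbitrary: c)
  case 0
  then have c: "c \<noteq> 0" using 0(2)[of "{}"] by simp
  have "ad_ext x p = 0" if "p \<in> ext 0" for p :: "nat set \<Rightarrow>\<^sub>0 'm"
    using that by (simp add: ad_ext_def contract_ext_zero clinear_zero[OF clinear_wedge_vec(1)])
  moreover have "c *\<^sub>C (inverse c *\<^sub>C q) = q" for q :: "nat set \<Rightarrow>\<^sub>0 'm" using c by (simp add: scaleC_scaleC scaleC_one)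
  ultimately show ?case using c ext_closed(4) by (metis complex_vector.scale_eq_0_iff diff_zero)
next
  case (Suc i)
  let ?T = "\<lambda>c p. c *\<^sub>C p - ad_ext x (p :: nat set \<Rightarrow>\<^sub>0 'm)"
  let ?c' = "c - jh_value i x"
  have i: "i < n" "i \<le> n" using Suc.prems(1) by simp_all
  have A0: "c \<noteq> (\<Sum>j\<in>A. jh_value j x)" if "A \<subseteq> {..<i}" for A
    using Suc.prems(2)[of A] that by (auto simp: lessThan_Suc)
  have A1: "?c' \<noteq> (\<Sum>j\<in>A. jh_value j x)" if "A \<subseteq> {..<i}" for A
  proof -
    have "finite A" "i \<notin> A" using that finite_subset[of A "{..<i}"] by auto
    then have "(\<Sum>j\<in>insert i A. jh_value j x) = jh_value i x + (\<Sum>j\<in>A. jh_value j x)" by simp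
    moreover have "insert i A \<subseteq> {..<Suc i}" using that by (auto simp: less_Suc_eq)
    ultimately show ?thesis using Suc.prems(2)[of "insert i A"] by (auto simp: algebra_simps)
  qed
  note IH0 = Suc.IH[OF i(2) A0] and IH1 = Suc.IH[OF i(2) A1]
  \<comment> \<open>\<open>w\<close> is the value of the off-diagonal block at
    \<open>p1\<close>.\<close>
  have T: "\<exists>w. w \<in> ext i \<and> (\<forall>p0. ?T c (p0 + wedge n i p1) = (?T c p0 - w) + wedge n i (?T ?c' p1))" if p1: "p1 \<in> ext i" for p1
  proof -
    obtain w where w: "w \<in> ext i" "ad_ext x (wedge n i p1) = w + wedge n i (jh_value i x *\<^sub>C p1 + ad_ext x p1)"
      using ad_ext_wedge[OF i(1) p1] by metis
    have "?T c (p0 + wedge n i p1) = (?T c p0 - w) + wedge n i (?T ?c' p1)" for p0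
      by (simp add: w(2) clinear_add[OF clinear_ad_ext(1)] scaleC_add_right clinear_add[OF clinear_wedge]
        clinear_diff[OF clinear_wedge] clinear_scale[OF clinear_wedge] complex_vector.scale_left_diff_distrib algebra_simps)
    with w(1) show ?thesis by blast
  qed
  have Tin: "?T c p \<in> ext i" if "p \<in> ext i" for c p using that i by (intro ext_closed ad_ext_ext)
  show ?case
  proof (intro conjI ballI impI)
    fix q :: "nat set \<Rightarrow>\<^sub>0 'm" assume "q \<in> ext (Suc i)"
    then obtain q0 q1 where q: "q0 \<in> ext i" "q1 \<in> ext i" "q = q0 + wedge n i q1" by (rule ext_split[OF _ i(1)])
    obtain p1 where p1: "p1 \<in> ext i" "?T ?c' p1 = q1" using IH1 q(2) by blast
    obtain w where w: "w \<in> ext i" "\<And>p0. ?T c (p0 + wedge n i p1) = (?T c p0 - w) + wedge n i (?T ?c' p1)" using T[OF p1(1)] by blast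
    obtain p0 where p0: "p0 \<in> ext i" "?T c p0 = q0 + w" using IH0 ext_closed(2)[OF q(1) w(1)] by blast
    have "p0 + wedge n i p1 \<in> ext (Suc i)"
      by (intro ext_closed wedge_ext ext_mono[OF _ p0(1)] ext_mono[OF _ p1(1)]) auto
    moreover have "?T c (p0 + wedge n i p1) = q" by (simp only: w(2) p0(2) p1(2) q(3)) simp
    ultimately show "\<exists>p\<in>ext (Suc i). ?T c p = q" by blast
  next
    fix p :: "nat set \<Rightarrow>\<^sub>0 'm" assume "p \<in> ext (Suc i)" and 0: "?T c p = 0"
    then obtain p0 p1 where p: "p0 \<in> ext i" "p1 \<in> ext i" "p = p0 + wedge n i p1" using ext_split[OF _ i(1)] by metis
    obtain w where w: "w \<in> ext i" "\<And>p0. ?T c (p0 + wedge n i p1) = (?T c p0 - w) + wedge n i (?T ?c' p1)" using T[OF p(2)] by blast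
    have z: "(?T c p0 - w) + wedge n i (?T ?c' p1) = 0" using 0 w(2)[of p0] p(3) by simp
    note u = ext_split_unique[OF ext_closed(3)[OF Tin[OF p(1)] w(1)] Tin[OF p(2)] i(1) z]
    have "p1 = 0" using IH1 p(2) u(2) by blast
    then have "?T c (0 + wedge n i p1) = 0" by (simp add: clinear_zero[OF clinear_wedge] clinear_zero[OF clinear_ad_ext(1)])
    then have "w = 0" using w(2)[of 0] u(2) by (simp add: clinear_zero[OF clinear_wedge] clinear_zero[OF clinear_ad_ext(1)])
    then have "p0 = 0" using IH0 p(1) u(1) by auto
    then show "p = 0" using \<open>p1 = 0\<close> p(3) by (simp add: clinear_zero[OF clinear_wedge])
  qed
qed

lemma koszul_complex_character:
  "lie_character l \<Longrightarrow> koszul_complex b n \<xi> (\<lambda>x m. l x * m)"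
  by unfold_locales (auto intro!: clinearI simp: lie_character_def clinear_add clinear_scale algebra_simps)

abbreviation char_diff :: "('g \<Rightarrow> complex) \<Rightarrow> (nat set \<Rightarrow>\<^sub>0 complex) \<Rightarrow> (nat set \<Rightarrow>\<^sub>0 complex)"
  where "char_diff l \<equiv> koszul_complex.diff b n \<xi> (\<lambda>x m. l x * m)"

lemma char_lie_der:
  assumes "lie_character l"
  shows "koszul_complex.lie_der b n \<xi> (\<lambda>x m. l x * m) x p = l x *\<^sub>C p - ad_ext x p"
proof -
  interpret koszul_complex b n \<xi> "\<lambda>x m. l x * m" by (rule koszul_complex_character[OF assms])
  show ?thesis by (rule poly_mapping_eqI) (simp add: lie_der_def R_ext_def lookup_minus lookup_coeff_map)
qed

text \<open>The diagonal entry of a product of triangular operators is the product of the entries,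
  so it vanishes on commutators.\<close>

lemma jh_value_character: "i < n \<Longrightarrow> lie_character (jh_value i)"
proof -
  assume i: "i < n"
  have lin: "clinear (jh_value i)" unfolding jh_value_def
    by (rule clinear_comp[OF clinear_coord bracket_clinear(2)])
  have two: "\<xi> i (bracket x (bracket y (b i))) = jh_value i x * jh_value i y" for x y
  proof -
    have "\<xi> i (bracket x (bracket y (b i))) = (\<Sum>k<n. \<xi> k (bracket y (b i)) *\<^sub>C \<xi> i (bracket x (b k)))"
      by (rule clinear_expand[OF clinear_comp[OF clinear_coord bracket_clinear(1)]])
    \<comment> \<open>Only \<open>k = i\<close> survives: the flag kills the first factor for
      \<open>k > i\<close> and the second for \<open>k < i\<close>.\<close>
    also have "\<dots> = (\<Sum>k<n. if k = i then jh_value i x * jh_value i y else 0)"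
    proof (rule sum.cong[OF refl])
      fix k assume "k \<in> {..<n}"
      then show "\<xi> k (bracket y (b i)) *\<^sub>C \<xi> i (bracket x (b k)) = (if k = i then jh_value i x * jh_value i y else 0)"
        using flag[of i k y] flag[of k i x] i by (cases k i rule: linorder_cases) (simp_all add: jh_value_def)
    qed
    finally show ?thesis using i by simp
  qed
  have "jh_value i (bracket x y) = 0" for x y
    by (simp add: jh_value_def jacobi_left clinear_diff[OF clinear_coord] two)
  with lin show ?thesis by (simp add: lie_character_def)
qed

end

text \<open>Finitely many hyperplanes do not cover the space: on a line through a point off the old
  ones, in a direction off the new one, each excludes at most one parameter. It provides one
  \<open>x\<close> that works against all candidate weights at once.\<close>

lemma functionals_common_nonzero:
  fixes F :: "('v::complex_vector \<Rightarrow> complex) set"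
  assumes "finite F" "\<And>f. f \<in> F \<Longrightarrow> clinear f" "\<And>f. f \<in> F \<Longrightarrow> \<exists>x. f x \<noteq> 0"
  shows "\<exists>x. \<forall>f\<in>F. f x \<noteq> 0"
  using assms
proof (induction F rule: finite_induct)
  case (insert f F)
  then obtain x where x: "\<forall>g\<in>F. g x \<noteq> 0" by blast
  obtain y where y: "f y \<noteq> 0" using insert.prems by blast
  let ?bad = "(\<lambda>g. - g x / g y) ` insert f F"
  have "finite ?bad" using insert.hyps by simp
  then obtain t where t: "t \<notin> ?bad" using ex_new_if_finite[OF infinite_UNIV_char_0] by blast
  show ?case
  proof (cases "f x = 0")
    case False
    then show ?thesis using x by blast
  next
    case True
    have "g (x + t *\<^sub>C y) \<noteq> 0" if g: "g \<in> insert f F" for g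
    proof
      assume "g (x + t *\<^sub>C y) = 0"
      then have 0: "g x + t * g y = 0" using insert.prems(1)[OF g] by (simp add: clinear_add clinear_scale)
      have "g y \<noteq> 0" using 0 x y g by auto
      then have "t = - g x / g y" using 0 by (simp add: field_simps eq_neg_iff_add_eq_0 add.commute)
      then show False using t g by blast
    qed
    then show ?thesis by blast
  qed
qed simp

context ideal_flag
begin

text \<open>By Cartan's formula the invertible operators \<open>l x - ad_ext x\<close> act as zero on homology.\<close>

theorem char_homology_weight:
  assumes l: "lie_character l" and p: "p \<in> ext n" "char_diff l p = 0" "p \<notin> char_diff l ` ext n"
  shows "\<exists>A\<subseteq>{..<n}. l = (\<lambda>x. \<Sum>i\<in>A. jh_value i x)"
proof (rule ccontr)
  interpret koszul_complex b n \<xi> "\<lambda>x m. l x * m" by (rule koszul_complex_character[OF l])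
  assume no: "\<not> ?thesis"
  let ?F = "(\<lambda>A x. l x - (\<Sum>i\<in>A. jh_value i x)) ` Pow {..<n}"
  have "\<exists>x. \<forall>f\<in>?F. f x \<noteq> 0"
  proof (rule functionals_common_nonzero)
    show "finite ?F" by simp
    fix f assume "f \<in> ?F"
    then obtain A where A: "A \<subseteq> {..<n}" "f = (\<lambda>x. l x - (\<Sum>i\<in>A. jh_value i x))" by blast
    show "clinear f" unfolding A(2) using l jh_value_character A(1)
      by (intro clinear_diff_fun clinear_sum_fun) (auto simp: lie_character_def)
    have "l \<noteq> (\<lambda>x. \<Sum>i\<in>A. jh_value i x)" using no A(1) by blast
    then show "\<exists>x. f x \<noteq> 0" by (auto simp: A(2) fun_eq_iff)
  qed
  then obtain x where x: "\<And>A. A \<subseteq> {..<n} \<Longrightarrow> l x \<noteq> (\<Sum>i\<in>A. jh_value i x)" by auto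
  note reg = ad_ext_regular_value[OF order_refl x]
  have T: "lie_der x q = l x *\<^sub>C q - ad_ext x q" for q by (rule char_lie_der[OF l])
  \<comment> \<open>Since \<open>lie_der x\<close> commutes with \<open>diff\<close> and is
    injective, the preimage \<open>q\<close> of the cycle \<open>p\<close> is a cycle; Cartan's
    formula then makes \<open>p\<close> the boundary of \<open>wedge_vec x q\<close>.\<close>
  obtain q where q: "q \<in> ext n" "lie_der x q = p" using reg p(1) unfolding T by blast
  have "lie_der x (diff q) = 0" using diff_lie_der[OF q(1), of x] q(2) p(2) by simp
  moreover have "diff q \<in> ext n" using diff_ext[OF q(1)] by simp
  ultimately have "diff q = 0" using reg unfolding T by blast
  then have "diff (wedge_vec x q) = p" using diff_wedge_vec[of x q] q(2) by (simp add: clinear_zero[OF clinear_wedge_vec(1)])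
  then show False using p(3) wedge_vec_ext[OF q(1)] by blast
qed

end

section \<open>Duality\<close>

context ideal_flag
begin

text \<open>The inversions in the product of the decreasing basis monomial of \<open>A\<close> with
  that of its complement in \<open>{..<n}\<close>.\<close>

definition shuffle_sign :: "nat set \<Rightarrow> complex"
  where "shuffle_sign A = (- 1) ^ card {(a, c). a \<in> A \<and> c \<notin> A \<and> a < c \<and> c < n}"

definition parity :: "(nat set \<Rightarrow>\<^sub>0 complex) \<Rightarrow> (nat set \<Rightarrow>\<^sub>0 complex)"
  where "parity = rescale (\<lambda>A. (- 1) ^ card (A \<inter> {..<n}))"

text \<open>The coefficient of the top element in the exterior product.\<close>

definition pairing :: "(nat set \<Rightarrow>\<^sub>0 complex) \<Rightarrow> (nat set \<Rightarrow>\<^sub>0 complex) \<Rightarrow> complex"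
  where "pairing p q = (\<Sum>A\<in>Pow {..<n}. shuffle_sign A * lookup p A * lookup q ({..<n} - A))"

lemma clinear_pairing: "clinear (\<lambda>p. pairing p q)" "clinear (pairing p)"
  by (auto intro!: clinearI simp: pairing_def lookup_add distrib_left distrib_right sum.distrib sum_distrib_left algebra_simps)

text \<open>The sign form of moving the vector with index \<open>i\<close> from the front of the
  monomial of \<open>B\<close> to behind it, which costs the degree of \<open>B\<close>;
  \<open>i\<close> then joins the complementary factor.\<close>

lemma shuffle_sign_insert:
  assumes i: "i < n" "i \<notin> B" and B: "B \<subseteq> {..<n}"
  shows "shuffle_sign (insert i B) * wedge_sign n i (insert i B) =
    shuffle_sign B * (- 1) ^ card (B \<inter> {..<n}) * wedge_sign n i ({..<n} - B)"
proof -
  let ?S = "\<lambda>A. {(a, c). a \<in> A \<and> c \<notin> A \<and> a < c \<and> c < n}"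
  let ?lt = "{a \<in> B. a < i}" and ?gt = "{a \<in> B. i < a \<and> a < n}" and ?e = "{j \<in> {..<n} - B. i < j \<and> j < n}"
  have finB: "finite B" using B finite_subset by blast
  have finS: "finite (?S A)" if "A \<subseteq> {..<n}" for A
    by (rule finite_subset[of _ "{..<n} \<times> {..<n}"]) (use that in auto)
  \<comment> \<open>Compares inversions: the letters of \<open>B\<close> below \<open>i\<close> lose
    theirs with \<open>i\<close>, and \<open>i\<close> gains one with each larger letter outside
    \<open>B\<close>.\<close>
  have "?S (insert i B) \<union> ?lt \<times> {i} = ?S B \<union> {i} \<times> ?e" using i by auto
  moreover have "card (?S (insert i B) \<union> ?lt \<times> {i}) = card (?S (insert i B)) + card ?lt"
    using finB finS[of "insert i B"] i B by (subst card_Un_disjoint) (auto simp: card_cartesian_product)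
  moreover have "card (?S B \<union> {i} \<times> ?e) = card (?S B) + card ?e"
    using finS[OF B] i by (subst card_Un_disjoint) (auto simp: card_cartesian_product)
  ultimately have 1: "card (?S (insert i B)) + card ?lt = card (?S B) + card ?e" by simp
  have "B \<inter> {..<n} = ?lt \<union> ?gt" using B i by (auto, metis linorder_neqE_nat)
  moreover have "card (?lt \<union> ?gt) = card ?lt + card ?gt"
    by (rule card_Un_disjoint) (use finB in auto)
  ultimately have 2: "card (B \<inter> {..<n}) = card ?lt + card ?gt" by (simp only:)
  have "card (?S B) + card (B \<inter> {..<n}) + card ?e = card (?S (insert i B)) + card ?gt + 2 * card ?lt"
    using 1 2 by simp
  then have "(- 1 :: complex) ^ (card (?S B) + card (B \<inter> {..<n}) + card ?e) = (- 1) ^ (card (?S (insert i B)) + card ?gt)"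
    by (simp add: power_add power_mult)
  moreover have "wedge_sign n i (insert i B) = wedge_sign n i B" using i by (simp add: wedge_sign_insert)
  ultimately show ?thesis by (simp add: shuffle_sign_def wedge_sign_def power_add)
qed

lemma pairing_wedge:
  assumes i: "i < n"
  shows "pairing (wedge n i p) q = pairing (parity p) (wedge n i q)"
proof -
  let ?N = "{..<n}" and ?l = lookup
  have "pairing (wedge n i p) q = (\<Sum>A\<in>{A \<in> Pow ?N. i \<in> A}. shuffle_sign A * (wedge_sign n i A * ?l p (A - {i})) * ?l q (?N - A))"
    unfolding pairing_def by (rule sum.mono_neutral_cong_right) (auto simp: lookup_ext)
  also have "\<dots> = (\<Sum>B\<in>{B \<in> Pow ?N. i \<notin> B}. shuffle_sign B * ((- 1) ^ card (B \<inter> ?N) * ?l p B) * (wedge_sign n i (?N - B) * ?l q (?N - B - {i})))"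
  proof (rule sum.reindex_bij_witness[of _ "insert i" "\<lambda>A. A - {i}"])
    fix A assume "A \<in> {A \<in> Pow ?N. i \<in> A}"
    then have A: "A \<subseteq> ?N" "i \<in> A" by auto
    then show ins: "insert i (A - {i}) = A" and "A - {i} \<in> {B \<in> Pow ?N. i \<notin> B}" by auto
    have e: "?N - (A - {i}) - {i} = ?N - A" using A by auto
    have s: "shuffle_sign A * wedge_sign n i A =
        shuffle_sign (A - {i}) * (- 1) ^ card ((A - {i}) \<inter> ?N) * wedge_sign n i (?N - (A - {i}))"
      using shuffle_sign_insert[OF i, of "A - {i}"] A unfolding ins by blast
    show "shuffle_sign (A - {i}) * ((- 1) ^ card ((A - {i}) \<inter> ?N) * ?l p (A - {i})) * (wedge_sign n i (?N - (A - {i})) * ?l q (?N - (A - {i}) - {i}))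
        = shuffle_sign A * (wedge_sign n i A * ?l p (A - {i})) * ?l q (?N - A)"
    proof -
      have "y * (c * P) * (v * Q) = x * (w * P) * Q" if "x * w = y * c * v" for x w y c v P Q :: complex
      proof -
        have "y * (c * P) * (v * Q) = (y * c * v) * (P * Q)" by (simp only: mult_ac)
        also have "\<dots> = x * (w * P) * Q" unfolding that[symmetric] by (simp only: mult_ac)
        finally show ?thesis .
      qed
      from this[OF s] show ?thesis unfolding e .
    qed
  qed (use i in auto)
  also have "\<dots> = pairing (parity p) (wedge n i q)"
    unfolding pairing_def by (rule sum.mono_neutral_cong_left) (use i in \<open>auto simp: lookup_ext parity_def\<close>)
  finally show ?thesis .
qed

lemma pairing_wedge_vec: "pairing (wedge_vec x p) q = pairing (parity p) (wedge_vec x q)"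
  by (simp add: wedge_vec_def clinear_sum[OF clinear_pairing(1)] clinear_sum[OF clinear_pairing(2)]
    clinear_scale[OF clinear_pairing(1)] clinear_scale[OF clinear_pairing(2)] pairing_wedge)

lemma parity_parity [simp]: "parity (parity p) = p"
  by (rule poly_mapping_eqI) (simp add: parity_def lookup_ext flip: power_mult_distrib mult.assoc)

lemma parity_insert: "i < n \<Longrightarrow> i \<notin> A \<Longrightarrow> (- 1 :: complex) ^ card (insert i A \<inter> {..<n}) = - ((- 1) ^ card (A \<inter> {..<n}))"
  by (simp add: Int_insert_left)

lemma rescale_uminus: "rescale (\<lambda>A. - s A) p = - rescale s p"
  by (rule poly_mapping_eqI) (simp add: lookup_ext)

lemma parity_ad_ext: "parity (ad_ext x p) = ad_ext x (parity p)"
  unfolding parity_def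
  by (rule ad_ext_rescale[symmetric, where s' = "\<lambda>A. - ((- 1) ^ card (A \<inter> {..<n}))"]) (rule parity_insert)

lemma clinear_parity: "clinear parity"
  unfolding parity_def by (rule clinear_rescale)

lemma parity_char_diff:
  assumes "lie_character l"
  shows "char_diff l (parity p) = - parity (char_diff l p)"
proof -
  interpret koszul_complex b n \<xi> "\<lambda>x m. l x * m" by (rule koszul_complex_character[OF assms])
  show ?thesis
    unfolding parity_def rescale_uminus[symmetric]
    by (rule diff_rescale[where s'' = "\<lambda>A. (- 1) ^ card (A \<inter> {..<n})"]) (simp_all add: parity_insert)
qed

lemma parity_wedge_vec: "parity (wedge_vec x p) = - wedge_vec x (parity p)"
proof -
  have "parity (wedge n i p) = - wedge n i (parity p)" if "i < n" for i
  proof -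
    have "wedge n i (rescale (\<lambda>A. - ((- 1) ^ card (A \<inter> {..<n}))) p) = parity (wedge n i p)"
      unfolding parity_def by (rule wedge_rescale) (rule parity_insert[OF that])
    then show ?thesis by (simp add: rescale_uminus parity_def clinear_diff[OF clinear_wedge, of n i 0, simplified] clinear_zero[OF clinear_wedge])
  qed
  then show ?thesis by (simp add: wedge_vec_def clinear_sum[OF clinear_parity] clinear_scale[OF clinear_parity] sum_negf)
qed

definition ad_trace :: "'g \<Rightarrow> complex"
  where "ad_trace x = (\<Sum>i<n. jh_value i x)"

text \<open>The index set \<open>{..<n}\<close> stands for the top exterior power, on which a
  derivation acts by its trace. This is the source of \<open>two_rho\<close>.\<close>

lemma lookup_ad_ext_top: "lookup (ad_ext x p) {..<n} = ad_trace x * lookup p {..<n}"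
proof -
  have w: "lookup (wedge n k (contract n j p)) {..<n} = (if k = j then lookup p {..<n} else 0)"
    if "j < n" "k < n" for j k
    using that by (auto simp: lookup_ext wedge_sign_remove insert_absorb simp flip: mult.assoc)
  have "lookup (ad_ext x p) {..<n} = (\<Sum>j<n. \<Sum>k<n. \<xi> k (bracket x (b j)) * lookup (wedge n k (contract n j p)) {..<n})"
    by (simp add: ad_ext_def wedge_vec_def lookup_sum)
  also have "\<dots> = (\<Sum>j<n. \<Sum>k<n. if k = j then jh_value j x * lookup p {..<n} else 0)"
    by (intro sum.cong refl) (simp add: w jh_value_def)
  finally show ?thesis by (simp add: ad_trace_def sum_distrib_right)
qed

lemma pairing_one_left: "pairing (single {} m) q = m * lookup q {..<n}"
proof -
  have "pairing (single {} m) q = (\<Sum>A\<in>Pow {..<n}. if A = {} then m * lookup q {..<n} else 0)"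
    unfolding pairing_def by (rule sum.cong) (auto simp: lookup_single when_def shuffle_sign_def)
  then show ?thesis by simp
qed

lemma pairing_one_right: "pairing p (single {} m) = shuffle_sign {..<n} * lookup p {..<n} * m"
proof -
  have "pairing p (single {} m) = (\<Sum>A\<in>Pow {..<n}. if A = {..<n} then shuffle_sign {..<n} * lookup p {..<n} * m else 0)"
    unfolding pairing_def by (rule sum.cong) (auto simp: lookup_single when_def)
  then show ?thesis by simp
qed

text \<open>\<open>ad_ext x\<close> is a derivation for the exterior product, and the pairing is the
  top component of this product.\<close>

lemma pairing_ad_ext:
  assumes "p \<in> ext n"
  shows "pairing (ad_ext x p) q + pairing p (ad_ext x q) = ad_trace x * pairing p q"
proof -
  let ?P = "\<lambda>p. \<forall>q. pairing (ad_ext x p) q + pairing p (ad_ext x q) = ad_trace x * pairing p q"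
  \<comment> \<open>The induction carries \<open>parity p\<close> along, since
    \<open>pairing_wedge_vec\<close> changes the left argument by \<open>parity\<close>.\<close>
  have "?P p \<and> ?P (parity p)" using assms
  proof (induction p rule: ext_induct)
    case (one m)
    have "parity (single {} m) = single {} m"
      by (rule poly_mapping_eqI) (simp add: parity_def lookup_ext lookup_single when_def)
    then show ?case by (simp add: ad_ext_one pairing_one_left lookup_ad_ext_top clinear_zero[OF clinear_pairing(1)])
  next
    case (add p q)
    then show ?case
      by (simp add: clinear_add[OF clinear_parity] clinear_add[OF clinear_ad_ext(1)] clinear_add[OF clinear_pairing(1)] algebra_simps)
  next
    case (wedge i p)
    have step: "?P (wedge_vec y r)" if r: "?P (parity r)" for y r
    proof
      fix q
      have "pairing (ad_ext x (wedge_vec y r)) q + pairing (wedge_vec y r) (ad_ext x q)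
          = pairing (parity r) (wedge_vec (bracket x y) q) + pairing (ad_ext x (parity r)) (wedge_vec y q)
            + pairing (parity r) (wedge_vec y (ad_ext x q))"
        by (simp add: ad_ext_wedge_vec clinear_add[OF clinear_pairing(1)] pairing_wedge_vec parity_ad_ext)
      also have "\<dots> = pairing (ad_ext x (parity r)) (wedge_vec y q) + pairing (parity r) (ad_ext x (wedge_vec y q))"
        by (simp add: ad_ext_wedge_vec clinear_add[OF clinear_pairing(2)])
      also have "\<dots> = ad_trace x * pairing (wedge_vec y r) q" using r by (simp add: pairing_wedge_vec)
      finally show "pairing (ad_ext x (wedge_vec y r)) q + pairing (wedge_vec y r) (ad_ext x q) = ad_trace x * pairing (wedge_vec y r) q" .
    qed
    have neg: "?P (- r)" if "?P r" for r
    proof -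
      have u: "ad_ext x (- r) = - ad_ext x r" "pairing (- r) q = - pairing r q" for r q
        using clinear_diff[OF clinear_ad_ext(1), of x 0 r] clinear_diff[OF clinear_pairing(1), of 0 r q]
        by (simp_all add: clinear_zero[OF clinear_ad_ext(1)] clinear_zero[OF clinear_pairing(1)])
      have "- (pairing (ad_ext x r) q + pairing r (ad_ext x q)) = - (ad_trace x * pairing r q)" for q using that by simp
      then show ?thesis by (simp add: u)
    qed
    have "?P (wedge_vec (b i) p)" using step[of p "b i"] wedge(3) by blast
    moreover have "?P (wedge_vec (b i) (parity p))" using step[of "parity p" "b i"] wedge(3) by simp
    then have "?P (parity (wedge_vec (b i) p))" unfolding parity_wedge_vec by (rule neg)
    ultimately show ?case unfolding wedge_vec_basis[OF wedge(1)] by blast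
  qed
  then show ?thesis by blast
qed

lemma parity_ext: "p \<in> ext n \<Longrightarrow> parity p \<in> ext n"
  unfolding parity_def by (rule rescale_ext)

lemma ad_trace_diff_character: "lie_character l \<Longrightarrow> lie_character (ad_trace - l)"
proof -
  assume l: "lie_character l"
  have "clinear (\<lambda>x. (\<Sum>i<n. jh_value i x) - l x)"
    using l jh_value_character by (intro clinear_diff_fun clinear_sum_fun) (auto simp: lie_character_def)
  moreover have "(\<Sum>i<n. jh_value i (bracket x y)) = 0" for x y
    using jh_value_character by (simp add: lie_character_def)
  moreover have "ad_trace - l = (\<lambda>x. (\<Sum>i<n. jh_value i x) - l x)" by (simp add: fun_eq_iff ad_trace_def)
  ultimately show ?thesis using l by (simp add: lie_character_def)
qed

text \<open>A vector is moved across the pairing and Cartan's formula is used on both sides. The Lie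
  derivatives contribute the scalars \<open>l\<close> and \<open>m\<close>, and moving
  \<open>ad_ext\<close> across the pairing costs the trace; these cancel because
  \<open>l + m\<close> is the trace.\<close>

lemma pairing_char_diff:
  assumes l: "lie_character l" and m: "lie_character m" "\<And>x. l x + m x = ad_trace x" and p: "p \<in> ext n" and q: "q \<in> ext n"
  shows "pairing (char_diff l p) q = pairing (parity p) (char_diff m q)"
  using q p
proof (induction q arbitrary: p rule: ext_induct)
  case (one c)
  interpret L: koszul_complex b n \<xi> "\<lambda>x m. l x * m" by (rule koszul_complex_character[OF l])
  interpret M: koszul_complex b n \<xi> "\<lambda>x a. m x * a" by (rule koszul_complex_character[OF m(1)])
  \<comment> \<open>A boundary has no component in the top degree, since no contraction has one and
    \<open>ad_ext\<close> acts there by a scalar.\<close>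
  have "lookup (contract n j r) {..<n} = 0" if "j < n" for j and r :: "nat set \<Rightarrow>\<^sub>0 complex"
    using that by (simp add: lookup_ext)
  then have "lookup (char_diff l p) {..<n} = 0"
    by (simp add: L.diff_def lookup_sum lookup_minus lookup_ad_ext_top L.R_ext_def lookup_coeff_map)
  then show ?case by (simp add: pairing_one_right M.diff_one clinear_zero[OF clinear_pairing(2)] )
next
  case (add q r)
  interpret M: koszul_complex b n \<xi> "\<lambda>x a. m x * a" by (rule koszul_complex_character[OF m(1)])
  show ?case using add by (simp add: clinear_add[OF clinear_pairing(2)] clinear_add[OF M.clinear_diff_ce])
next
  case (wedge i q)
  interpret L: koszul_complex b n \<xi> "\<lambda>x m. l x * m" by (rule koszul_complex_character[OF l])
  interpret M: koszul_complex b n \<xi> "\<lambda>x a. m x * a" by (rule koszul_complex_character[OF m(1)])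
  let ?y = "b i"
  note lin = clinear_add[OF clinear_pairing(1)] clinear_diff[OF clinear_pairing(1)] clinear_scale[OF clinear_pairing(1)]
    clinear_add[OF clinear_pairing(2)] clinear_diff[OF clinear_pairing(2)] clinear_scale[OF clinear_pairing(2)]
  have neg: "pairing (- r) q = - pairing r q" for r q
    using clinear_diff[OF clinear_pairing(1), of 0 r q] by (simp add: clinear_zero[OF clinear_pairing(1)])
  have pp: "parity p \<in> ext n" using wedge(4) by (rule parity_ext)
  have "pairing (L.diff p) (wedge_vec ?y q) = pairing (wedge_vec ?y (parity (L.diff p))) q"
    by (simp add: pairing_wedge_vec)
  also have "parity (L.diff p) = - L.diff (parity p)" by (simp add: parity_char_diff[OF l])
  also have "wedge_vec ?y (- L.diff (parity p)) = L.diff (wedge_vec ?y (parity p)) - L.lie_der ?y (parity p)"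
    using clinear_diff[OF clinear_wedge_vec(1), of ?y 0 "L.diff (parity p)"]
    by (simp add: L.diff_wedge_vec clinear_zero[OF clinear_wedge_vec(1)])
  also have "pairing (L.diff (wedge_vec ?y (parity p)) - L.lie_der ?y (parity p)) q
      = pairing (parity (wedge_vec ?y (parity p))) (M.diff q) - (l ?y * pairing (parity p) q - pairing (ad_ext ?y (parity p)) q)"
    using wedge(3)[OF wedge_vec_ext[OF pp]] by (simp add: lin char_lie_der[OF l])
  also have "pairing (parity (wedge_vec ?y (parity p))) (M.diff q) = - pairing (parity p) (wedge_vec ?y (M.diff q))"
    by (simp add: parity_wedge_vec neg pairing_wedge_vec)
  also have "pairing (ad_ext ?y (parity p)) q = ad_trace ?y * pairing (parity p) q - pairing (parity p) (ad_ext ?y q)"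
    using pairing_ad_ext[OF pp, of ?y q] by (simp add: algebra_simps)
  also have "- pairing (parity p) (wedge_vec ?y (M.diff q)) - (l ?y * pairing (parity p) q
        - (ad_trace ?y * pairing (parity p) q - pairing (parity p) (ad_ext ?y q)))
      = pairing (parity p) (M.diff (wedge_vec ?y q))"
    by (simp add: M.diff_wedge_vec lin char_lie_der[OF m(1)] m(2)[symmetric] distrib_right)
  finally show ?case by (simp only: wedge_vec_basis[OF wedge(1)])
qed

lemma shuffle_sign_square [simp]: "shuffle_sign A * shuffle_sign A = 1"
  unfolding shuffle_sign_def power_mult_distrib[symmetric] by simp

lemma pairing_represents:
  assumes f: "clinear f"
  shows "\<exists>g\<in>ext n. \<forall>p\<in>ext n. pairing p g = f p"
proof -
  \<comment> \<open>Monomials of complementary index sets are dual under the pairing up to the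
    shuffle sign, which is its own inverse.\<close>
  define g where "g = (\<Sum>A\<in>Pow {..<n}. single ({..<n} - A) (shuffle_sign A * f (single A 1)))"
  have lg: "lookup g ({..<n} - A) = shuffle_sign A * f (single A 1)" if "A \<subseteq> {..<n}" for A
  proof -
    have "{..<n} - A = {..<n} - B \<longleftrightarrow> A = B" if "B \<subseteq> {..<n}" for B using that \<open>A \<subseteq> {..<n}\<close> by blast
    then have "lookup g ({..<n} - A) = (\<Sum>B\<in>Pow {..<n}. if A = B then shuffle_sign A * f (single A 1) else 0)"
      unfolding g_def lookup_sum by (intro sum.cong) (auto simp: lookup_single when_def)
    then show ?thesis using that by simp
  qed
  have "pairing p g = f p" if p: "p \<in> ext n" for p
  proof -
    have "p = (\<Sum>A\<in>Pow {..<n}. lookup p A *\<^sub>C single A 1)"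
    proof (rule poly_mapping_eqI)
      fix B
      have "lookup (\<Sum>A\<in>Pow {..<n}. lookup p A *\<^sub>C single A 1) B
          = (\<Sum>A\<in>Pow {..<n}. if A = B then lookup p B else 0)"
        unfolding lookup_sum by (rule sum.cong) (auto simp: lookup_single when_def)
      then show "lookup p B = lookup (\<Sum>A\<in>Pow {..<n}. lookup p A *\<^sub>C single A 1) B"
        using p by (auto simp: ext_iff)
    qed
    then have "f p = (\<Sum>A\<in>Pow {..<n}. lookup p A * f (single A 1))"
      by (metis (no_types, lifting) clinear_sum[OF f] clinear_scale[OF f] scaleC_complex_def sum.cong)
    also have "\<dots> = pairing p g"
      unfolding pairing_def
    proof (rule sum.cong[OF refl])
      fix A assume "A \<in> Pow {..<n}"
      then show "lookup p A * f (single A 1) =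
          shuffle_sign A * lookup p A * lookup g ({..<n} - A)"
        using shuffle_sign_square[of A] by (simp add: lg)
    qed
    finally show ?thesis by simp
  qed
  moreover have "g \<in> ext n" unfolding g_def by (intro ext_closed) (auto simp: ext_iff lookup_single when_def)
  ultimately show ?thesis by blast
qed

lemma pairing_nondegenerate:
  assumes q: "q \<in> ext n" and 0: "\<And>p. p \<in> ext n \<Longrightarrow> pairing p q = 0"
  shows "q = 0"
proof (rule poly_mapping_eqI)
  fix B
  show "lookup q B = lookup 0 B"
  proof (cases "B \<subseteq> {..<n}")
    case True
    let ?A = "{..<n} - B"
    have "pairing (single ?A 1) q = (\<Sum>C\<in>Pow {..<n}. if C = ?A then shuffle_sign ?A * lookup q B else 0)"
      unfolding pairing_def using True by (intro sum.cong) (auto simp: lookup_single when_def double_diff)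
    also have "\<dots> = shuffle_sign ?A * lookup q B" by simp
    finally have "shuffle_sign ?A * lookup q B = 0"
      using 0[of "single ?A 1"] by (auto simp: ext_iff lookup_single when_def)
    moreover have "shuffle_sign ?A \<noteq> 0" by (simp add: shuffle_sign_def)
    ultimately show ?thesis by simp
  qed (use q in \<open>simp add: ext_iff\<close>)
qed

end

lemma functional_separating:
  fixes S :: "'v::complex_vector set"
  assumes S: "csubspace S" and v: "v \<notin> S"
  shows "\<exists>f :: 'v \<Rightarrow> complex. clinear f \<and> f v = 1 \<and> (\<forall>s\<in>S. f s = 0)"
proof -
  obtain B where B: "B \<subseteq> S" "complex_vector.independent B" "S \<subseteq> cspan B"
    using complex_vector.maximal_independent_subset by blast
  have "v \<notin> cspan B" using v complex_vector.span_minimal[OF B(1) S] by blast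
  then have ind: "complex_vector.independent (insert v B)" using B(2) by (rule complex_vector.independent_insertI)
  interpret vector_space_pair "scaleC :: complex \<Rightarrow> 'v \<Rightarrow> 'v" "scaleC :: complex \<Rightarrow> complex \<Rightarrow> complex" ..
  obtain f :: "'v \<Rightarrow> complex" where f: "clinear f" "\<forall>x\<in>insert v B. f x = (if x = v then 1 else 0)"
    using linear_independent_extend[OF ind, of "\<lambda>x. if x = v then 1 else 0"] by blast
  have "v \<notin> B" using v B(1) by blast
  have "f s = 0" if "s \<in> S" for s
  proof -
    have "s \<in> cspan B" using that B(3) by blast
    then show ?thesis
    proof (induction rule: complex_vector.span_induct_alt)
      case base
      show ?case by (rule clinear_zero[OF f(1)])
    next
      case (step c x y)
      then show ?case using f \<open>v \<notin> B\<close> by (auto simp: clinear_add clinear_scale)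
    qed
  qed
  then show ?thesis using f by auto
qed

context ideal_flag
begin

text \<open>A functional that separates the cycle \<open>p\<close> from the boundaries is
  represented by some \<open>g\<close>. Adjointness turns its vanishing on boundaries into
  \<open>g\<close> being a cycle; if \<open>g\<close> were a boundary, its pairing with
  \<open>p\<close> would vanish.\<close>

theorem char_homology_duality:
  assumes l: "lie_character l" and m: "lie_character m" "\<And>x. l x + m x = ad_trace x" and p: "p \<in> ext n" "char_diff l p = 0" "p \<notin> char_diff l ` ext n"
  shows "\<exists>q\<in>ext n. char_diff m q = 0 \<and> q \<notin> char_diff m ` ext n"
proof -
  interpret L: koszul_complex b n \<xi> "\<lambda>x m. l x * m" by (rule koszul_complex_character[OF l])
  interpret M: koszul_complex b n \<xi> "\<lambda>x a. m x * a" by (rule koszul_complex_character[OF m(1)])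
  have "csubspace (L.diff ` ext n)"
  proof (rule complex_vector.subspaceI)
    show "0 \<in> L.diff ` ext n"
      by (intro image_eqI[of _ _ 0]) (simp_all add: clinear_zero[OF L.clinear_diff_ce] ext_closed)
    show "x + y \<in> L.diff ` ext n" if "x \<in> L.diff ` ext n" "y \<in> L.diff ` ext n" for x y
    proof -
      from that obtain p q where "p \<in> ext n" "q \<in> ext n" "x = L.diff p" "y = L.diff q" by blast
      then show ?thesis by (intro image_eqI[of _ _ "p + q"]) (simp_all add: clinear_add[OF L.clinear_diff_ce] ext_closed)
    qed
    show "c *\<^sub>C x \<in> L.diff ` ext n" if "x \<in> L.diff ` ext n" for c x
    proof -
      from that obtain p where "p \<in> ext n" "x = L.diff p" by blast
      then show ?thesis by (intro image_eqI[of _ _ "c *\<^sub>C p"]) (simp_all add: clinear_scale[OF L.clinear_diff_ce] ext_closed)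
    qed
  qed
  from functional_separating[OF this p(3)] obtain f :: "_ \<Rightarrow> complex"
    where f: "clinear f" "f p = 1" "\<And>r. r \<in> ext n \<Longrightarrow> f (L.diff r) = 0" by blast
  obtain g where g: "g \<in> ext n" "\<And>r. r \<in> ext n \<Longrightarrow> pairing r g = f r" using pairing_represents[OF f(1)] by blast
  have "M.diff g = 0"
  proof (rule pairing_nondegenerate)
    show "M.diff g \<in> ext n" using M.diff_ext[OF g(1)] by simp
    fix r :: "nat set \<Rightarrow>\<^sub>0 complex" assume r: "r \<in> ext n"
    have "pairing r (M.diff g) = pairing (L.diff (parity r)) g"
      using pairing_char_diff[OF l m parity_ext[OF r] g(1)] by simp
    also have "\<dots> = 0" using g(2)[OF L.diff_ext[OF parity_ext[OF r]]] f(3)[OF parity_ext[OF r]] by simp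
    finally show "pairing r (M.diff g) = 0" .
  qed
  moreover have "g \<notin> M.diff ` ext n"
  proof
    assume "g \<in> M.diff ` ext n"
    then obtain h where h: "h \<in> ext n" "g = M.diff h" by blast
    have "pairing p g = pairing (L.diff (parity p)) h"
      using pairing_char_diff[OF l m parity_ext[OF p(1)] h(1)] by (simp add: h(2))
    also have "L.diff (parity p) = 0" using p(2) parity_char_diff[OF l, of p] by (simp add: clinear_zero[OF clinear_parity])
    finally have "pairing p g = 0" by (simp add: clinear_zero[OF clinear_pairing(1)])
    then show False using g(2)[OF p(1)] f(2) by simp
  qed
  ultimately show ?thesis using g(1) by blast
qed

end

section \<open>The Koszul resolution of the trivial module\<close>

context ideal_flag
begin

lemma koszul_complex_uea: "koszul_complex b n \<xi> (\<lambda>x u. u * uea_incl x)"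
proof (intro koszul_complex.intro koszul_complex_axioms.intro ideal_flag_axioms)
  show "clinear (\<lambda>u. u * uea_incl x)" for x :: 'g
    by (rule clinearI) (simp_all add: distrib_right uea_mult_scaleC_left)
  show "clinear (\<lambda>x. u * uea_incl x)" for u :: "'g uea"
    by (rule clinearI)
      (simp_all add: clinear_add[OF uea_incl_clinear] clinear_scale[OF uea_incl_clinear] distrib_left uea_mult_scaleC_right)
  show "u * uea_incl (bracket x y) = u * uea_incl x * uea_incl y - u * uea_incl y * uea_incl x" for x y :: 'g and u
    by (simp add: uea_incl_bracket right_diff_distrib mult.assoc)
qed

abbreviation uea_diff :: "(nat set \<Rightarrow>\<^sub>0 'g uea) \<Rightarrow> (nat set \<Rightarrow>\<^sub>0 'g uea)"
  where "uea_diff \<equiv> koszul_complex.diff b n \<xi> (\<lambda>x u. u * uea_incl x)"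

lemma lookup_ad_ext_empty: "lookup (ad_ext x p) {} = 0"
  by (simp add: ad_ext_def wedge_vec_def lookup_sum lookup_ext)

text \<open>Together with \<open>left_ideal_boundary\<close>: in degree zero the boundaries of the
  subcomplex on the first \<open>i\<close> letters are \<open>left_ideal i\<close>, so its homology
  there is the quotient to which \<open>left_ideal_regular\<close> applies.\<close>

lemma lookup_uea_diff_empty:
  assumes p: "p \<in> ext i" and i: "i \<le> n"
  shows "lookup (uea_diff p) {} = (\<Sum>j<i. lookup p {j} * uea_incl (b j))"
proof -
  interpret koszul_complex b n \<xi> "\<lambda>x u. u * uea_incl x" by (rule koszul_complex_uea)
  have "lookup (uea_diff p) {} = (\<Sum>j<n. lookup p {j} * uea_incl (b j))"
    by (simp add: diff_def lookup_sum lookup_minus lookup_ad_ext_empty R_ext_def lookup_coeff_map lookup_ext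
      wedge_sign_def scaleC_one)
  also have "\<dots> = (\<Sum>j<i. lookup p {j} * uea_incl (b j))"
    using p i by (intro sum.mono_neutral_right) (auto simp: ext_iff)
  finally show ?thesis .
qed

lemma uea_diff_single:
  assumes "j < n"
  shows "uea_diff (wedge n j (single {} u)) = single {} (u * uea_incl (b j))"
proof -
  interpret koszul_complex b n \<xi> "\<lambda>x u. u * uea_incl x" by (rule koszul_complex_uea)
  show ?thesis
    by (simp add: diff_wedge_vec lie_der_one diff_one clinear_zero[OF clinear_wedge_vec(1)] flip: wedge_vec_basis[OF assms])
qed

lemma single_empty_ext: "single {} m \<in> ext i"
  by (simp add: ext_iff lookup_single when_def)

lemma left_ideal_boundary:
  assumes u: "u \<in> left_ideal i" and i: "i \<le> n"
  shows "\<exists>h\<in>ext i. uea_diff h = single {} u"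
proof -
  interpret koszul_complex b n \<xi> "\<lambda>x u. u * uea_incl x" by (rule koszul_complex_uea)
  obtain f where f: "u = (\<Sum>j<i. f j * uea_incl (b j))" using u by (auto simp: left_ideal_def)
  let ?h = "\<Sum>j<i. wedge n j (single {} (f j))"
  have "?h \<in> ext i" by (intro ext_closed wedge_ext single_empty_ext) auto
  moreover have "diff ?h = (\<Sum>j<i. single {} (f j * uea_incl (b j)))"
    using i by (simp add: clinear_sum[OF clinear_diff_ce] uea_diff_single)
  then have "diff ?h = single {} u"
    by (intro poly_mapping_eqI) (simp add: f lookup_sum lookup_single when_def)
  ultimately show ?thesis by blast
qed

text \<open>The complex on the first \<open>Suc i\<close> basis vectors is the mapping cone of an endomorphism of the
  complex on the first \<open>i\<close>, which induces right multiplication by \<open>b i\<close> in degree zero homology.\<close>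

theorem uea_diff_exact:
  assumes "i \<le> n" "p \<in> ext i" "uea_diff p = 0" "lookup p {} = 0"
  shows "\<exists>h\<in>ext i. uea_diff h = p"
  using assms
proof (induction i arbitrary: p)
  case 0
  have "p = 0"
  proof (rule poly_mapping_eqI)
    fix A show "lookup p A = lookup 0 A"
      using 0 by (cases "A = {}") (auto simp: ext_iff)
  qed
  moreover interpret koszul_complex b n \<xi> "\<lambda>x u. u * uea_incl x" by (rule koszul_complex_uea)
  have "diff 0 = 0" by (rule clinear_zero[OF clinear_diff_ce])
  ultimately show ?case using ext_closed(1) by blast
next
  case (Suc i)
  interpret koszul_complex b n \<xi> "\<lambda>x u. u * uea_incl x" by (rule koszul_complex_uea)
  have i: "i < n" "i \<le> n" using Suc.prems(1) by simp_all
  obtain p0 p1 where p: "p0 \<in> ext i" "p1 \<in> ext i" "p = p0 + wedge n i p1" using ext_split[OF Suc.prems(2) i(1)] by blast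
  have dw: "diff (wedge n i q) = lie_der (b i) q - wedge n i (diff q)" for q
    unfolding wedge_vec_basis[OF i(1), symmetric] by (rule diff_wedge_vec)
  have wn: "wedge n i (- q) = - wedge n i q" for q :: "nat set \<Rightarrow>\<^sub>0 'g uea"
    using clinear_diff[OF clinear_wedge, of n i 0 q] by (simp add: clinear_zero[OF clinear_wedge])
  have "diff p0 + lie_der (b i) p1 + wedge n i (- diff p1) = 0"
    using Suc.prems(3) by (simp add: p(3) clinear_add[OF clinear_diff_ce] dw wn algebra_simps)
  moreover have "diff p0 + lie_der (b i) p1 \<in> ext i" "- diff p1 \<in> ext i"
    using p i by (intro ext_closed diff_ext lie_der_ext; simp)+
  ultimately have d0: "diff p0 + lie_der (b i) p1 = 0" and "- diff p1 = 0"
    using ext_split_unique[OF _ _ i(1)] by metis+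
  then have d1: "diff p1 = 0" by simp
  \<comment> \<open>In degree zero, \<open>d0\<close> says that \<open>u * uea_incl (b i)\<close> is
    a boundary on the first \<open>i\<close> letters; regularity cancels the factor.\<close>
  define u where "u = lookup p1 {}"
  have "lookup (diff p0) {} + u * uea_incl (b i) = 0"
    using arg_cong[OF d0, of "\<lambda>q. lookup q {}"]
    by (simp add: lookup_add lie_der_def lookup_minus lookup_ad_ext_empty R_ext_def lookup_coeff_map u_def)
  then have "u * uea_incl (b i) = - 1 * lookup (diff p0) {}"
    by (simp add: eq_neg_iff_add_eq_0 add.commute)
  also have "\<dots> \<in> left_ideal i"
    unfolding lookup_uea_diff_empty[OF p(1) i(2)] by (intro left_ideal_mult left_idealI)
  finally have "u \<in> left_ideal i" by (rule left_ideal_regular[OF i(1)])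
  then obtain g where g: "g \<in> ext i" "diff g = single {} u" using left_ideal_boundary i(2) by blast
  have "diff (p1 - single {} u) = 0" by (simp add: clinear_diff[OF clinear_diff_ce] d1 diff_one)
  moreover have "p1 - single {} u \<in> ext i" using p(2) by (intro ext_closed single_empty_ext)
  moreover have "lookup (p1 - single {} u) {} = 0" by (simp add: lookup_minus u_def)
  ultimately obtain g' where g': "g' \<in> ext i" "diff g' = p1 - single {} u" using Suc.IH[OF i(2)] by blast
  \<comment> \<open>Constants are cycles, so the constant term of the primitive can be removed;
    otherwise \<open>r\<close> below could have one and the induction hypothesis would not
    apply.\<close>
  define h1 where "h1 = g + g' - single {} (lookup (g + g') {})"
  have h1: "h1 \<in> ext i" "diff h1 = p1"
    using g g' by (simp_all add: h1_def ext_closed single_empty_ext clinear_add[OF clinear_diff_ce] clinear_diff[OF clinear_diff_ce] diff_one)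
  have "lookup h1 {} = 0" by (simp add: h1_def lookup_minus)
  then have "lookup (lie_der (b i) h1) {} = 0"
    by (simp add: lie_der_def lookup_minus lookup_ad_ext_empty R_ext_def lookup_coeff_map)
  moreover have "lookup p0 {} = 0" using Suc.prems(4) by (simp add: p(3) lookup_ext)
  ultimately have r0: "lookup (p0 + lie_der (b i) h1) {} = 0" by (simp add: lookup_add)
  \<comment> \<open>What is left of \<open>p\<close> after subtracting
    \<open>diff (- wedge n i h1)\<close>; it involves only the first \<open>i\<close>
    letters.\<close>
  define r where "r = p0 + lie_der (b i) h1"
  have r: "r \<in> ext i" using p(1) h1(1) i by (simp add: r_def ext_closed lie_der_ext)
  have "h1 \<in> ext n" using ext_mono[OF i(2) h1(1)] .
  then have "diff r = 0" using d0 by (simp add: r_def clinear_add[OF clinear_diff_ce] diff_lie_der h1(2))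
  moreover have "lookup r {} = 0" using r0 by (simp add: r_def)
  ultimately obtain h0 where h0: "h0 \<in> ext i" "diff h0 = r" using Suc.IH[OF i(2) r] by blast
  have "h0 - wedge n i h1 \<in> ext (Suc i)"
    by (intro ext_closed wedge_ext ext_mono[OF _ h0(1)] ext_mono[OF _ h1(1)]) auto
  moreover have "diff (h0 - wedge n i h1) = p"
    by (simp add: clinear_diff[OF clinear_diff_ce] h0(2) dw h1(2) r_def p(3))
  ultimately show ?case by blast
qed


lemma uea_act_trivial_left_ideal:
  assumes "u \<in> left_ideal i"
  shows "uea_act trivial_module u z = 0"
proof -
  have lm: "left_module (uea_act (trivial_module :: 'g \<Rightarrow> complex \<Rightarrow> complex))"
    by (rule left_module_uea_act[OF trivial_lie_module])
  obtain f where u: "u = (\<Sum>j<i. f j * uea_incl (b j))" using assms by (auto simp: left_ideal_def)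
  have "uea_act trivial_module (sum g A) z = (\<Sum>j\<in>A. uea_act trivial_module (g j) z)" if "finite A" for g :: "nat \<Rightarrow> 'g uea" and A
    using that
  proof (induction A rule: finite_induct)
    case (insert j A)
    then show ?case using lm by (simp add: left_module_def)
  qed (simp add: left_module_zero[OF lm])
  moreover have "uea_act trivial_module (v * uea_incl x) z = 0" for v and x :: 'g
  proof -
    have "uea_act trivial_module (v * uea_incl x) z = uea_act trivial_module v (uea_act trivial_module (uea_incl x) z)"
      using lm unfolding left_module_def by blast
    then show ?thesis
      by (simp add: uea_act_incl[OF trivial_lie_module] trivial_module_def left_module_zero_right[OF lm])
  qed
  ultimately show ?thesis by (simp add: u)
qed

text \<open>Each nonempty monomial ends in a generator, so an element is congruent to its
  augmentation modulo \<open>left_ideal n\<close>.\<close>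

lemma uea_augmentation_kernel:
  assumes "uea_act trivial_module u (1::complex) = 0"
  shows "u \<in> left_ideal n"
proof -
  have lm: "left_module (uea_act (trivial_module :: 'g \<Rightarrow> complex \<Rightarrow> complex))"
    by (rule left_module_uea_act[OF trivial_lie_module])
  have "u - uea_act trivial_module u (1::complex) *\<^sub>C 1 \<in> left_ideal n"
    using uea_span_monomials[of u]
  proof (induction rule: complex_vector.span_induct_alt)
    case base
    show ?case using left_ideal_sum[of "{}"] by (simp add: left_module_zero[OF lm])
  next
    case (step c x y)
    then obtain w where w: "set w \<subseteq> {..<n}" "x = monomial w" by blast
    have x: "x - uea_act trivial_module x (1::complex) *\<^sub>C 1 \<in> left_ideal n"
    proof (cases w rule: rev_cases)
      case Nil
      have "uea_act trivial_module (1 :: 'g uea) (1::complex) = 1" using lm unfolding left_module_def by blast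
      then show ?thesis using Nil w(2) left_ideal_sum[of "{}"] by (simp add: scaleC_one)
    next
      case (snoc w' j)
      then have "x \<in> left_ideal n" using w left_ideal_gen[of j n "monomial w'"] by simp
      then show ?thesis by (simp add: uea_act_trivial_left_ideal)
    qed
    have "uea_act trivial_module (c *\<^sub>C x + y) (1::complex) = c * uea_act trivial_module x 1 + uea_act trivial_module y 1"
      using lm by (simp add: left_module_def uea_act_scaleC[OF trivial_lie_module])
    then have "c *\<^sub>C x + y - uea_act trivial_module (c *\<^sub>C x + y) (1::complex) *\<^sub>C 1
        = c *\<^sub>C (x - uea_act trivial_module x (1::complex) *\<^sub>C 1) + (y - uea_act trivial_module y (1::complex) *\<^sub>C 1)"
      by (simp add: complex_vector.scale_right_diff_distrib scaleC_add_left scaleC_scaleC)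
    also have "\<dots> \<in> left_ideal n" by (intro left_ideal_add left_ideal_scaleC x step(2))
    finally show ?case .
  qed
  then show ?thesis by (simp add: assms)
qed

text \<open>Coefficients are only multiplied from the right and by scalars, which commutes with left
  multiplication.\<close>

lemma uea_diff_smult: "uea_diff (smult r p) = smult r (uea_diff p)"
proof -
  interpret koszul_complex b n \<xi> "\<lambda>x u. u * uea_incl x" by (rule koszul_complex_uea)
  have lin: "clinear (\<lambda>u. r * (u :: 'g uea))"
    by (rule clinearI) (simp_all add: distrib_left uea_mult_scaleC_right)
  have sm: "smult r = coeff_map (\<lambda>u. r * (u :: 'g uea))"
    by (intro ext poly_mapping_eqI) (simp add: lookup_smult lookup_coeff_map)
  have "R_ext x (coeff_map (\<lambda>u. r * u) q) = coeff_map (\<lambda>u. r * u) (R_ext x q)" for x q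
    by (rule poly_mapping_eqI) (simp add: R_ext_def lookup_coeff_map mult.assoc)
  then show ?thesis
    unfolding sm diff_def
    by (simp add: clinear_sum[OF clinear_coeff_map[OF lin]] clinear_diff[OF clinear_coeff_map[OF lin]]
      clinear_scale[OF clinear_coeff_map[OF lin]] ad_ext_coeff_map[OF lin] flip: contract_coeff_map[OF lin])
qed

definition koszul_resolution :: "(nat set, 'g uea, complex) resolution"
  where "koszul_resolution = \<lparr>res_gens = \<lambda>k. {A. A \<subseteq> {..<n} \<and> card A = k}, res_diff = \<lambda>_. uea_diff,
    res_aug = \<lambda>p. uea_act trivial_module (lookup p {}) 1\<rparr>"

lemma free_resolution_koszul: "free_resolution (uea_act trivial_module) koszul_resolution"
proof -
  interpret koszul_complex b n \<xi> "\<lambda>x u. u * uea_incl x" by (rule koszul_complex_uea)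
  have lm: "left_module (uea_act (trivial_module :: 'g \<Rightarrow> complex \<Rightarrow> complex))"
    by (rule left_module_uea_act[OF trivial_lie_module])
  let ?F = "\<lambda>k. free_mod {A. A \<subseteq> {..<n} \<and> card A = k} :: (nat set \<Rightarrow>\<^sub>0 'g uea) set"
  let ?e = "\<lambda>p. uea_act trivial_module (lookup p {} :: 'g uea) (1::complex)"
  have F: "?F k = homog k" for k by (simp add: free_mod_def homog_def)
  have zero: "lookup p {} = 0" if "p \<in> homog (Suc k)" for p k
    using that by (auto simp: homog_def in_keys_iff)
  have homog0: "p = single {} (lookup p {})" if "p \<in> homog 0" for p
  proof (rule poly_mapping_eqI)
    fix A
    have "A = {}" if "A \<in> keys p"
      using that \<open>p \<in> homog 0\<close> finite_subset[of A "{..<n}"] by (auto simp: homog_def)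
    then show "lookup p A = lookup (single {} (lookup p {})) A"
      by (auto simp: lookup_single when_def in_keys_iff)
  qed
  have exact: "uea_diff ` homog (Suc k) = {p \<in> homog k. diff p = 0}" if k: "k \<noteq> 0" for k
  proof (intro equalityI subsetI)
    fix p assume "p \<in> uea_diff ` homog (Suc k)"
    then obtain h where h: "h \<in> homog (Suc k)" "p = diff h" by blast
    then show "p \<in> {p \<in> homog k. diff p = 0}" by (simp add: diff_homog diff_diff homog_ext)
  next
    fix p assume "p \<in> {p \<in> homog k. diff p = 0}"
    then have p: "p \<in> homog k" "diff p = 0" by simp_all
    have "lookup p {} = 0" using zero[of p "k - 1"] p(1) k by simp
    then obtain h where h: "h \<in> ext n" "diff h = p" using uea_diff_exact[OF order_refl homog_ext[OF p(1)] p(2)] by blast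
    \<comment> \<open>The primitive found without grading is replaced by its component of degree
      \<open>Suc k\<close>.\<close>
    have "diff (degree_proj (Suc k) h) = p" using p(1) by (simp add: diff_degree_proj h(2) homog_iff)
    then show "p \<in> uea_diff ` homog (Suc k)" using degree_proj_homog[OF h(1)] by blast
  qed
  have exact0: "uea_diff ` homog 1 = {p \<in> homog 0. ?e p = 0}"
  proof (intro equalityI subsetI)
    fix p assume "p \<in> uea_diff ` homog 1"
    then obtain h where h: "h \<in> homog (Suc 0)" "p = diff h" by auto
    have "lookup p {} \<in> left_ideal n"
      unfolding h(2) lookup_uea_diff_empty[OF homog_ext[OF h(1)] order_refl] by (rule left_idealI)
    then show "p \<in> {p \<in> homog 0. ?e p = 0}" using h by (simp add: diff_homog uea_act_trivial_left_ideal)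
  next
    fix p assume "p \<in> {p \<in> homog 0. ?e p = 0}"
    then have p: "p \<in> homog 0" "?e p = 0" by simp_all
    obtain h where h: "h \<in> ext n" "diff h = p"
      using left_ideal_boundary[OF uea_augmentation_kernel[OF p(2)] order_refl] homog0[OF p(1)] by metis
    have "diff (degree_proj (Suc 0) h) = p" using p(1) by (simp add: diff_degree_proj h(2) homog_iff)
    then show "p \<in> uea_diff ` homog 1" using degree_proj_homog[OF h(1)] by (metis One_nat_def image_eqI)
  qed
  have "linear_on (homog 0) smult (uea_act trivial_module) ?e"
    using lm unfolding linear_on_def left_module_def lookup_add lookup_smult by blast
  moreover have "?e ` homog 0 = UNIV"
  proof -
    have "uea_act trivial_module (1 :: 'g uea) (1::complex) = 1" using lm unfolding left_module_def by blast
    then have "?e (single {} (z *\<^sub>C 1)) = z" for z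
      by (simp add: uea_act_scaleC[OF trivial_lie_module])
    moreover have "single {} (z *\<^sub>C 1) \<in> homog 0" for z by (simp add: homog_def)
    ultimately have "z \<in> ?e ` homog 0" for z by (intro image_eqI[of _ _ "single {} (z *\<^sub>C 1)"]) simp_all
    then show ?thesis by blast
  qed
  moreover have "linear_on (homog (Suc k)) smult smult uea_diff" for k
    by (simp add: linear_on_def clinear_add[OF clinear_diff_ce] uea_diff_smult)
  ultimately show ?thesis
    using exact exact0 unfolding free_resolution_def koszul_resolution_def Let_def resolution.simps F by simp
qed

end

section \<open>Comparison of free resolutions\<close>

lemma smult_one: "smult 1 p = p"
  by (rule poly_mapping_eqI) (simp add: lookup_smult)

lemma single_in_free_mod: "i \<in> I \<Longrightarrow> single i r \<in> free_mod I"
  by (auto simp: free_mod_def)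

lemma uminus_in_free_mod: "a \<in> free_mod I \<Longrightarrow> - a \<in> free_mod I"
  using smult_in_free_mod[of a I "- 1"] by (simp add: free_mod_def)

lemma diff_in_free_mod: "a \<in> free_mod I \<Longrightarrow> b \<in> free_mod I \<Longrightarrow> a - b \<in> free_mod I"
  using add_in_free_mod[OF _ uminus_in_free_mod, of a I b] by simp

text \<open>That \<open>i\<close> is not a key of \<open>q\<close> allows coordinatewise conditions
  to be split between the two summands; \<open>frag_of_negligible\<close> depends on it.\<close>

lemma free_mod_induct [consumes 1, case_names zero add]:
  assumes "p \<in> free_mod I" "P 0"
    and "\<And>i r q. i \<in> I \<Longrightarrow> q \<in> free_mod I \<Longrightarrow> i \<notin> keys q \<Longrightarrow> P q \<Longrightarrow>
      P (single i r + q)"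
  shows "P p"
  using assms(1)
proof (induction "card (keys p)" arbitrary: p)
  case 0
  then show ?case using assms(2) by simp
next
  case (Suc m)
  then obtain k where k: "k \<in> keys p" by (metis card.empty equals0I nat.distinct(1))
  let ?q = "p - single k (lookup p k)"
  have keys: "keys ?q = keys p - {k}"
    by (auto simp: in_keys_iff lookup_minus lookup_single when_def split: if_splits)
  have "k \<in> I" "?q \<in> free_mod I" "k \<notin> keys ?q" using k Suc.prems by (auto simp: free_mod_def keys)
  moreover have "m = card (keys ?q)" using keys k Suc.hyps(2) by simp
  ultimately have "P (single k (lookup p k) + ?q)" using Suc.hyps(1) assms(3) by blast
  then show ?case by simp
qed

lemma linear_on_zero: "linear_on (free_mod I) smult t f \<Longrightarrow> f 0 = 0"
  unfolding linear_on_def by (metis add_cancel_right_right zero_in_free_mod add.right_neutral)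

lemma linear_on_add:
  "linear_on (free_mod I) smult t f \<Longrightarrow> p \<in> free_mod I \<Longrightarrow> q \<in> free_mod I \<Longrightarrow> f (p + q) = f p + f q"
  by (simp add: linear_on_def)

lemma linear_on_smult:
  "linear_on (free_mod I) smult t f \<Longrightarrow> p \<in> free_mod I \<Longrightarrow> f (smult r p) = t r (f p)"
  by (simp add: linear_on_def)

lemma linear_on_diff:
  assumes f: "linear_on (free_mod I) smult t f" and p: "p \<in> free_mod I" "q \<in> free_mod I"
  shows "f (p - q) = f p - f q"
  using linear_on_add[OF f diff_in_free_mod[OF p] p(2)] by simp

lemma linear_on_eqI:
  assumes f: "linear_on (free_mod I) smult t f" and g: "linear_on (free_mod I) smult t g"
    and eq: "\<And>i. i \<in> I \<Longrightarrow> f (single i 1) = g (single i 1)"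
    and p: "p \<in> free_mod I"
  shows "f p = g p"
  using p
proof (induction rule: free_mod_induct)
  case zero
  show ?case by (simp only: linear_on_zero[OF f] linear_on_zero[OF g])
next
  case (add i r q)
  have s: "single i r = smult r (single i 1)" by (simp add: smult_single)
  have "f (single i r) = g (single i r)"
    unfolding s using add(1) eq by (simp only: linear_on_smult[OF f single_in_free_mod] linear_on_smult[OF g single_in_free_mod])
  then show ?case
    using add by (simp only: linear_on_add[OF f single_in_free_mod] linear_on_add[OF g single_in_free_mod])
qed

lemma free_extend_smult_in_free_mod:
  assumes "p \<in> free_mod I" "\<And>i. i \<in> I \<Longrightarrow> h i \<in> free_mod J"
  shows "free_extend smult h p \<in> free_mod J"
  by (rule linear_on_kernel_image[OF left_module_smult assms(1,2)])
    (simp_all add: zero_in_free_mod add_in_free_mod smult_in_free_mod)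

abbreviation "free_lift \<equiv> free_extend smult"

lemma free_lift_simps:
  "free_lift h (p + q) = free_lift h p + free_lift h q" "free_lift h (smult r p) = smult r (free_lift h p)"
  "free_lift h (single i r) = smult r (h i)" "free_lift h 0 = 0"
  by (simp_all add: free_extend_add[OF left_module_smult] free_extend_smult[OF left_module_smult]
    free_extend_single[OF left_module_smult]) (simp add: free_extend_def)

lemma free_lift_diff: "free_lift h (p - q) = free_lift h p - free_lift h q"
  using free_lift_simps(1)[of h "p - q" q] by simp

lemma linear_on_free_lift: "linear_on P smult smult (free_lift h)"
  by (simp add: linear_on_def free_lift_simps)

lemma linear_on_compose:
  assumes "linear_on (free_mod I) smult smult f" "linear_on (free_mod J) smult t g"
    and "\<And>p. p \<in> free_mod I \<Longrightarrow> f p \<in> free_mod J"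
  shows "linear_on (free_mod I) smult t (\<lambda>p. g (f p))"
  using assms by (simp add: linear_on_def)

locale resolved_module =
  fixes act :: "'r::ring_1 \<Rightarrow> 'v::ab_group_add \<Rightarrow> 'v" and R :: "('i, 'r, 'v) resolution"
  assumes resolution: "free_resolution act R"
begin

abbreviation "gens \<equiv> res_gens R"
abbreviation "F k \<equiv> free_mod (gens k)"
abbreviation "d \<equiv> res_diff R"
abbreviation "aug \<equiv> res_aug R"

lemma linear_aug: "linear_on (F 0) smult act aug"
  and aug_surj: "aug ` F 0 = UNIV"
  and linear_d: "linear_on (F (Suc k)) smult smult (d k)"
  and image_d_0: "d 0 ` F 1 = {p \<in> F 0. aug p = 0}"
  and image_d_Suc: "d (Suc k) ` F (Suc (Suc k)) = {p \<in> F (Suc k). d k p = 0}"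
  using resolution by (simp_all add: free_resolution_def Let_def)

text \<open>The augmentation takes the place of the differential in degree zero, so exactness
  becomes the single statement \<open>image_d\<close>.\<close>

definition cycle :: "nat \<Rightarrow> ('i \<Rightarrow>\<^sub>0 'r) \<Rightarrow> bool"
  where "cycle k p \<longleftrightarrow> p \<in> F k \<and> (case k of 0 \<Rightarrow> aug p = 0 | Suc j \<Rightarrow> d j p = 0)"

lemma image_d: "d k ` F (Suc k) = {p. cycle k p}"
  using image_d_0 image_d_Suc by (cases k) (auto simp: cycle_def)

lemma cycle_d: "p \<in> F (Suc k) \<Longrightarrow> cycle k (d k p)"
  using image_d by blast

lemma d_in: "p \<in> F (Suc k) \<Longrightarrow> d k p \<in> F k"
  using cycle_d by (simp add: cycle_def)

lemma cycle_boundary: "cycle k p \<Longrightarrow> \<exists>q\<in>F (Suc k). p = d k q"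
  using image_d[of k] by (metis imageE mem_Collect_eq)

end

text \<open>The comparison theorem, by dependent choice of the images \<open>h k i\<close> of basis
  elements; freeness makes any such choice extend by \<open>free_lift\<close>.\<close>

lemma resolution_lift_exists:
  fixes R :: "('i, 'r::ring_1, 'v::ab_group_add) resolution" and R' :: "('j, 'r, 'v) resolution"
  assumes "free_resolution act R" "free_resolution act R'"
  shows "\<exists>h. \<forall>k. (\<forall>i\<in>res_gens R k. h k i \<in> free_mod (res_gens R' k)) \<and>
    (\<forall>p\<in>free_mod (res_gens R 0). res_aug R' (free_lift (h 0) p) = res_aug R p) \<and>
    (\<forall>p\<in>free_mod (res_gens R (Suc k)). res_diff R' k (free_lift (h (Suc k)) p) = free_lift (h k) (res_diff R k p))"
proof -
  interpret A: resolved_module act R by unfold_locales fact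
  interpret B: resolved_module act R' by unfold_locales fact
  \<comment> \<open>The invariant includes that cycles go to cycles, which provides the preimages in
    the next degree.\<close>
  define P where "P k h \<longleftrightarrow> (\<forall>i\<in>A.gens k. h i \<in> B.F k) \<and> (\<forall>p. A.cycle k p \<longrightarrow> B.cycle k (free_lift h p)) \<and>
    (k = 0 \<longrightarrow> (\<forall>p\<in>A.F 0. B.aug (free_lift h p) = A.aug p))" for k and h :: "'i \<Rightarrow> ('j \<Rightarrow>\<^sub>0 'r)"
  define Q where "Q k h h' \<longleftrightarrow> (\<forall>p\<in>A.F (Suc k). B.d k (free_lift h' p) = free_lift h (A.d k p))"
    for k and h h' :: "'i \<Rightarrow> ('j \<Rightarrow>\<^sub>0 'r)"
  have "\<exists>f. \<forall>k. P k (f k) \<and> Q k (f k) (f (Suc k))"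
  proof (rule dependent_nat_choice)
    have "\<forall>i. \<exists>y\<in>B.F 0. B.aug y = A.aug (single i 1)" using B.aug_surj by (metis UNIV_I imageE)
    then obtain h where h: "\<And>i. h i \<in> B.F 0" "\<And>i. B.aug (h i) = A.aug (single i 1)" by metis
    have in0: "free_lift h p \<in> B.F 0" if "p \<in> A.F 0" for p by (rule free_extend_smult_in_free_mod[OF that h(1)])
    have aug: "B.aug (free_lift h p) = A.aug p" if "p \<in> A.F 0" for p
      using that
    proof (rule linear_on_eqI[OF _ A.linear_aug, rotated 2])
      show "linear_on (A.F 0) smult act (\<lambda>p. B.aug (free_lift h p))"
        by (rule linear_on_compose[OF linear_on_free_lift B.linear_aug in0])
    qed (simp add: free_lift_simps h smult_one)
    then have "P 0 h" using h(1) in0 by (simp add: P_def A.cycle_def B.cycle_def)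
    then show "\<exists>h. P 0 h" by blast
  next
    fix h k assume "P k h"
    then have h: "\<And>i. i \<in> A.gens k \<Longrightarrow> h i \<in> B.F k" "\<And>p. A.cycle k p \<Longrightarrow> B.cycle k (free_lift h p)" by (simp_all add: P_def)
    have "\<exists>y\<in>B.F (Suc k). free_lift h (A.d k (single i 1)) = B.d k y" if "i \<in> A.gens (Suc k)" for i
      by (intro B.cycle_boundary h(2) A.cycle_d single_in_free_mod that)
    then obtain h' where h': "\<And>i. i \<in> A.gens (Suc k) \<Longrightarrow> h' i \<in> B.F (Suc k)"
      "\<And>i. i \<in> A.gens (Suc k) \<Longrightarrow> free_lift h (A.d k (single i 1)) = B.d k (h' i)" by metis
    have inS: "free_lift h' p \<in> B.F (Suc k)" if "p \<in> A.F (Suc k)" for p by (rule free_extend_smult_in_free_mod[OF that h'(1)])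
    have Q: "B.d k (free_lift h' p) = free_lift h (A.d k p)" if "p \<in> A.F (Suc k)" for p
      using that
    proof (rule linear_on_eqI[rotated 3])
      show "linear_on (A.F (Suc k)) smult smult (\<lambda>p. B.d k (free_lift h' p))"
        by (rule linear_on_compose[OF linear_on_free_lift B.linear_d inS])
      show "linear_on (A.F (Suc k)) smult smult (\<lambda>p. free_lift h (A.d k p))"
        by (rule linear_on_compose[OF A.linear_d linear_on_free_lift A.d_in])
    qed (simp add: free_lift_simps h' smult_one)
    have "P (Suc k) h'"
      using h'(1) Q inS by (simp add: P_def A.cycle_def B.cycle_def free_lift_simps)
    then show "\<exists>h'. P (Suc k) h' \<and> Q k h h'" using Q by (auto simp: Q_def)
  qed
  then obtain h where h: "\<And>k. P k (h k)" "\<And>k. Q k (h k) (h (Suc k))" by blast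
  then show ?thesis by (intro exI[of _ h] allI) (simp add: P_def Q_def)
qed

text \<open>What the homotopy chosen so far fails to account for has values in cycles, hence in
  boundaries, and the homotopy can be continued on basis elements.\<close>

lemma resolution_null_homotopy_exists:
  fixes R :: "('i, 'r::ring_1, 'v::ab_group_add) resolution" and \<phi> :: "nat \<Rightarrow> ('i \<Rightarrow>\<^sub>0 'r) \<Rightarrow> ('i \<Rightarrow>\<^sub>0 'r)"
  assumes "free_resolution act R"
    and lin: "\<And>k. linear_on (free_mod (res_gens R k)) smult smult (\<phi> k)"
    and into: "\<And>k p. p \<in> free_mod (res_gens R k) \<Longrightarrow> \<phi> k p \<in> free_mod (res_gens R k)"
    and aug0: "\<And>p. p \<in> free_mod (res_gens R 0) \<Longrightarrow> res_aug R (\<phi> 0 p) = 0"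
    and chain: "\<And>k p. p \<in> free_mod (res_gens R (Suc k)) \<Longrightarrow> res_diff R k (\<phi> (Suc k) p) = \<phi> k (res_diff R k p)"
  shows "\<exists>s. \<forall>k. (\<forall>i\<in>res_gens R k. s k i \<in> free_mod (res_gens R (Suc k))) \<and>
    (\<forall>p\<in>free_mod (res_gens R 0). \<phi> 0 p = res_diff R 0 (free_lift (s 0) p)) \<and>
    (\<forall>p\<in>free_mod (res_gens R (Suc k)).
      \<phi> (Suc k) p = res_diff R (Suc k) (free_lift (s (Suc k)) p) + free_lift (s k) (res_diff R k p))"
proof -
  interpret A: resolved_module act R by unfold_locales fact
  define P where "P k s \<longleftrightarrow> (\<forall>i\<in>A.gens k. s i \<in> A.F (Suc k)) \<and> (\<forall>p. A.cycle k p \<longrightarrow> \<phi> k p = A.d k (free_lift s p)) \<and>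
    (k = 0 \<longrightarrow> (\<forall>p\<in>A.F 0. \<phi> 0 p = A.d 0 (free_lift s p)))" for k and s :: "'i \<Rightarrow> ('i \<Rightarrow>\<^sub>0 'r)"
  define Q where "Q k s s' \<longleftrightarrow> (\<forall>p\<in>A.F (Suc k). \<phi> (Suc k) p = A.d (Suc k) (free_lift s' p) + free_lift s (A.d k p))"
    for k and s s' :: "'i \<Rightarrow> ('i \<Rightarrow>\<^sub>0 'r)"
  have "\<exists>f. \<forall>k. P k (f k) \<and> Q k (f k) (f (Suc k))"
  proof (rule dependent_nat_choice)
    have "\<exists>y\<in>A.F (Suc 0). \<phi> 0 (single i 1) = A.d 0 y" if "i \<in> A.gens 0" for i
      using into[OF single_in_free_mod[OF that]] aug0[OF single_in_free_mod[OF that]]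
      by (intro A.cycle_boundary) (simp add: A.cycle_def)
    then obtain s where s: "\<And>i. i \<in> A.gens 0 \<Longrightarrow> s i \<in> A.F (Suc 0)"
      "\<And>i. i \<in> A.gens 0 \<Longrightarrow> \<phi> 0 (single i 1) = A.d 0 (s i)" by metis
    have inS: "free_lift s p \<in> A.F (Suc 0)" if "p \<in> A.F 0" for p by (rule free_extend_smult_in_free_mod[OF that s(1)])
    have "\<phi> 0 p = A.d 0 (free_lift s p)" if "p \<in> A.F 0" for p
      using that
    proof (rule linear_on_eqI[OF lin, rotated 2])
      show "linear_on (A.F 0) smult smult (\<lambda>p. A.d 0 (free_lift s p))"
        by (rule linear_on_compose[OF linear_on_free_lift A.linear_d inS])
    qed (simp add: free_lift_simps s smult_one)
    then have "P 0 s" using s(1) by (simp add: P_def A.cycle_def)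
    then show "\<exists>s. P 0 s" by blast
  next
    fix s k assume "P k s"
    then have s: "\<And>i. i \<in> A.gens k \<Longrightarrow> s i \<in> A.F (Suc k)" "\<And>p. A.cycle k p \<Longrightarrow> \<phi> k p = A.d k (free_lift s p)" by (simp_all add: P_def)
    have ins: "free_lift s p \<in> A.F (Suc k)" if "p \<in> A.F k" for p by (rule free_extend_smult_in_free_mod[OF that s(1)])
    \<comment> \<open>\<open>?\<psi>\<close> takes values in cycles: \<open>A.d k p\<close> is a
      cycle, on which the invariant says that \<open>\<phi> k\<close> is \<open>A.d k\<close> after
      the old homotopy.\<close>
    let ?\<psi> = "\<lambda>p. \<phi> (Suc k) p - free_lift s (A.d k p)"
    have psi_in: "?\<psi> p \<in> A.F (Suc k)" if "p \<in> A.F (Suc k)" for p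
      using that by (intro diff_in_free_mod into ins A.d_in)
    have "\<exists>y\<in>A.F (Suc (Suc k)). ?\<psi> (single i 1) = A.d (Suc k) y" if i: "i \<in> A.gens (Suc k)" for i
    proof (rule A.cycle_boundary)
      let ?x = "single i 1"
      have x: "?x \<in> A.F (Suc k)" by (rule single_in_free_mod[OF i])
      have "A.d k (?\<psi> ?x) = A.d k (\<phi> (Suc k) ?x) - A.d k (free_lift s (A.d k ?x))"
        by (intro linear_on_diff[OF A.linear_d] into ins A.d_in x)
      also have "\<dots> = 0" using s(2)[OF A.cycle_d[OF x]] chain[OF x] by simp
      finally show "A.cycle (Suc k) (?\<psi> ?x)" using psi_in[OF x] by (simp add: A.cycle_def)
    qed
    then obtain s' where s': "\<And>i. i \<in> A.gens (Suc k) \<Longrightarrow> s' i \<in> A.F (Suc (Suc k))"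
      "\<And>i. i \<in> A.gens (Suc k) \<Longrightarrow> ?\<psi> (single i 1) = A.d (Suc k) (s' i)" by metis
    have inS: "free_lift s' p \<in> A.F (Suc (Suc k))" if "p \<in> A.F (Suc k)" for p by (rule free_extend_smult_in_free_mod[OF that s'(1)])
    have eq: "?\<psi> p = A.d (Suc k) (free_lift s' p)" if "p \<in> A.F (Suc k)" for p
      using that
    proof (rule linear_on_eqI[rotated 3])
      show "linear_on (A.F (Suc k)) smult smult (\<lambda>p. A.d (Suc k) (free_lift s' p))"
        by (rule linear_on_compose[OF linear_on_free_lift A.linear_d inS])
      have "linear_on (A.F (Suc k)) smult smult (\<lambda>p. free_lift s (A.d k p))"
        by (rule linear_on_compose[OF A.linear_d linear_on_free_lift A.d_in])
      moreover have "smult r (a - b) = smult r a - smult r b" for r :: 'r and a b :: "'i \<Rightarrow>\<^sub>0 'r"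
        by (rule poly_mapping_eqI) (simp add: lookup_smult lookup_minus right_diff_distrib)
      ultimately show "linear_on (A.F (Suc k)) smult smult ?\<psi>"
        using lin[of "Suc k"] by (simp add: linear_on_def)
    qed (simp add: free_lift_simps s' smult_one)
    have "P (Suc k) s'"
      using s'(1) eq by (force simp: P_def A.cycle_def free_lift_simps)
    moreover have "Q k s s'" unfolding Q_def using eq by (metis diff_add_cancel)
    ultimately show "\<exists>s'. P (Suc k) s' \<and> Q k s s'" by blast
  qed
  then obtain s where s: "\<And>k. P k (s k)" "\<And>k. Q k (s k) (s (Suc k))" by blast
  then show ?thesis by (intro exI[of _ s] allI) (simp add: P_def Q_def)
qed

section \<open>Reduction along a character of the ring\<close>

locale ring_character =
  fixes ev :: "'r::ring_1 \<Rightarrow> complex"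
  assumes ev_add: "ev (a + b) = ev a + ev b" and ev_mult: "ev (a * b) = ev a * ev b"
begin

lemma ev_zero: "ev 0 = 0"
  using ev_add[of 0 0] by simp

lemma ev_diff: "ev (a - b) = ev a - ev b"
  using ev_add[of "a - b" b] by simp

lemma ev_sum: "ev (sum f A) = (\<Sum>a\<in>A. ev (f a))"
  by (induction A rule: infinite_finite_induct) (simp_all add: ev_zero ev_add)

text \<open>The kernel of the reduction of a free module along \<open>ev\<close>; the reduced
  complex is handled by computing modulo this set.\<close>

definition negligible :: "('i \<Rightarrow>\<^sub>0 'r) set"
  where "negligible = {p. \<forall>i. ev (lookup p i) = 0}"

lemma negligible_closed:
  "0 \<in> negligible" "p \<in> negligible \<Longrightarrow> q \<in> negligible \<Longrightarrow> p + q \<in> negligible"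
  "p \<in> negligible \<Longrightarrow> q \<in> negligible \<Longrightarrow> p - q \<in> negligible" "p \<in> negligible \<Longrightarrow> - p \<in> negligible"
  using ev_diff[of 0] by (simp_all add: negligible_def lookup_add lookup_minus ev_add ev_diff ev_zero)

lemma negligible_free_lift: "p \<in> negligible \<Longrightarrow> free_lift h p \<in> negligible"
  by (simp add: negligible_def free_extend_def lookup_sum lookup_smult ev_sum ev_mult)

definition reduced_cycle :: "('i, 'r, 'v) resolution \<Rightarrow> nat \<Rightarrow> ('i \<Rightarrow>\<^sub>0 'r) \<Rightarrow> bool"
  where "reduced_cycle R k p \<longleftrightarrow> p \<in> free_mod (res_gens R k) \<and> (\<forall>j. k = Suc j \<longrightarrow> res_diff R j p \<in> negligible)"

definition reduced_boundary :: "('i, 'r, 'v) resolution \<Rightarrow> nat \<Rightarrow> ('i \<Rightarrow>\<^sub>0 'r) \<Rightarrow> bool"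
  where "reduced_boundary R k p \<longleftrightarrow> (\<exists>q\<in>free_mod (res_gens R (Suc k)). p - res_diff R k q \<in> negligible)"

text \<open>Comparison maps in both directions compose to a map homotopic to the identity. They and
  the homotopy have the form \<open>free_lift\<close>, hence preserve \<open>negligible\<close> and
  descend to the reduced complexes.\<close>

lemma reduced_homology_transfer:
  fixes R :: "('i, 'r, 'v::ab_group_add) resolution" and R' :: "('j, 'r, 'v) resolution"
  assumes R: "free_resolution act R" and R': "free_resolution act R'"
    and exact: "\<And>p. reduced_cycle R' k p \<Longrightarrow> reduced_boundary R' k p"
    and p: "reduced_cycle R k p"
  shows "reduced_boundary R k p"
proof -
  interpret A: resolved_module act R by unfold_locales fact
  interpret B: resolved_module act R' by unfold_locales fact
  obtain f where f: "\<And>k i. i \<in> A.gens k \<Longrightarrow> f k i \<in> B.F k"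
    "\<And>p. p \<in> A.F 0 \<Longrightarrow> B.aug (free_lift (f 0) p) = A.aug p"
    "\<And>k p. p \<in> A.F (Suc k) \<Longrightarrow> B.d k (free_lift (f (Suc k)) p) = free_lift (f k) (A.d k p)"
    using resolution_lift_exists[OF R R'] by blast
  obtain g where g: "\<And>k i. i \<in> B.gens k \<Longrightarrow> g k i \<in> A.F k"
    "\<And>p. p \<in> B.F 0 \<Longrightarrow> A.aug (free_lift (g 0) p) = B.aug p"
    "\<And>k p. p \<in> B.F (Suc k) \<Longrightarrow> A.d k (free_lift (g (Suc k)) p) = free_lift (g k) (B.d k p)"
    using resolution_lift_exists[OF R' R] by blast
  have f_in: "free_lift (f k) p \<in> B.F k" if "p \<in> A.F k" for k p by (rule free_extend_smult_in_free_mod[OF that f(1)])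
  have g_in: "free_lift (g k) p \<in> A.F k" if "p \<in> B.F k" for k p by (rule free_extend_smult_in_free_mod[OF that g(1)])
  let ?\<phi> = "\<lambda>k p. free_lift (g k) (free_lift (f k) p) - p"
  have "\<exists>s. \<forall>k. (\<forall>i\<in>A.gens k. s k i \<in> A.F (Suc k)) \<and> (\<forall>p\<in>A.F 0. ?\<phi> 0 p = A.d 0 (free_lift (s 0) p)) \<and>
    (\<forall>p\<in>A.F (Suc k). ?\<phi> (Suc k) p = A.d (Suc k) (free_lift (s (Suc k)) p) + free_lift (s k) (A.d k p))"
  proof (rule resolution_null_homotopy_exists[OF R])
    have sm: "smult r (a - b) = smult r a - smult r b" for r :: 'r and a b :: "'i \<Rightarrow>\<^sub>0 'r"
      by (rule poly_mapping_eqI) (simp add: lookup_smult lookup_minus right_diff_distrib)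
    show "linear_on (A.F k) smult smult (?\<phi> k)" for k
      by (simp add: linear_on_def free_lift_simps sm)
    show "?\<phi> k p \<in> A.F k" if "p \<in> A.F k" for k p using that by (intro diff_in_free_mod g_in f_in)
    show "A.aug (?\<phi> 0 p) = 0" if "p \<in> A.F 0" for p
      using that by (subst linear_on_diff[OF A.linear_aug]) (simp_all add: g_in f_in g(2) f(2))
    show "A.d k (?\<phi> (Suc k) p) = ?\<phi> k (A.d k p)" if "p \<in> A.F (Suc k)" for k p
      using that by (subst linear_on_diff[OF A.linear_d]) (simp_all add: g_in f_in g(3) f(3))
  qed
  then obtain s where s: "\<And>k i. i \<in> A.gens k \<Longrightarrow> s k i \<in> A.F (Suc k)"
    "\<And>p. p \<in> A.F 0 \<Longrightarrow> ?\<phi> 0 p = A.d 0 (free_lift (s 0) p)"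
    "\<And>k p. p \<in> A.F (Suc k) \<Longrightarrow> ?\<phi> (Suc k) p = A.d (Suc k) (free_lift (s (Suc k)) p) + free_lift (s k) (A.d k p)"
    by blast
  have s_in: "free_lift (s k) p \<in> A.F (Suc k)" if "p \<in> A.F k" for k p by (rule free_extend_smult_in_free_mod[OF that s(1)])
  have pF: "p \<in> A.F k" using p by (simp add: reduced_cycle_def)
  have "reduced_cycle R' k (free_lift (f k) p)"
    using p f_in[OF pF] by (auto simp: reduced_cycle_def f(3) negligible_free_lift)
  then obtain q where q: "q \<in> B.F (Suc k)" "free_lift (f k) p - B.d k q \<in> negligible"
    using exact by (auto simp: reduced_boundary_def)
  have gq: "free_lift (g k) (free_lift (f k) p) - A.d k (free_lift (g (Suc k)) q) \<in> negligible"
    using negligible_free_lift[OF q(2), of "g k"] by (simp add: free_lift_diff g(3)[OF q(1)])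
  have hom: "?\<phi> k p - A.d k (free_lift (s k) p) \<in> negligible"
  proof (cases k)
    case 0
    then show ?thesis using s(2) pF negligible_closed(1) by simp
  next
    case (Suc j)
    then have "A.d j p \<in> negligible" using p by (simp add: reduced_cycle_def)
    then show ?thesis using s(3)[of p j] pF Suc by (simp add: negligible_free_lift)
  qed
  \<comment> \<open>The primitive of \<open>p\<close> is the image under \<open>g\<close> of the one
    found in \<open>R'\<close>, corrected by the homotopy.\<close>
  have "A.d k (free_lift (g (Suc k)) q - free_lift (s k) p) = A.d k (free_lift (g (Suc k)) q) - A.d k (free_lift (s k) p)"
    by (rule linear_on_diff[OF A.linear_d g_in[OF q(1)] s_in[OF pF]])
  then have "p - A.d k (free_lift (g (Suc k)) q - free_lift (s k) p)
      = (free_lift (g k) (free_lift (f k) p) - A.d k (free_lift (g (Suc k)) q)) - (?\<phi> k p - A.d k (free_lift (s k) p))"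
    by simp
  also have "\<dots> \<in> negligible" by (rule negligible_closed(3)[OF gq hom])
  finally show ?thesis
    unfolding reduced_boundary_def using diff_in_free_mod[OF g_in[OF q(1)] s_in[OF pF]] by blast
qed

end

section \<open>Tor of a one-dimensional module\<close>

text \<open>The algebra homomorphism to the complex numbers that extends a character
  \<open>l\<close>, read off from the action on the one-dimensional module.\<close>

definition char_eval :: "('g::complex_lie_algebra \<Rightarrow> complex) \<Rightarrow> 'g uea \<Rightarrow> complex"
  where "char_eval l u = uea_act (char_module l) u 1"

lemma lie_module_char: "lie_character l \<Longrightarrow> lie_module (char_module l)"
  unfolding lie_module_def char_module_def
  by (auto intro!: clinearI simp: lie_character_def clinear_add clinear_scale algebra_simps)

context
  fixes l :: "'g::complex_lie_algebra \<Rightarrow> complex"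
  assumes l: "lie_character l"
begin

lemma uea_act_char: "uea_act (char_module l) u z = z * char_eval l u"
proof -
  have "clinear (uea_act (char_module l) u)"
    unfolding uea_act_def by (rule free_act_clinear) (use lie_module_char[OF l] in \<open>simp add: lie_module_def\<close>)
  from clinear_scale[OF this, of z 1] show ?thesis by (simp add: char_eval_def)
qed

lemma char_eval_scaleC: "char_eval l (c *\<^sub>C u) = c * char_eval l u"
  by (simp add: char_eval_def uea_act_scaleC[OF lie_module_char[OF l]])

lemma char_eval_ring: "char_eval l (u + v) = char_eval l u + char_eval l v"
  "char_eval l (u * v) = char_eval l u * char_eval l v" "char_eval l 1 = 1"
proof -
  note lm = left_module_uea_act[OF lie_module_char[OF l]]
  show "char_eval l (u + v) = char_eval l u + char_eval l v" "char_eval l 1 = 1"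
    using lm unfolding char_eval_def left_module_def by blast+
  have "char_eval l (u * v) = uea_act (char_module l) u (char_eval l v)"
    using lm unfolding char_eval_def left_module_def by blast
  then show "char_eval l (u * v) = char_eval l u * char_eval l v" by (simp add: uea_act_char)
qed

lemma char_eval_incl: "char_eval l (uea_incl x) = l x"
  by (simp add: char_eval_def uea_act_incl[OF lie_module_char[OF l]] char_module_def)

lemma clinear_char_eval: "clinear (char_eval l)"
  by (rule clinearI) (simp_all add: char_eval_ring char_eval_scaleC)

interpretation ring_character "char_eval l"
  by unfold_locales (rule char_eval_ring)+

text \<open>Brings complex scalars into the form to which linearity over the enveloping algebra
  applies.\<close>

lemma scaleC_smult: "c *\<^sub>C p = smult (c *\<^sub>C (1 :: 'g uea)) p"
  by (rule poly_mapping_eqI) (simp add: lookup_smult uea_mult_scaleC_left)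

text \<open>The isomorphism of \<open>\<complex>\<^sub>l\<^sup>* \<otimes> F\<close> with the quotient of \<open>F\<close> by \<open>negligible\<close>, on representatives.\<close>

definition contracted :: "((complex \<Rightarrow> complex) \<times> ('i \<Rightarrow>\<^sub>0 'g uea) \<Rightarrow>\<^sub>0 int) \<Rightarrow> ('i \<Rightarrow>\<^sub>0 'g uea)"
  where "contracted z = (\<Sum>x\<in>keys z. (of_int (lookup z x) * fst x 1) *\<^sub>C snd x)"

lemma contracted_frag_of [simp]: "contracted (frag_of (m, p)) = m 1 *\<^sub>C p"
  by (simp add: contracted_def)

lemma contracted_add: "contracted (a + b) = contracted a + contracted b"
  unfolding contracted_def
  by (rule sum_keys_add) (simp_all add: distrib_right scaleC_add_left)

lemma contracted_zero [simp]: "contracted 0 = 0"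
  by (simp add: contracted_def)

lemma contracted_diff: "contracted (a - b) = contracted a - contracted b"
  using contracted_add[of "a - b" b] by simp

lemma dual_apply: "m \<in> dual_space \<Longrightarrow> m z = z * m 1"
  using clinear_scale[of m z 1] by (simp add: dual_space_def)

lemma dual_act_apply:
  assumes "m \<in> dual_space"
  shows "dual_act (char_module l) m u = (\<lambda>z. char_eval l u * m z)"
proof
  fix z
  show "dual_act (char_module l) m u z = char_eval l u * m z"
    using clinear_scale[of m "char_eval l u" z] assms
    by (simp add: dual_act_def uea_act_char dual_space_def mult.commute)
qed

lemma id_dual: "(\<lambda>z. z) \<in> dual_space"
  by (auto simp: dual_space_def intro!: clinearI)

abbreviation "rel I \<equiv> tensor_rel dual_space (dual_act (char_module l)) (free_mod I) smult"

lemma rel_add: "a \<in> rel I \<Longrightarrow> b \<in> rel I \<Longrightarrow> a + b \<in> rel I"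
  using tensor_rel.diff[OF _ tensor_rel.diff[OF tensor_rel.zero], of a dual_space "dual_act (char_module l)" "free_mod I" smult b] by simp

lemma contracted_rel: "z \<in> rel I \<Longrightarrow> contracted z \<in> negligible"
proof (induction rule: tensor_rel.induct)
  case (add_left m m' p)
  then show ?case by (simp add: contracted_diff scaleC_add_left negligible_closed)
next
  case (add_right m p p')
  then show ?case by (simp add: contracted_diff scaleC_add_right negligible_closed)
next
  case (balanced m p u)
  then show ?case
    by (simp add: contracted_diff dual_act_apply negligible_def lookup_minus lookup_smult ev_diff char_eval_scaleC ev_mult)
qed (simp_all add: contracted_diff negligible_closed)

lemma contracted_in:
  assumes "z \<in> tensor_free dual_space (free_mod I)"
  shows "contracted z \<in> free_mod I"
proof -
  have "keys z \<subseteq> dual_space \<times> free_mod I" using assms by (simp add: tensor_free_def)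
  then show ?thesis
    by (induction z rule: frag_induction) (auto simp: contracted_diff zero_in_free_mod diff_in_free_mod scaleC_smult smult_in_free_mod)
qed

lemma tensor_map_diff: "tensor_map f (a - b) = tensor_map f a - tensor_map f b"
  by (simp add: tensor_map_def frag_extend_diff)

lemma contracted_tensor_map:
  assumes f: "linear_on (free_mod I) smult smult f" and z: "z \<in> tensor_free dual_space (free_mod I)"
  shows "contracted (tensor_map f z) = f (contracted z)"
proof -
  have keys: "keys z \<subseteq> dual_space \<times> free_mod I" using z by (simp add: tensor_free_def)
  have "contracted (tensor_map f z) = f (contracted z) \<and> contracted z \<in> free_mod I"
    using keys
  proof (induction z rule: frag_induction)
    case zero
    show ?case by (simp add: tensor_map_def linear_on_zero[OF f] zero_in_free_mod)
  next
    case (one x)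
    then obtain m p where "x = (m, p)" "p \<in> free_mod I" by auto
    then show ?case
      by (simp add: tensor_map_def scaleC_smult linear_on_smult[OF f] smult_in_free_mod)
  next
    case (diff a b)
    then show ?case by (simp add: tensor_map_diff contracted_diff linear_on_diff[OF f] diff_in_free_mod)
  qed
  then show ?thesis ..
qed

text \<open>Every \<open>m\<close> in the dual of the complex line is the identity acted upon by the
  scalar \<open>m 1\<close>; balancing moves this scalar to the right factor, and additivity
  collects everything into one pure tensor.\<close>

lemma tensor_free_contracted:
  assumes z: "z \<in> tensor_free dual_space (free_mod I)"
  shows "z - frag_of (\<lambda>z. z, contracted z) \<in> rel I"
proof -
  let ?id = "\<lambda>z :: complex. z"
  have keys: "keys z \<subseteq> dual_space \<times> free_mod I" using z by (simp add: tensor_free_def)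
  have "z - frag_of (?id, contracted z) \<in> rel I \<and> contracted z \<in> free_mod I"
    using keys
  proof (induction z rule: frag_induction)
    case zero
    have "frag_of (?id, 0 + 0) - frag_of (?id, 0) - frag_of (?id, 0) \<in> rel I"
      by (intro tensor_rel.add_right id_dual zero_in_free_mod)
    then show ?case by (simp add: zero_in_free_mod)
  next
    case (one x)
    then obtain m p where x: "x = (m, p)" "m \<in> dual_space" "p \<in> free_mod I" by auto
    have "dual_act (char_module l) ?id (m 1 *\<^sub>C 1) = (\<lambda>z. m 1 * z)"
      by (simp add: dual_act_apply[OF id_dual] char_eval_scaleC char_eval_ring)
    also have "\<dots> = m"
    proof
      show "m 1 * z = m z" for z using dual_apply[OF x(2), of z] by (simp only: mult.commute)
    qed
    finally have "dual_act (char_module l) ?id (m 1 *\<^sub>C 1) = m" .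
    then have "frag_of (m, p) - frag_of (?id, smult (m 1 *\<^sub>C 1) p) \<in> rel I"
      using tensor_rel.balanced[OF id_dual x(3), of "dual_act (char_module l)" "m 1 *\<^sub>C 1" smult] by simp
    then show ?case using x by (simp add: scaleC_smult smult_in_free_mod)
  next
    case (diff a b)
    have "frag_of (?id, (contracted a - contracted b) + contracted b) - frag_of (?id, contracted a - contracted b) - frag_of (?id, contracted b) \<in> rel I"
      using diff by (intro tensor_rel.add_right id_dual diff_in_free_mod) auto
    then have e: "frag_of (?id, contracted a) - frag_of (?id, contracted a - contracted b) - frag_of (?id, contracted b) \<in> rel I"
      by simp
    have ab: "a - frag_of (?id, contracted a) \<in> rel I" "b - frag_of (?id, contracted b) \<in> rel I" using diff by blast+
    from rel_add[OF tensor_rel.diff[OF ab] e] show ?case using diff by (simp add: contracted_diff diff_in_free_mod)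
  qed
  then show ?thesis ..
qed

text \<open>A term \<open>single i u\<close> with \<open>char_eval l u = 0\<close> can be balanced
  onto the left factor, where \<open>u\<close> acts as zero, and the tensor product of zero with
  anything is zero.\<close>

lemma frag_of_negligible:
  assumes "p \<in> free_mod I" "p \<in> negligible"
  shows "frag_of (\<lambda>z. z, p) \<in> rel I"
  using assms
proof (induction rule: free_mod_induct)
  case zero
  let ?id = "\<lambda>z :: complex. z"
  have "frag_of (?id, 0 + 0) - frag_of (?id, 0) - frag_of (?id, 0) \<in> rel I"
    by (intro tensor_rel.add_right id_dual zero_in_free_mod)
  from tensor_rel.diff[OF tensor_rel.zero this] show ?case by simp
next
  case (add i u q)
  let ?id = "\<lambda>z :: complex. z" and ?zero = "\<lambda>z :: complex. 0 :: complex"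
  let ?one = "single i (1 :: 'g uea)"
  have one: "?one \<in> free_mod I" by (rule single_in_free_mod[OF add(1)])
  have neg: "char_eval l (lookup (single i u + q) j) = 0" for j
    using add.prems by (simp add: negligible_def)
  have u: "char_eval l u = 0"
    using neg[of i] add(3) by (simp add: lookup_add in_keys_iff)
  then have "char_eval l (lookup q j) = 0" for j
    using neg[of j] by (cases "i = j") (simp_all add: lookup_add lookup_single ev_add)
  then have "q \<in> negligible" by (simp add: negligible_def)
  then have q_rel: "frag_of (?id, q) \<in> rel I" by (rule add.IH)
  have "?zero \<in> dual_space" by (auto simp: dual_space_def intro!: clinearI)
  note tensor_rel.add_left[OF this this one, of "dual_act (char_module l)" smult]
  moreover have "?zero + ?zero = ?zero" by (simp add: fun_eq_iff)
  ultimately have "- frag_of (?zero, ?one) \<in> rel I" by simp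
  moreover have "frag_of (?zero, ?one) - frag_of (?id, single i u) \<in> rel I"
    using tensor_rel.balanced[OF id_dual one, of "dual_act (char_module l)" u smult]
    by (simp add: dual_act_apply[OF id_dual] u smult_single)
  ultimately have "- frag_of (?id, single i u) \<in> rel I" using rel_add by fastforce
  from tensor_rel.diff[OF tensor_rel.zero this] have s_rel: "frag_of (?id, single i u) \<in> rel I" by simp
  have "frag_of (?id, single i u + q) - frag_of (?id, single i u) - frag_of (?id, q) \<in> rel I"
    by (intro tensor_rel.add_right id_dual single_in_free_mod add)
  from rel_add[OF rel_add[OF this s_rel] q_rel] show ?case by simp
qed

lemma rel_iff_negligible:
  assumes z: "z \<in> tensor_free dual_space (free_mod I)"
  shows "z \<in> rel I \<longleftrightarrow> contracted z \<in> negligible"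
proof
  assume "contracted z \<in> negligible"
  then have "frag_of (\<lambda>z. z, contracted z) \<in> rel I" by (rule frag_of_negligible[OF contracted_in[OF z]])
  from rel_add[OF tensor_free_contracted[OF z] this] show "z \<in> rel I" by simp
qed (rule contracted_rel)

lemma tensor_map_in:
  assumes f: "\<And>p. p \<in> P \<Longrightarrow> f p \<in> Q" and z: "z \<in> tensor_free M P"
  shows "tensor_map f z \<in> tensor_free M Q"
proof -
  have "keys z \<subseteq> M \<times> P" using z by (simp add: tensor_free_def)
  then have "keys (tensor_map f z) \<subseteq> M \<times> Q"
  proof (induction z rule: frag_induction)
    case (diff a b)
    then show ?case unfolding tensor_map_diff by (meson keys_diff Un_least subset_trans)
  qed (auto simp: tensor_map_def f)
  then show ?thesis by (simp add: tensor_free_def)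
qed

lemma frag_of_in: "p \<in> P \<Longrightarrow> frag_of (\<lambda>z. z, p) \<in> tensor_free dual_space P"
  by (simp add: tensor_free_def id_dual)

lemma tensor_free_diff: "a \<in> tensor_free M P \<Longrightarrow> b \<in> tensor_free M P \<Longrightarrow> a - b \<in> tensor_free M P"
  by (simp add: tensor_free_def) (meson keys_diff Un_least subset_trans)

text \<open>\<open>contracted\<close> carries relations, and only them, to negligible elements, so
  cycles and boundaries of the tensored complex are those of the reduced one. As \<open>0\<close> is
  a cycle, the quotient is a singleton exactly if all cycles are boundaries.\<close>

lemma tor_nonzero_iff_reduced:
  fixes act :: "'g uea \<Rightarrow> 'v::ab_group_add \<Rightarrow> 'v"
  assumes act: "left_module act"
  shows "tor_nonzero k dual_space (dual_act (char_module l)) act \<longleftrightarrow>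
    (\<exists>p. reduced_cycle (chosen_resolution act) k p \<and> \<not> reduced_boundary (chosen_resolution act) k p)"
proof -
  let ?R = "chosen_resolution act" and ?M = "dual_space :: (complex \<Rightarrow> complex) set"
  interpret A: resolved_module act ?R by unfold_locales (rule free_resolution_chosen[OF act])
  let ?Z = "tensor_cycles k ?M (dual_act (char_module l)) ?R"
  let ?B = "tensor_boundaries k ?M (dual_act (char_module l)) ?R"
  let ?r = "{(x, y). x \<in> ?Z \<and> y \<in> ?Z \<and> x - y \<in> ?B}"
  have Z: "z \<in> ?Z \<longleftrightarrow> z \<in> tensor_free ?M (A.F k) \<and> reduced_cycle ?R k (contracted z)" for z
    by (auto simp: tensor_cycles_def reduced_cycle_def contracted_in
      rel_iff_negligible[OF tensor_map_in[OF A.d_in]] contracted_tensor_map[OF A.linear_d])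
  have B: "z \<in> ?B \<longleftrightarrow> reduced_boundary ?R k (contracted z)" if z: "z \<in> tensor_free ?M (A.F k)" for z
  proof
    assume "z \<in> ?B"
    then obtain w r where w: "z = tensor_map (A.d k) w + r" "w \<in> tensor_free ?M (A.F (Suc k))" "r \<in> rel (A.gens k)"
      by (auto simp: tensor_boundaries_def)
    then have "contracted z - A.d k (contracted w) \<in> negligible"
      using contracted_rel by (simp add: contracted_add contracted_tensor_map[OF A.linear_d])
    then show "reduced_boundary ?R k (contracted z)" using contracted_in[OF w(2)] by (auto simp: reduced_boundary_def)
  next
    assume "reduced_boundary ?R k (contracted z)"
    then obtain q where q: "q \<in> A.F (Suc k)" "contracted z - A.d k q \<in> negligible" by (auto simp: reduced_boundary_def)
    let ?w = "frag_of (\<lambda>z :: complex. z, q)"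
    have w: "?w \<in> tensor_free ?M (A.F (Suc k))" by (rule frag_of_in[OF q(1)])
    have tw: "tensor_map (A.d k) ?w \<in> tensor_free ?M (A.F k)" by (rule tensor_map_in[OF A.d_in w])
    have "contracted (z - tensor_map (A.d k) ?w) \<in> negligible"
      using q(2) by (simp add: contracted_diff contracted_tensor_map[OF A.linear_d w] scaleC_one)
    then have "z - tensor_map (A.d k) ?w \<in> rel (A.gens k)"
      by (simp add: rel_iff_negligible[OF tensor_free_diff[OF z tw]])
    then show "z \<in> ?B" using w by (force simp: tensor_boundaries_def)
  qed
  have bd_diff: "reduced_boundary ?R k (p - q)" if "reduced_boundary ?R k p" "reduced_boundary ?R k q" for p q
  proof -
    from that obtain x y where x: "x \<in> A.F (Suc k)" "p - A.d k x \<in> negligible"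
      and y: "y \<in> A.F (Suc k)" "q - A.d k y \<in> negligible" by (auto simp: reduced_boundary_def)
    have "(p - q) - A.d k (x - y) = (p - A.d k x) - (q - A.d k y)"
      using linear_on_diff[OF A.linear_d x(1) y(1)] by simp
    then show ?thesis
      unfolding reduced_boundary_def using negligible_closed(3)[OF x(2) y(2)] diff_in_free_mod[OF x(1) y(1)] by metis
  qed
  have bd0: "reduced_boundary ?R k 0"
    unfolding reduced_boundary_def
    using linear_on_zero[OF A.linear_d[of k]] negligible_closed(1) zero_in_free_mod by (intro bexI[of _ 0]) simp_all
  have Z0: "0 \<in> ?Z"
    unfolding Z using linear_on_zero[OF A.linear_d]
    by (auto simp: tensor_free_def reduced_cycle_def zero_in_free_mod negligible_closed(1))
  have tf: "z \<in> tensor_free ?M (A.F k)" if "z \<in> ?Z" for z using that Z by blast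
  have "is_singleton (?Z // ?r) \<longleftrightarrow> ?Z \<subseteq> ?B"
  proof
    assume ZB: "?Z \<subseteq> ?B"
    have "x - y \<in> ?B" if "x \<in> ?Z" "y \<in> ?Z" for x y
      using that ZB bd_diff tf by (simp add: B tensor_free_diff contracted_diff subset_iff)
    then have "?r = ?Z \<times> ?Z" by auto
    then have "?Z // ?r = {?Z}" using Z0 by (auto simp: quotient_def)
    then show "is_singleton (?Z // ?r)" by simp
  next
    assume "is_singleton (?Z // ?r)"
    then obtain C where C: "?Z // ?r = {C}" by (auto simp: is_singleton_def)
    show "?Z \<subseteq> ?B"
    proof
      fix z assume z: "z \<in> ?Z"
      have "?r `` {z} = ?r `` {0}" using C z Z0 quotientI[of z ?Z ?r] quotientI[of 0 ?Z ?r] by simp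
      moreover have "(z, z) \<in> ?r" using z bd0 B[OF tf[OF Z0]] by simp
      ultimately have "(0, z) \<in> ?r" by blast
      then have "reduced_boundary ?R k (0 - contracted z)"
        using B[of "0 - z"] tensor_free_diff[OF tf[OF Z0] tf[OF z]] contracted_diff[of 0 z] by simp
      from bd_diff[OF bd0 this] show "z \<in> ?B" by (simp add: B[OF tf[OF z]])
    qed
  qed
  then have "tor_nonzero k ?M (dual_act (char_module l)) act \<longleftrightarrow> (\<exists>z\<in>?Z. z \<notin> ?B)"
    by (auto simp: tor_nonzero_def tor_def Let_def)
  also have "\<dots> \<longleftrightarrow> (\<exists>p. reduced_cycle ?R k p \<and> \<not> reduced_boundary ?R k p)"
  proof
    assume "\<exists>z\<in>?Z. z \<notin> ?B"
    then show "\<exists>p. reduced_cycle ?R k p \<and> \<not> reduced_boundary ?R k p" using Z B tf by blast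
  next
    assume "\<exists>p. reduced_cycle ?R k p \<and> \<not> reduced_boundary ?R k p"
    then obtain p where p: "reduced_cycle ?R k p" "\<not> reduced_boundary ?R k p" by blast
    let ?z = "frag_of (\<lambda>z :: complex. z, p)"
    have "?z \<in> tensor_free ?M (A.F k)" using p(1) by (intro frag_of_in) (simp add: reduced_cycle_def)
    moreover have "contracted ?z = p" by (simp add: scaleC_one)
    ultimately have "?z \<in> ?Z" "?z \<notin> ?B" using p by (simp_all add: Z B)
    then show "\<exists>z\<in>?Z. z \<notin> ?B" by blast
  qed
  finally show ?thesis .
qed

end

section \<open>The Taylor spectrum of the trivial module\<close>

context ideal_flag
begin

text \<open>Evaluation of the coefficients by \<open>char_eval l\<close> intertwines the two
  differentials, has \<open>negligible\<close> as its kernel, and is split by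
  \<open>lift\<close>.\<close>

lemma koszul_reduced_iff:
  assumes l: "lie_character l"
  shows "(\<exists>p. ring_character.reduced_cycle (char_eval l) koszul_resolution k p \<and>
      \<not> ring_character.reduced_boundary (char_eval l) koszul_resolution k p) \<longleftrightarrow>
    (\<exists>p\<in>koszul_complex.homog n k. char_diff l p = 0 \<and> p \<notin> char_diff l ` koszul_complex.homog n (Suc k))"
proof -
  interpret K: koszul_complex b n \<xi> "\<lambda>x u. u * uea_incl x" by (rule koszul_complex_uea)
  interpret C: koszul_complex b n \<xi> "\<lambda>x m. l x * m" by (rule koszul_complex_character[OF l])
  interpret ring_character "char_eval l" by unfold_locales (rule char_eval_ring[OF l])+
  let ?ev = "coeff_map (char_eval l) :: (nat set \<Rightarrow>\<^sub>0 'g uea) \<Rightarrow> _"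
  define lift :: "(nat set \<Rightarrow>\<^sub>0 complex) \<Rightarrow> (nat set \<Rightarrow>\<^sub>0 'g uea)" where "lift = coeff_map (\<lambda>z. z *\<^sub>C 1)"
  have gens: "free_mod (res_gens koszul_resolution k) = K.homog k" for k
    by (simp add: koszul_resolution_def free_mod_def K.homog_def)
  have d: "res_diff koszul_resolution k = K.diff" for k by (simp add: koszul_resolution_def)
  note lin = clinear_char_eval[OF l]
  have neg: "p \<in> negligible \<longleftrightarrow> ?ev p = 0" for p :: "nat set \<Rightarrow>\<^sub>0 'g uea"
    by (simp add: negligible_def poly_mapping_eq_iff fun_eq_iff lookup_coeff_map clinear_zero[OF lin])
  have ev_diff: "?ev (K.diff p) = C.diff (?ev p)" for p
  proof -
    have "?ev (K.R_ext x q) = C.R_ext x (?ev q)" for x q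
      by (rule poly_mapping_eqI)
        (simp add: K.R_ext_def C.R_ext_def lookup_coeff_map clinear_zero[OF lin] char_eval_ring[OF l] char_eval_incl[OF l])
    then show ?thesis
      by (simp add: K.diff_def C.diff_def clinear_sum[OF clinear_coeff_map[OF lin]] clinear_diff[OF clinear_coeff_map[OF lin]]
        clinear_scale[OF clinear_coeff_map[OF lin]] ad_ext_coeff_map[OF lin] contract_coeff_map[OF lin])
  qed
  have ev_homog: "?ev p \<in> C.homog k" if "p \<in> K.homog k" for p k
    using that keys_coeff_map[of "char_eval l" p] by (simp add: K.homog_def C.homog_def)
  have lift_homog: "lift c \<in> K.homog k" if "c \<in> C.homog k" for c k
    using that keys_coeff_map[of "\<lambda>z. z *\<^sub>C (1 :: 'g uea)" c] by (simp add: K.homog_def C.homog_def lift_def)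
  have ev_lift: "?ev (lift c) = c" for c
    by (rule poly_mapping_eqI)
      (simp add: lift_def lookup_coeff_map clinear_zero[OF lin] char_eval_scaleC[OF l] char_eval_ring[OF l])
  have cyc: "reduced_cycle koszul_resolution k p \<longleftrightarrow> p \<in> K.homog k \<and> C.diff (?ev p) = 0" for p
  proof (cases k)
    case 0
    have "K.diff p = 0" if "p \<in> K.homog 0" using that K.diff_degree_proj_zero[of p] by (simp add: K.homog_iff)
    then show ?thesis
      using 0 by (auto simp: reduced_cycle_def gens clinear_zero[OF clinear_coeff_map[OF lin]] simp flip: ev_diff)
  qed (simp add: reduced_cycle_def gens d neg ev_diff)
  have bd: "reduced_boundary koszul_resolution k p \<longleftrightarrow> ?ev p \<in> C.diff ` C.homog (Suc k)" for p
  proof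
    assume "reduced_boundary koszul_resolution k p"
    then obtain q where q: "q \<in> K.homog (Suc k)" "p - K.diff q \<in> negligible" by (auto simp: reduced_boundary_def gens d)
    then have "?ev p = C.diff (?ev q)" by (simp add: neg clinear_diff[OF clinear_coeff_map[OF lin]] ev_diff)
    then show "?ev p \<in> C.diff ` C.homog (Suc k)" using ev_homog[OF q(1)] by blast
  next
    assume "?ev p \<in> C.diff ` C.homog (Suc k)"
    then obtain c where c: "c \<in> C.homog (Suc k)" "?ev p = C.diff c" by blast
    then have "p - K.diff (lift c) \<in> negligible" by (simp add: neg clinear_diff[OF clinear_coeff_map[OF lin]] ev_diff ev_lift)
    then show "reduced_boundary koszul_resolution k p"
      using lift_homog[OF c(1)] by (auto simp: reduced_boundary_def gens d)
  qed
  show ?thesis unfolding cyc bd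
  proof
    assume "\<exists>p. (p \<in> K.homog k \<and> C.diff (?ev p) = 0) \<and> ?ev p \<notin> C.diff ` C.homog (Suc k)"
    then show "\<exists>p\<in>C.homog k. C.diff p = 0 \<and> p \<notin> C.diff ` C.homog (Suc k)" using ev_homog by blast
  next
    assume "\<exists>p\<in>C.homog k. C.diff p = 0 \<and> p \<notin> C.diff ` C.homog (Suc k)"
    then obtain c where "c \<in> C.homog k" "C.diff c = 0" "c \<notin> C.diff ` C.homog (Suc k)" by blast
    then show "\<exists>p. (p \<in> K.homog k \<and> C.diff (?ev p) = 0) \<and> ?ev p \<notin> C.diff ` C.homog (Suc k)"
      using lift_homog by (intro exI[of _ "lift c"]) (simp add: ev_lift)
  qed
qed

lemma simple_char_module: "lie_character l \<Longrightarrow> simple_module (char_module l)"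
proof -
  assume l: "lie_character l"
  have "W = {0} \<or> W = UNIV" if W: "csubspace W" for W :: "complex set"
  proof (cases "W \<subseteq> {0}")
    case True
    then show ?thesis using complex_vector.subspace_0[OF W] by blast
  next
    case False
    then obtain w where w: "w \<in> W" "w \<noteq> 0" by blast
    have "z \<in> W" for z using complex_vector.subspace_scale[OF W w(1), of "z / w"] w(2) by simp
    then show ?thesis by blast
  qed
  moreover have "(UNIV :: complex set) \<noteq> {0}" by (metis UNIV_I singletonD zero_neq_one)
  ultimately show ?thesis using lie_module_char[OF l] by (simp add: simple_module_def)
qed

lemma finite_dimensional_complex: "finite_dimensional TYPE(complex)"
proof -
  have "z \<in> cspan {1}" for z :: complex
    using complex_vector.span_scale[OF complex_vector.span_base[of "1 :: complex" "{1}"], of z] by simp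
  then show ?thesis unfolding finite_dimensional_def by (intro exI[of _ "{1}"]) auto
qed

text \<open>The chosen resolution is exchanged for the Koszul resolution in each degree; after that
  the degree is dropped by \<open>homology_nonzero_iff\<close>.\<close>

theorem in_taylor_spectrum_iff:
  assumes l: "lie_character l"
  shows "in_taylor_spectrum (char_module l) (trivial_module :: 'g \<Rightarrow> complex \<Rightarrow> complex) \<longleftrightarrow>
    (\<exists>p\<in>ext n. char_diff l p = 0 \<and> p \<notin> char_diff l ` ext n)"
proof -
  interpret C: koszul_complex b n \<xi> "\<lambda>x m. l x * m" by (rule koszul_complex_character[OF l])
  interpret ring_character "char_eval l" by unfold_locales (rule char_eval_ring[OF l])+
  let ?act = "uea_act (trivial_module :: 'g \<Rightarrow> complex \<Rightarrow> complex)"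
  have lm: "left_module ?act" by (rule left_module_uea_act[OF trivial_lie_module])
  note res = free_resolution_chosen[OF lm] free_resolution_koszul
  have "(\<exists>p. reduced_cycle (chosen_resolution ?act) k p \<and> \<not> reduced_boundary (chosen_resolution ?act) k p) \<longleftrightarrow>
      (\<exists>p. reduced_cycle koszul_resolution k p \<and> \<not> reduced_boundary koszul_resolution k p)" for k
    using reduced_homology_transfer[OF res(1) res(2), of k] reduced_homology_transfer[OF res(2) res(1), of k] by blast
  then have "(\<exists>k. tor_nonzero k dual_space (dual_act (char_module l)) ?act) \<longleftrightarrow>
      (\<exists>k. \<exists>p\<in>C.homog k. C.diff p = 0 \<and> p \<notin> C.diff ` C.homog (Suc k))"
    by (simp only: tor_nonzero_iff_reduced[OF l lm] koszul_reduced_iff[OF l])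
  then show ?thesis
    unfolding in_taylor_spectrum_def
    by (simp only: C.homology_nonzero_iff simple_char_module[OF l] finite_dimensional_complex simp_thms)
qed

end

lemma sum_fun_apply: "(\<Sum>i\<in>A. f i) x = (\<Sum>i\<in>A. f i x :: 'b::comm_monoid_add)"
  by (induction A rule: infinite_finite_induct) simp_all

theorem theorem4p1:
  fixes \<mu> :: "'g::complex_lie_algebra \<Rightarrow> complex" and n :: nat
  assumes "finite_dimensional TYPE('g)"
    and "complex_vector.dim (UNIV :: 'g set) = n"
    and "solvable TYPE('g)"
    and "\<mu> \<in> taylor_spectrum trivial_module"
  shows "(\<exists>\<chi>s. length \<chi>s \<le> n \<and> set \<chi>s \<subseteq> jordan_hoelder_values \<and> \<mu> = sum_list \<chi>s) \<and>
    two_rho - \<mu> \<in> taylor_spectrum trivial_module"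
proof -
  \<comment> \<open>The same choice as in the definition of \<open>two_rho\<close>, so that
    \<open>two_rho\<close> becomes \<open>ad_trace\<close> below.\<close>
  define bs where "bs = (SOME bs. triangular_basis (bracket :: 'g \<Rightarrow> 'g \<Rightarrow> 'g) bs)"
  have tri: "triangular_basis (bracket :: 'g \<Rightarrow> 'g \<Rightarrow> 'g) bs"
    unfolding bs_def by (rule someI_ex, rule lie_triangular_basis[OF assms(1,3,1) lie_module_bracket])
  then have bs: "distinct bs" "complex_vector.independent (set bs)" "cspan (set bs) = UNIV"
    and flag: "\<And>x j. j < length bs \<Longrightarrow> bracket x (bs ! j) \<in> cspan (set (take (Suc j) bs))"
    by (auto simp: triangular_basis_def)
  have len: "length bs = n"
    using complex_vector.dim_eq_card[of "set bs" UNIV] bs assms(2) by (simp add: distinct_card)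
  define \<xi> where "\<xi> i x = complex_vector.representation (set bs) x (bs ! i)" for i x
  interpret ideal_flag "\<lambda>i. bs ! i" n \<xi>
  proof (rule ideal_flag.intro)
    show "clinear (\<xi> i)" for i
      unfolding \<xi>_def
      by (rule clinearI) (simp_all add: bs complex_vector.representation_add complex_vector.representation_scale)
    show "(\<Sum>i<n. \<xi> i x *\<^sub>C bs ! i) = x" for x
    proof -
      have "(\<Sum>i<n. \<xi> i x *\<^sub>C bs ! i) = (\<Sum>v\<in>set bs. complex_vector.representation (set bs) x v *\<^sub>C v)"
        unfolding \<xi>_def
        by (rule sum.reindex_bij_betw[OF bij_betw_nth[OF bs(1)]]) (simp_all add: len)
      then show ?thesis using complex_vector.sum_representation_eq[OF bs(2), of x "set bs"] bs(3) by simp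
    qed
    show "\<xi> i (bs ! j) = (if i = j then 1 else 0)" if "i < n" "j < n" for i j
      using that bs(1) by (simp add: \<xi>_def complex_vector.representation_basis[OF bs(2)] len nth_eq_iff_index_eq)
    \<comment> \<open>Triangularity confines \<open>bracket x (bs ! j)\<close> to the span of the
      first \<open>j + 1\<close> vectors, so later coordinates vanish.\<close>
    show "\<xi> k (bracket x (bs ! j)) = 0" if "j < n" "k < n" "j < k" for j k x
    proof (rule ccontr)
      assume "\<xi> k (bracket x (bs ! j)) \<noteq> 0"
      then have "complex_vector.representation (set (take (Suc j) bs)) (bracket x (bs ! j)) (bs ! k) \<noteq> 0"
        using complex_vector.representation_extend[OF bs(2) flag[of j x] set_take_subset] that len by (simp add: \<xi>_def)
      then have "bs ! k \<in> set (take (Suc j) bs)" by (rule complex_vector.representation_ne_zero)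
      then obtain i where "i < Suc j" "i < n" "bs ! i = bs ! k" by (auto simp: in_set_conv_nth len)
      then show False using that bs(1) by (simp add: nth_eq_iff_index_eq len)
    qed
  qed
  have jh: "jh_value i = diagonal_entry bracket bs i" for i
    by (simp add: fun_eq_iff jh_value_def diagonal_entry_def \<xi>_def)
  then have jh_in: "jh_value i \<in> jordan_hoelder_values" if "i < n" for i
    using that tri len unfolding jordan_hoelder_values_def weights_def by blast
  have rho: "two_rho = ad_trace"
    by (simp add: fun_eq_iff two_rho_def bs_def[symmetric] Let_def sum_fun_apply ad_trace_def jh len)
  have \<mu>: "lie_character \<mu>" "in_taylor_spectrum (char_module \<mu>) (trivial_module :: 'g \<Rightarrow> complex \<Rightarrow> complex)"
    using assms(4) by (simp_all add: taylor_spectrum_def)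
  then obtain p where p: "p \<in> ext n" "char_diff \<mu> p = 0" "p \<notin> char_diff \<mu> ` ext n"
    using in_taylor_spectrum_iff by blast
  obtain A where A: "A \<subseteq> {..<n}" "\<mu> = (\<lambda>x. \<Sum>i\<in>A. jh_value i x)" using char_homology_weight[OF \<mu>(1) p] by blast
  have "finite A" using A(1) finite_subset by blast
  \<comment> \<open>The indices in \<open>A\<close> are distinct, hence there are at most
    \<open>n\<close> summands, although the values themselves may coincide.\<close>
  let ?\<chi>s = "map jh_value (sorted_list_of_set A)"
  have "\<mu> = sum_list ?\<chi>s"
    using \<open>finite A\<close> by (simp add: A(2) sum_list_distinct_conv_sum_set sum_fun_apply fun_eq_iff)
  moreover have "length ?\<chi>s \<le> n" using card_mono[OF _ A(1)] by simp
  moreover have "set ?\<chi>s \<subseteq> jordan_hoelder_values" using A(1) \<open>finite A\<close> jh_in by auto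
  moreover have \<nu>: "lie_character (two_rho - \<mu>)" unfolding rho by (rule ad_trace_diff_character[OF \<mu>(1)])
  moreover have "\<exists>q\<in>ext n. char_diff (two_rho - \<mu>) q = 0 \<and> q \<notin> char_diff (two_rho - \<mu>) ` ext n"
    by (rule char_homology_duality[OF \<mu>(1) \<nu> _ p]) (simp add: rho)
  then have "two_rho - \<mu> \<in> taylor_spectrum trivial_module"
    using in_taylor_spectrum_iff[OF \<nu>] \<nu> by (simp add: taylor_spectrum_def del: minus_apply)
  ultimately show ?thesis by blast
qed

end
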